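(* Let $(u,p)\in V\times Q$ be the solution of the Stokes problem with right-hand side $g\in L^2(\Omega)^2$, let $\sigma:=\mu\nabla u+p\,\mathrm{id}$ with $\mathrm{id}\in\mathbb R^{2\times2}$ the identity matrix, and for a refinement $\mathcal T$ of the initial mesh $\mathcal T_0$ by newest vertex bisection define the consistency error $$\kappa(\sigma,\mathcal T):=\sup_{0\ne v_{\mathcal T}\in V_{\mathcal T}}\frac{(g,v_{\mathcal T})_{L^2(\Omega)}-(\sigma,\nabla_{\mathcal T}v_{\mathcal T})_{L^2(\Omega)}}{\|\nabla_{\mathcal T}v_{\mathcal T}\|_{L^2(\Omega)}}.$$ Then there is a constant $C>0$, independent of the mesh $\mathcal T$, such that $$\kappa(\sigma,\mathcal T)\le C\Big(\inf_{(v_{\mathcal T},q_{\mathcal T})\in V_{\mathcal T}\times Q_{\mathcal T}}|||u-v_{\mathcal T},p-q_{\mathcal T}|||_{\mathcal T}+\operatorname{osc}(g,\mathcal T)\Big).$$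
   Context: Stokes problem: $\Omega\subset\mathbb R^2$ is a polygonal domain, $\mu>0$, $g\in L^2(\Omega)^2$, $V:=(H_0^1(\Omega))^2$, $Q:=L^2_0(\Omega)=\{q\in L^2(\Omega):\int_\Omega q\,dx=0\}$, $a(u,v):=\mu(\nabla u,\nabla v)_{L^2(\Omega)}$, $b(v,q):=(\operatorname{div}v,q)_{L^2(\Omega)}$; $(u,p)\in V\times Q$ satisfies $a(u,v)+b(v,p)+b(u,q)=(g,v)_{L^2(\Omega)}$ for all $(v,q)\in V\times Q$. Meshes and spaces: $\mathcal T_0$ is an initial shape-regular (conforming) triangulation of $\overline\Omega$ into triangles; $\mathcal T$ is a conforming refinement of it. $h_K:=|K|^{1/2}$; $[v]$ is the jump across an edge (for a boundary edge, the trace); $\nabla_{\mathcal T},\operatorname{div}_{\mathcal T}$ are the element-by-element operators. $V_{\mathcal T}:=\{v\in L^2(\Omega)^2: v|_K\in P_1(K)^2\ \forall K\in\mathcal T,\ \int_E[v]\,ds=0$ for all interior edges $E$, $\int_Ev\,ds=0$ for all edges $E\subset\partial\Omega\}$; $Q_{\mathcal T}:=\{q\in Q: q|_K\in P_0(K)\ \forall K\in\mathcal T\}$. $\operatorname{osc}^2(g,\mathcal T):=\sum_{K\in\mathcal T}h_K^2\|g-g_K\|_{L^2(K)}^2$ with $g_K$ the $L^2$ projection of $g$ onto constants on $K$. Energy norm: $|||v,q|||_{\mathcal T}^2:=\|\nabla_{\mathcal T}v\|_{L^2(\Omega)}^2+\gamma_1\|q\|_{L^2(\Omega)}^2$, where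 $\gamma_1>0$ is a fixed, mesh-independent weight (on which $C$ may depend), chosen so that for some $\gamma_2,\beta_1>0$, $0<\alpha<1$ the quantities $X_k:=\|\nabla_k(u-u_k)\|^2_{L^2(\Omega)}+\gamma_1\|p-p_k\|^2_{L^2(\Omega)}+\gamma_2\sum_{K\in\mathcal T_k}(\beta_1h_K^2\|g\|^2_{L^2(K)}+\eta_K^2(u_k,p_k))$ satisfy $X_k\le\alpha X_{k-1}$ for consecutive meshes of the following adaptive algorithm. Here $\nabla_k=\nabla_{\mathcal T_k}$; $(u_k,p_k)\in V_{\mathcal T_k}\times Q_{\mathcal T_k}$ solves $\mu(\nabla_ku_k,\nabla_kv)_{L^2(\Omega)}+(\operatorname{div}_{\mathcal T_k}v,p_k)_{L^2(\Omega)}+(\operatorname{div}_{\mathcal T_k}u_k,q)_{L^2(\Omega)}=(g,v)_{L^2(\Omega)}$ for all $(v,q)\in V_{\mathcal T_k}\times Q_{\mathcal T_k}$; $\eta_K(u_k,p_k):=h_K\|g\|_{L^2(K)}+\big(\sum_{E\subset\partial K}h_K\|[\nabla_ku_k\,\tau_E]\|_{L^2(E)}^2\big)^{1/2}$ with $\tau_E$ a unit tangent to $E$; and $\mathcal T_{k+1}$ is obtained from $\mathcal T_k$ by newest vertex bisection (with conformity completion) of a set $\mathcal M_k\subset\mathcal T_k$ of minimal cardinality with $\sum_{K\in\mathcal M_k}\eta_K^2(u_k,p_k)\ge\theta\sum_{K\in\mathcal T_k}\eta_K^2(u_k,p_k)$, for a fixed $0<\theta<1$. *)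

theory Defs
  imports "HOL-Analysis.Analysis"
begin

type_synonym point = "real^2"
type_synonym vfield = "real^2 \<Rightarrow> real^2"
type_synonym tensor_field = "real^2 \<Rightarrow> real^2^2"

section \<open>Lebesgue and Sobolev spaces\<close>

text \<open>Elements of the function spaces are represented by functions on the whole plane, of which
  only the values almost everywhere on the domain matter. The inner product of type
  \<^typ>\<open>real^2^2\<close> is the Frobenius product.\<close>

definition L2 :: "point set \<Rightarrow> (point \<Rightarrow> 'b::euclidean_space) \<Rightarrow> bool" where
  "L2 U f \<longleftrightarrow> f \<in> borel_measurable (lebesgue_on U) \<and>
     integrable (lebesgue_on U) (\<lambda>x. (norm (f x))\<^sup>2)"

definition l2inner :: "point set \<Rightarrow> (point \<Rightarrow> 'b::euclidean_space) \<Rightarrow> (point \<Rightarrow> 'b) \<Rightarrow> real" where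
  "l2inner U f g = (LINT x|lebesgue_on U. f x \<bullet> g x)"

definition l2norm :: "point set \<Rightarrow> (point \<Rightarrow> 'b::euclidean_space) \<Rightarrow> real" where
  "l2norm U f = sqrt (l2inner U f f)"

definition pderiv_at :: "2 \<Rightarrow> (point \<Rightarrow> real) \<Rightarrow> point \<Rightarrow> real" where
  "pderiv_at j f x = frechet_derivative f (at x) (axis j 1)"

primrec Ck :: "nat \<Rightarrow> (point \<Rightarrow> real) \<Rightarrow> bool" where
  "Ck 0 f \<longleftrightarrow> continuous_on UNIV f"
| "Ck (Suc n) f \<longleftrightarrow> (\<forall>x. f differentiable (at x)) \<and> (\<forall>j. Ck n (pderiv_at j f))"

definition test_fun :: "point set \<Rightarrow> (point \<Rightarrow> real) \<Rightarrow> bool" where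
  "test_fun U \<phi> \<longleftrightarrow> (\<forall>n. Ck n \<phi>) \<and>
     compact (closure {x. \<phi> x \<noteq> 0}) \<and> closure {x. \<phi> x \<noteq> 0} \<subseteq> U"

text \<open>Row \<open>i\<close> of the gradient is the gradient of the \<open>i\<close>-th component.\<close>

definition weak_gradient :: "point set \<Rightarrow> vfield \<Rightarrow> tensor_field \<Rightarrow> bool" where
  "weak_gradient U v G \<longleftrightarrow> L2 U G \<and>
     (\<forall>\<phi>. test_fun U \<phi> \<longrightarrow> (\<forall>i j.
        (LINT x|lebesgue_on U. v x $ i * pderiv_at j \<phi> x) =
        - (LINT x|lebesgue_on U. G x $ i $ j * \<phi> x)))"

definition grad :: "point set \<Rightarrow> vfield \<Rightarrow> tensor_field" where
  "grad U v = (SOME G. weak_gradient U v G)"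

definition H1 :: "point set \<Rightarrow> vfield \<Rightarrow> bool" where
  "H1 U v \<longleftrightarrow> L2 U v \<and> (\<exists>G. weak_gradient U v G)"

definition H1_norm :: "point set \<Rightarrow> vfield \<Rightarrow> real" where
  "H1_norm U v = sqrt ((l2norm U v)\<^sup>2 + (l2norm U (grad U v))\<^sup>2)"

definition V_space :: "point set \<Rightarrow> vfield set" where
  "V_space \<Omega> = {v. H1 \<Omega> v \<and>
     (\<exists>w :: nat \<Rightarrow> vfield. (\<forall>n i. test_fun \<Omega> (\<lambda>x. w n x $ i)) \<and>
        (\<lambda>n. H1_norm \<Omega> (\<lambda>x. v x - w n x)) \<longlonglongrightarrow> 0)}"

definition Q_space :: "point set \<Rightarrow> (point \<Rightarrow> real) set" where
  "Q_space \<Omega> = {q. L2 \<Omega> q \<and> (LINT x|lebesgue_on \<Omega>. q x) = 0}"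

section \<open>The Stokes problem\<close>

text \<open>The condition \<open>interior (closure \<Omega>) = \<Omega>\<close> excludes slits, which a triangulation of the
  closure cannot resolve.\<close>

definition polygonal_domain :: "point set \<Rightarrow> bool" where
  "polygonal_domain \<Omega> \<longleftrightarrow> open \<Omega> \<and> connected \<Omega> \<and> bounded \<Omega> \<and> \<Omega> \<noteq> {} \<and>
     interior (closure \<Omega>) = \<Omega> \<and>
     (\<exists>S. finite S \<and> frontier \<Omega> = (\<Union>(a, b)\<in>S. closed_segment a b))"

definition stokes_solution ::
  "point set \<Rightarrow> real \<Rightarrow> vfield \<Rightarrow> vfield \<Rightarrow> (point \<Rightarrow> real) \<Rightarrow> bool" where
  "stokes_solution \<Omega> \<mu> g u p \<longleftrightarrow> u \<in> V_space \<Omega> \<and> p \<in> Q_space \<Omega> \<and>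
     (\<forall>v\<in>V_space \<Omega>. \<forall>q\<in>Q_space \<Omega>.
        \<mu> * l2inner \<Omega> (grad \<Omega> u) (grad \<Omega> v)
        + l2inner \<Omega> (\<lambda>x. trace (grad \<Omega> v x)) p
        + l2inner \<Omega> (\<lambda>x. trace (grad \<Omega> u x)) q
        = l2inner \<Omega> g v)"

definition stress :: "point set \<Rightarrow> real \<Rightarrow> vfield \<Rightarrow> (point \<Rightarrow> real) \<Rightarrow> tensor_field" where
  "stress \<Omega> \<mu> u p = (\<lambda>x. \<mu> *\<^sub>R grad \<Omega> u x + p x *\<^sub>R mat 1)"

section \<open>Triangulations and newest vertex bisection\<close>

text \<open>A triple \<open>(a, b, c)\<close> is the triangle with vertices \<open>a\<close>, \<open>b\<close>, \<open>c\<close> whose newest vertex is \<open>a\<close>,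
  so that its refinement edge joins \<open>b\<close> and \<open>c\<close>. For the triangles of an initial mesh the newest
  vertex is an arbitrary choice.\<close>

type_synonym tri = "point \<times> point \<times> point"

fun hull_of :: "tri \<Rightarrow> point set" where
  "hull_of (a, b, c) = convex hull {a, b, c}"

fun edges :: "tri \<Rightarrow> (point \<times> point) set" where
  "edges (a, b, c) = {(a, b), (b, c), (c, a)}"

definition mesh_size :: "tri \<Rightarrow> real" where
  "mesh_size K = sqrt (measure lebesgue (hull_of K))"

text \<open>Injectivity excludes that a triangle occurs in a mesh with two labellings. Shape regularity
  of one such (finite) mesh is automatic.\<close>

definition conforming_mesh :: "point set \<Rightarrow> tri set \<Rightarrow> bool" where
  "conforming_mesh \<Omega> \<T> \<longleftrightarrow> finite \<T> \<and> inj_on hull_of \<T> \<and> (\<forall>K\<in>\<T>. 2 simplex hull_of K) \<and>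
     triangulation (hull_of ` \<T>) \<and> (\<Union>K\<in>\<T>. hull_of K) = closure \<Omega>"

fun children :: "tri \<Rightarrow> tri set" where
  "children (a, b, c) = {(midpoint b c, a, b), (midpoint b c, c, a)}"

definition bisect_step :: "tri set \<Rightarrow> tri set \<Rightarrow> bool" where
  "bisect_step \<T> \<T>' \<longleftrightarrow> (\<exists>K\<in>\<T>. \<T>' = (\<T> - {K}) \<union> children K)"

text \<open>Meshes on the way from \<open>\<T>\<close> to \<open>\<T>'\<close> may have hanging nodes.\<close>

definition nvb_refinement :: "point set \<Rightarrow> tri set \<Rightarrow> tri set \<Rightarrow> bool" where
  "nvb_refinement \<Omega> \<T> \<T>' \<longleftrightarrow> bisect_step\<^sup>*\<^sup>* \<T> \<T>' \<and> conforming_mesh \<Omega> \<T>'"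

text \<open>Bisection of the marked triangles followed by conformity completion yields the coarsest
  conforming refinement in which no marked triangle is left.\<close>

definition nvb_refine :: "point set \<Rightarrow> tri set \<Rightarrow> tri set \<Rightarrow> tri set \<Rightarrow> bool" where
  "nvb_refine \<Omega> \<T> \<M> \<T>' \<longleftrightarrow> nvb_refinement \<Omega> \<T> \<T>' \<and> \<M> \<inter> \<T>' = {} \<and>
     (\<forall>\<T>''. nvb_refinement \<Omega> \<T> \<T>'' \<and> \<M> \<inter> \<T>'' = {} \<longrightarrow> bisect_step\<^sup>*\<^sup>* \<T>' \<T>'')"

section \<open>Nonconforming finite element spaces\<close>

definition affine_field :: "vfield \<Rightarrow> bool" where
  "affine_field A \<longleftrightarrow> (\<exists>M c. \<forall>x. A x = M *v x + c)"

text \<open>\<open>poly_on v K\<close> is the polynomial representing \<open>v\<close> on \<open>K\<close>; it provides the traces on edges.\<close>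

definition poly_on :: "vfield \<Rightarrow> tri \<Rightarrow> vfield" where
  "poly_on v K = (THE A. affine_field A \<and> (AE x in lebesgue_on (hull_of K). v x = A x))"

definition broken_grad :: "tri set \<Rightarrow> vfield \<Rightarrow> tensor_field" where
  "broken_grad \<T> v = (SOME G. \<forall>K\<in>\<T>. weak_gradient (interior (hull_of K)) v G)"

definition broken_div :: "tri set \<Rightarrow> vfield \<Rightarrow> point \<Rightarrow> real" where
  "broken_div \<T> v x = trace (broken_grad \<T> v x)"

definition edge_integral :: "point \<times> point \<Rightarrow> (point \<Rightarrow> 'b::euclidean_space) \<Rightarrow> 'b" where
  "edge_integral E f =
     dist (fst E) (snd E) *\<^sub>R integral {0..1} (\<lambda>t. f (linepath (fst E) (snd E) t))"

definition tangent :: "point \<times> point \<Rightarrow> point" where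
  "tangent E = (snd E - fst E) /\<^sub>R dist (fst E) (snd E)"

definition neighbours :: "tri set \<Rightarrow> tri \<Rightarrow> point \<times> point \<Rightarrow> tri set" where
  "neighbours \<T> K E = {K'\<in>\<T>. K' \<noteq> K \<and> (E \<in> edges K' \<or> prod.swap E \<in> edges K')}"

text \<open>Jump across the edge \<open>E\<close> of \<open>K\<close> of the piecewise function which equals \<open>w K\<close> on \<open>K\<close>. As \<open>E\<close>
  belongs to at most one further triangle, the sum has at most one term; it is empty for a
  boundary edge, where the jump is the trace.\<close>

definition jump ::
  "tri set \<Rightarrow> tri \<Rightarrow> point \<times> point \<Rightarrow> (tri \<Rightarrow> point \<Rightarrow> 'b::euclidean_space) \<Rightarrow> point \<Rightarrow> 'b" where
  "jump \<T> K E w x = w K x - (\<Sum>K'\<in>neighbours \<T> K E. w K' x)"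

definition V_mesh :: "point set \<Rightarrow> tri set \<Rightarrow> vfield set" where
  "V_mesh \<Omega> \<T> = {v. L2 \<Omega> v \<and>
     (\<forall>K\<in>\<T>. \<exists>A. affine_field A \<and> (AE x in lebesgue_on (hull_of K). v x = A x)) \<and>
     (\<forall>K\<in>\<T>. \<forall>E\<in>edges K.
        (\<not> closed_segment (fst E) (snd E) \<subseteq> frontier \<Omega> \<longrightarrow>
           edge_integral E (jump \<T> K E (poly_on v)) = 0) \<and>
        (closed_segment (fst E) (snd E) \<subseteq> frontier \<Omega> \<longrightarrow>
           edge_integral E (poly_on v K) = 0))}"

definition Q_mesh :: "point set \<Rightarrow> tri set \<Rightarrow> (point \<Rightarrow> real) set" where
  "Q_mesh \<Omega> \<T> = {q \<in> Q_space \<Omega>. \<forall>K\<in>\<T>. \<exists>c. AE x in lebesgue_on (hull_of K). q x = c}"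

definition l2proj_const :: "tri \<Rightarrow> vfield \<Rightarrow> point" where
  "l2proj_const K g = (THE c. \<forall>d. l2inner (hull_of K) (\<lambda>x. g x - c) (\<lambda>_. d) = 0)"

definition osc :: "vfield \<Rightarrow> tri set \<Rightarrow> real" where
  "osc g \<T> = sqrt (\<Sum>K\<in>\<T>. (mesh_size K)\<^sup>2 * (l2norm (hull_of K) (\<lambda>x. g x - l2proj_const K g))\<^sup>2)"

definition energy_norm ::
  "point set \<Rightarrow> real \<Rightarrow> tri set \<Rightarrow> vfield \<Rightarrow> (point \<Rightarrow> real) \<Rightarrow> real" where
  "energy_norm \<Omega> \<gamma>\<^sub>1 \<T> v q = sqrt ((l2norm \<Omega> (broken_grad \<T> v))\<^sup>2 + \<gamma>\<^sub>1 * (l2norm \<Omega> q)\<^sup>2)"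

text \<open>The supremum is taken in the extended reals, so that an upper bound asserts its finiteness;
  it is \<open>-\<infinity>\<close> if the space is trivial.\<close>

definition consistency_error :: "point set \<Rightarrow> vfield \<Rightarrow> tensor_field \<Rightarrow> tri set \<Rightarrow> ereal" where
  "consistency_error \<Omega> g \<sigma> \<T> =
     (SUP v\<in>{v \<in> V_mesh \<Omega> \<T>. \<not> (AE x in lebesgue_on \<Omega>. v x = 0)}.
        ereal ((l2inner \<Omega> g v - l2inner \<Omega> \<sigma> (broken_grad \<T> v)) / l2norm \<Omega> (broken_grad \<T> v)))"

section \<open>The adaptive algorithm and the weight of the pressure\<close>

definition discrete_solution ::
  "point set \<Rightarrow> real \<Rightarrow> vfield \<Rightarrow> tri set \<Rightarrow> vfield \<Rightarrow> (point \<Rightarrow> real) \<Rightarrow> bool" where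
  "discrete_solution \<Omega> \<mu> g \<T> u p \<longleftrightarrow> u \<in> V_mesh \<Omega> \<T> \<and> p \<in> Q_mesh \<Omega> \<T> \<and>
     (\<forall>v\<in>V_mesh \<Omega> \<T>. \<forall>q\<in>Q_mesh \<Omega> \<T>.
        \<mu> * l2inner \<Omega> (broken_grad \<T> u) (broken_grad \<T> v)
        + l2inner \<Omega> (broken_div \<T> v) p
        + l2inner \<Omega> (broken_div \<T> u) q
        = l2inner \<Omega> g v)"

definition estimator :: "vfield \<Rightarrow> tri set \<Rightarrow> vfield \<Rightarrow> tri \<Rightarrow> real" where
  "estimator g \<T> u K = mesh_size K * l2norm (hull_of K) g +
     sqrt (\<Sum>E\<in>edges K. mesh_size K * edge_integral E
       (\<lambda>x. (norm (jump \<T> K E (\<lambda>K' y. jacobian (poly_on u K') (at y) *v tangent E) x))\<^sup>2))"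

definition bulk_criterion :: "vfield \<Rightarrow> real \<Rightarrow> tri set \<Rightarrow> vfield \<Rightarrow> tri set \<Rightarrow> bool" where
  "bulk_criterion g \<theta> \<T> u \<M> \<longleftrightarrow> \<M> \<subseteq> \<T> \<and>
     (\<Sum>K\<in>\<M>. (estimator g \<T> u K)\<^sup>2) \<ge> \<theta> * (\<Sum>K\<in>\<T>. (estimator g \<T> u K)\<^sup>2)"

definition adaptive_run ::
  "point set \<Rightarrow> real \<Rightarrow> vfield \<Rightarrow> real \<Rightarrow> tri set \<Rightarrow> (nat \<Rightarrow> tri set) \<Rightarrow> (nat \<Rightarrow> vfield) \<Rightarrow>
     (nat \<Rightarrow> point \<Rightarrow> real) \<Rightarrow> bool" where
  "adaptive_run \<Omega> \<mu> g \<theta> \<T>\<^sub>0 Ts us ps \<longleftrightarrow> Ts 0 = \<T>\<^sub>0 \<and>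
     (\<forall>k. discrete_solution \<Omega> \<mu> g (Ts k) (us k) (ps k) \<and>
        (\<exists>\<M>. bulk_criterion g \<theta> (Ts k) (us k) \<M> \<and>
           (\<forall>\<M>'. bulk_criterion g \<theta> (Ts k) (us k) \<M>' \<longrightarrow> card \<M> \<le> card \<M>') \<and>
           nvb_refine \<Omega> (Ts k) \<M> (Ts (Suc k))))"

definition quasi_error ::
  "point set \<Rightarrow> vfield \<Rightarrow> vfield \<Rightarrow> (point \<Rightarrow> real) \<Rightarrow> real \<Rightarrow> real \<Rightarrow> real \<Rightarrow>
     tri set \<Rightarrow> vfield \<Rightarrow> (point \<Rightarrow> real) \<Rightarrow> real" where
  "quasi_error \<Omega> g u p \<gamma>\<^sub>1 \<gamma>\<^sub>2 \<beta>\<^sub>1 \<T> u' p' =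
     (l2norm \<Omega> (broken_grad \<T> (\<lambda>x. u x - u' x)))\<^sup>2 + \<gamma>\<^sub>1 * (l2norm \<Omega> (\<lambda>x. p x - p' x))\<^sup>2
     + \<gamma>\<^sub>2 * (\<Sum>K\<in>\<T>. \<beta>\<^sub>1 * (mesh_size K)\<^sup>2 * (l2norm (hull_of K) g)\<^sup>2 + (estimator g \<T> u' K)\<^sup>2)"

definition contraction_weight ::
  "point set \<Rightarrow> real \<Rightarrow> vfield \<Rightarrow> real \<Rightarrow> tri set \<Rightarrow> vfield \<Rightarrow> (point \<Rightarrow> real) \<Rightarrow> real \<Rightarrow> bool" where
  "contraction_weight \<Omega> \<mu> g \<theta> \<T>\<^sub>0 u p \<gamma>\<^sub>1 \<longleftrightarrow> \<gamma>\<^sub>1 > 0 \<and>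
     (\<exists>\<gamma>\<^sub>2 \<beta>\<^sub>1 \<alpha>. \<gamma>\<^sub>2 > 0 \<and> \<beta>\<^sub>1 > 0 \<and> 0 < \<alpha> \<and> \<alpha> < 1 \<and>
       (\<forall>Ts us ps. adaptive_run \<Omega> \<mu> g \<theta> \<T>\<^sub>0 Ts us ps \<longrightarrow>
         (\<forall>k. quasi_error \<Omega> g u p \<gamma>\<^sub>1 \<gamma>\<^sub>2 \<beta>\<^sub>1 (Ts (Suc k)) (us (Suc k)) (ps (Suc k))
            \<le> \<alpha> * quasi_error \<Omega> g u p \<gamma>\<^sub>1 \<gamma>\<^sub>2 \<beta>\<^sub>1 (Ts k) (us k) (ps k))))"

end

(*
  Every v in the nonconforming space has a conforming companion W in V such that, on each triangle K,
  both v - W and its gradient have mean zero: W is the piecewise affine interpolant of nodal averages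
  of v, corrected by edge bubbles (which fix the edge means, hence the mean of the gradient) and by
  element bubbles. Testing the Stokes problem with W gives, with the piecewise constant stress s_T of
  arbitrary discrete functions and the element means g_K,
    (g, v) - (s, grad v) = sum_K (g - g_K, v - W)_K - (s - s_T, grad (v - W))_K.
  On K the difference v - W is a cubic polynomial controlled by the errors of the nodal averages at the
  vertices of K. These are controlled by grad v, since one can walk between any two triangles at an
  interior vertex, and from any triangle at a boundary vertex to a boundary edge, through edges at that
  vertex: otherwise the triangles reached would cover a punctured neighbourhood of the vertex, being
  open and closed in it. The length of the walk is bounded by shape regularity.

  That W belongs to V is shown by multiplying with a cutoff of the distance to the boundary, which keeps
  the Lipschitz constant bounded because W vanishes there, and by mollification.
*)
theory Submission
  imports Defs
begin

section \<open>Smooth functions\<close>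

text \<open>The stress is only square integrable and has no traces on single edges, so the
  consistency error cannot be integrated by parts element by element into edge terms. The companion
  takes over: it may be tested in the Stokes problem, and the two vanishing means allow constants to
  be subtracted from g and from the stress. The discrete pair that supplies the constants is
  unrelated to v, so the bound holds for every pair before the infimum is taken. The constant
  depends only on shape regularity, \<mu> and the weight of the pressure.

  At a boundary vertex the domain may touch itself, and then the triangles there are not all linked
  through edges. This is why a walk from such a vertex heads for a boundary edge, where the mean is
  zero, and not for another given triangle.

  Gradients and traces are selected by \<open>SOME\<close> and \<open>THE\<close>. Every explicit
  gradient must be identified with the selected one, which rests on the fundamental lemma of the
  calculus of variations and hence on a supply of smooth bumps.\<close>

definition grd :: "(point \<Rightarrow> real) \<Rightarrow> point \<Rightarrow> point" where
  "grd f x = (\<chi> j. pderiv_at j f x)"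

definition smooth :: "(point \<Rightarrow> real) \<Rightarrow> bool" where
  "smooth f \<longleftrightarrow> (\<forall>n. Ck n f)"

lemma pderiv_at_eq: "(f has_derivative f') (at x) \<Longrightarrow> pderiv_at j f x = f' (axis j 1)"
  by (metis pderiv_at_def frechet_derivative_at)

lemma grd_eq: "(f has_derivative (\<lambda>h. l \<bullet> h)) (at x) \<Longrightarrow> grd f x = l"
  by (simp add: grd_def pderiv_at_eq inner_axis vec_eq_iff)

lemma has_derivative_grd:
  assumes "f differentiable (at x)"
  shows "(f has_derivative (\<lambda>h. grd f x \<bullet> h)) (at x)"
proof -
  obtain f' where f': "(f has_derivative f') (at x)"
    using assms differentiable_def by blast
  interpret f': bounded_linear f' by (rule has_derivative_bounded_linear[OF f'])
  have "f' h = grd f x \<bullet> h" for h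
  proof -
    have "f' h = f' (\<Sum>i\<in>UNIV. h $ i *\<^sub>R axis i 1)" by (simp add: basis_expansion[of h, unfolded scalar_mult_eq_scaleR])
    also have "\<dots> = (\<Sum>i\<in>UNIV. h $ i * pderiv_at i f x)"
      by (simp add: f'.sum f'.scaleR pderiv_at_eq[OF f'])
    finally show ?thesis by (simp add: grd_def inner_vec_def mult.commute)
  qed
  then show ?thesis using f' by (metis (no_types, lifting) ext)
qed

lemma Ck_Suc_imp: "Ck (Suc n) f \<Longrightarrow> Ck n f"
proof (induction n arbitrary: f)
  case 0
  then show ?case
    by (auto simp: continuous_on_eq_continuous_at differentiable_imp_continuous_within)
next
  case (Suc n)
  then show ?case by (metis Ck.simps(2))
qed

lemma pderiv_at_add:
  assumes "f differentiable (at x)" "g differentiable (at x)"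
  shows "pderiv_at j (\<lambda>x. f x + g x) x = pderiv_at j f x + pderiv_at j g x"
  by (simp add: pderiv_at_eq[OF has_derivative_add[OF assms[THEN has_derivative_grd]]]
      inner_axis grd_def)

lemma pderiv_at_mult:
  assumes "f differentiable (at x)" "g differentiable (at x)"
  shows "pderiv_at j (\<lambda>x. f x * g x) x = f x * pderiv_at j g x + pderiv_at j f x * g x"
  by (simp add: pderiv_at_eq[OF has_derivative_mult[OF assms[THEN has_derivative_grd]]]
      inner_axis grd_def)

lemma Ck_add: "Ck n f \<Longrightarrow> Ck n g \<Longrightarrow> Ck n (\<lambda>x. f x + g x)"
proof (induction n arbitrary: f g)
  case 0
  then show ?case by (auto intro: continuous_on_add)
next
  case (Suc n)
  then have "pderiv_at j (\<lambda>x. f x + g x) = (\<lambda>x. pderiv_at j f x + pderiv_at j g x)" for j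
    by (auto simp: pderiv_at_add)
  with Suc show ?case by auto
qed

lemma Ck_mult: "Ck n f \<Longrightarrow> Ck n g \<Longrightarrow> Ck n (\<lambda>x. f x * g x)"
proof (induction n arbitrary: f g)
  case 0
  then show ?case by (auto intro: continuous_on_mult)
next
  case (Suc n)
  then have "pderiv_at j (\<lambda>x. f x * g x) = (\<lambda>x. f x * pderiv_at j g x + pderiv_at j f x * g x)" for j
    by (auto simp: pderiv_at_mult)
  with Suc show ?case by (auto intro!: Ck_add simp: Ck_Suc_imp[of n f] Ck_Suc_imp[of n g])
qed

lemma Ck_const: "Ck n (\<lambda>x. c)"
proof (induction n arbitrary: c)
  case (Suc n)
  have "pderiv_at j (\<lambda>x. c) = (\<lambda>x. 0)" for j
    by (rule ext) (simp add: pderiv_at_eq[OF has_derivative_const])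
  then show ?case using Suc by simp
qed auto

lemma smooth_mult: "smooth f \<Longrightarrow> smooth g \<Longrightarrow> smooth (\<lambda>x. f x * g x)"
  by (simp add: smooth_def Ck_mult)

lemma smooth_const: "smooth (\<lambda>x. c)"
  by (simp add: smooth_def Ck_const)

lemma smooth_diff: "smooth f \<Longrightarrow> f differentiable (at x)"
  by (metis smooth_def Ck.simps(2))

lemma smooth_pderiv: "smooth f \<Longrightarrow> smooth (pderiv_at j f)"
  by (metis smooth_def Ck.simps(2))

lemma smooth_continuous: "smooth f \<Longrightarrow> continuous_on S f"
  by (metis smooth_def Ck.simps(1) continuous_on_subset subset_UNIV)

lemma smooth_continuous_grd: "smooth f \<Longrightarrow> continuous_on S (grd f)"
  unfolding grd_def by (intro continuous_on_vec_lambda smooth_continuous smooth_pderiv)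

section \<open>Flat functions and smooth bumps\<close>

text \<open>All the functions exp (-1/t) / t^k are kept in one family because it is closed under
  differentiation up to linear combinations (\<open>flat_deriv\<close>); this makes an induction on
  the order of smoothness possible.\<close>

definition flat :: "nat \<Rightarrow> real \<Rightarrow> real" where
  "flat k t = (if t > 0 then exp (- 1 / t) / t ^ k else 0)"

lemma flat_tendsto_0: "(flat k \<longlongrightarrow> 0) (at 0)"
proof -
  have "((\<lambda>t. flat k t) \<longlongrightarrow> 0) (at_right 0)"
  proof -
    have "((\<lambda>t::real. (inverse t) ^ k / exp (inverse t)) \<longlongrightarrow> 0) (at_right 0)"
      by (rule filterlim_compose[OF tendsto_power_div_exp_0 filterlim_inverse_at_top_right])
    then show ?thesis
      by (rule Lim_transform_eventually)
         (auto simp: eventually_at_right_less flat_def exp_minus field_simps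
               intro!: eventually_at_rightI[of 0 1])
  qed
  moreover have "(flat k \<longlongrightarrow> 0) (at_left 0)"
    by (rule Lim_transform_eventually[of "\<lambda>_. 0"])
       (auto simp: flat_def intro!: eventually_at_leftI[of "-1" 0])
  ultimately show ?thesis by (simp add: filterlim_split_at)
qed

lemma flat_deriv:
  "(flat k has_real_derivative (flat (k + 2) t - k * flat (k + 1) t)) (at t)"
proof (cases t "0::real" rule: linorder_cases)
  case less
  have "((\<lambda>_. 0) has_real_derivative 0) (at t)" by simp
  then have "(flat k has_real_derivative 0) (at t)"
    by (rule DERIV_cong_ev[THEN iffD1, rotated -1, OF _ refl])
       (use less in \<open>auto simp: flat_def eventually_nhds intro!: exI[of _ "{..<0}"]\<close>)
  then show ?thesis using less by (simp add: flat_def)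
next
  case equal
  \<comment> \<open>At 0 the difference quotient of \<open>flat k\<close> is
    \<open>flat (Suc k)\<close> itself.\<close>
  have "((\<lambda>h. (flat k (0 + h) - flat k 0) / h) \<longlongrightarrow> 0) (at 0)"
    by (rule Lim_transform_eventually[OF flat_tendsto_0[of "Suc k"]])
       (auto simp: flat_def)
  then show ?thesis using equal by (simp add: DERIV_def flat_def)
next
  case greater
  have "((\<lambda>t. exp (- 1 / t) / t ^ k) has_real_derivative (flat (k + 2) t - k * flat (k + 1) t)) (at t)"
  proof -
    have pw: "((\<lambda>t. t ^ k) has_real_derivative real k * t ^ k / t) (at t)"
      using greater DERIV_pow[of k t UNIV] by (cases k) auto
    have ex: "((\<lambda>t. exp (- 1 / t)) has_real_derivative exp (- 1 / t) / t\<^sup>2) (at t)"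
      using greater by (auto intro!: derivative_eq_intros simp: power2_eq_square)
    show ?thesis
      using greater
      by (intro DERIV_cong[OF DERIV_divide[OF ex pw]])
         (auto simp: flat_def field_simps power2_eq_square)
  qed
  then show ?thesis
    by (rule DERIV_cong_ev[THEN iffD1, rotated -1, OF _ refl])
       (use greater in \<open>auto simp: flat_def eventually_nhds intro!: exI[of _ "{0<..}"]\<close>)
qed

text \<open>The index k varies in the induction, since each derivative involves
  \<open>flat (k + 1)\<close> and \<open>flat (k + 2)\<close>.\<close>

lemma smooth_flat: "smooth (\<lambda>x. flat k (\<alpha> * x $ i + c))"
proof -
  have der: "((\<lambda>x. flat k (\<alpha> * x $ i + c)) has_derivative
      (\<lambda>h. (flat (k + 2) (\<alpha> * x $ i + c) - k * flat (k + 1) (\<alpha> * x $ i + c)) * (\<alpha> * h $ i))) (at x)"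
    for x :: point and k
  proof -
    have "((\<lambda>x::point. \<alpha> * x $ i + c) has_derivative (\<lambda>h. \<alpha> * h $ i)) (at x)"
      by (auto intro!: derivative_eq_intros bounded_linear_imp_has_derivative bounded_linear_vec_nth)
    from has_derivative_compose[OF this flat_deriv[unfolded has_field_derivative_def]]
    show ?thesis .
  qed
  have "Ck n (\<lambda>x. flat k (\<alpha> * x $ i + c))" for n
  proof (induction n arbitrary: k)
    case 0
    have "continuous (at x) (\<lambda>x. flat k (\<alpha> * x $ i + c))" for x
      using der by (rule has_derivative_continuous)
    then show ?case by (simp add: continuous_on_eq_continuous_at)
  next
    case (Suc n)
    have eq: "pderiv_at j (\<lambda>x. flat k (\<alpha> * x $ i + c)) = (\<lambda>x. (\<alpha> * axis j 1 $ i) *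
       (flat (k + 2) (\<alpha> * x $ i + c) + (- real k) * flat (k + 1) (\<alpha> * x $ i + c)))" for j
      by (rule ext) (simp add: pderiv_at_eq[OF der])
    show ?case
      unfolding Ck.simps eq using der Suc
      by (intro conjI allI Ck_mult Ck_add Ck_const Suc) (auto simp: differentiable_def)
  qed
  then show ?thesis by (simp add: smooth_def)
qed

text \<open>For s > 0 positive exactly on \<open>box a b\<close>, and tending to the indicator of
  the box as s grows. Large s serves to test against boxes, s = 1 gives the kernel of the
  mollifier.\<close>

definition bump :: "point \<Rightarrow> point \<Rightarrow> real \<Rightarrow> point \<Rightarrow> real" where
  "bump a b s x = (flat 0 (s * x $ 1 + - (s * a $ 1)) * flat 0 ((- s) * x $ 1 + s * b $ 1)) *
     (flat 0 (s * x $ 2 + - (s * a $ 2)) * flat 0 ((- s) * x $ 2 + s * b $ 2))"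

lemma smooth_bump: "smooth (bump a b s)"
  unfolding bump_def by (intro smooth_mult smooth_flat)

lemma mem_box_2: "x \<in> box a b \<longleftrightarrow> a $ 1 < x $ 1 \<and> x $ 1 < b $ 1 \<and> a $ 2 < x $ 2 \<and> x $ 2 < b $ 2"
  for x :: point
  by (auto simp: mem_box_cart forall_2)

lemma bump_eq:
  assumes "s > 0"
  shows "bump a b s x = (if x \<in> box a b then exp (- 1 / (s * (x $ 1 - a $ 1))) * exp (- 1 / (s * (b $ 1 - x $ 1)))
    * (exp (- 1 / (s * (x $ 2 - a $ 2))) * exp (- 1 / (s * (b $ 2 - x $ 2)))) else 0)"
proof -
  have *: "s * u + - (s * w) = s * (u - w)" "(- s) * u + s * w = s * (w - u)" for u w
    by (auto simp: algebra_simps)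
  show ?thesis
    unfolding bump_def * flat_def mem_box_2 using assms by (simp add: zero_less_mult_iff)
qed

lemma bump_nonneg: "s > 0 \<Longrightarrow> 0 \<le> bump a b s x"
  by (simp add: bump_eq)

lemma bump_le_1: assumes "s > 0" shows "bump a b s x \<le> 1"
  using assms by (auto simp: bump_eq mem_box_2 intro!: mult_le_one)

lemma bump_tendsto: "(\<lambda>n. bump a b (real (Suc n)) x) \<longlonglongrightarrow> indicator (box a b) x"
proof (cases "x \<in> box a b")
  case True
  have *: "(\<lambda>n. exp (- 1 / (real (Suc n) * d))) \<longlonglongrightarrow> 1" if "d > 0" for d :: real
  proof -
    have "(\<lambda>n. - (1 / d) * inverse (real (Suc n))) \<longlonglongrightarrow> - (1 / d) * 0"
      by (intro tendsto_mult tendsto_const LIMSEQ_inverse_real_of_nat)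
    then have "(\<lambda>n. - 1 / (real (Suc n) * d)) \<longlonglongrightarrow> 0"
      by (simp add: field_simps)
    from tendsto_exp[OF this] show ?thesis by simp
  qed
  have "(\<lambda>n. exp (- 1 / (real (Suc n) * (x $ 1 - a $ 1))) * exp (- 1 / (real (Suc n) * (b $ 1 - x $ 1)))
    * (exp (- 1 / (real (Suc n) * (x $ 2 - a $ 2))) * exp (- 1 / (real (Suc n) * (b $ 2 - x $ 2)))))
    \<longlonglongrightarrow> 1 * 1 * (1 * 1)"
    using True by (intro tendsto_mult *) (auto simp: mem_box_2)
  then show ?thesis using True by (simp add: bump_eq del: of_nat_Suc)
qed (simp add: bump_eq)

lemma test_fun_bump:
  assumes "cbox a b \<subseteq> U" "s > 0"
  shows "test_fun U (bump a b s)"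
proof -
  have "closure {x. bump a b s x \<noteq> 0} \<subseteq> cbox a b"
    using assms(2) box_subset_cbox[of a b] by (intro closure_minimal) (auto simp: bump_eq split: if_splits)
  then show ?thesis
    using assms smooth_bump[of a b s]
    by (auto simp: test_fun_def smooth_def intro: compact_closure[THEN iffD2] bounded_subset[OF bounded_cbox, of _ a b]
        dest: order_trans[OF closure_subset])
qed

lemma test_fun_smooth: "test_fun U f \<Longrightarrow> smooth f"
  by (simp add: test_fun_def smooth_def)

section \<open>Square integrable functions\<close>

lemma L2_measurable: "L2 U f \<Longrightarrow> f \<in> borel_measurable (lebesgue_on U)"
  by (simp add: L2_def)

lemma L2_square_integrable: "L2 U f \<Longrightarrow> integrable (lebesgue_on U) (\<lambda>x. (norm (f x))\<^sup>2)"
  by (simp add: L2_def)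

lemma abs_mult_le_square_sum: "\<bar>a * b\<bar> \<le> a\<^sup>2 + b\<^sup>2" for a b :: real
proof -
  have "2 * \<bar>a\<bar> * \<bar>b\<bar> \<le> a\<^sup>2 + b\<^sup>2"
    using sum_squares_bound[of "\<bar>a\<bar>" "\<bar>b\<bar>"] by simp
  moreover have "0 \<le> \<bar>a\<bar> * \<bar>b\<bar>" by simp
  ultimately show ?thesis unfolding abs_mult by linarith
qed

lemma norm_add_square_le: "(norm (a + b))\<^sup>2 \<le> 2 * (norm a)\<^sup>2 + 2 * (norm b)\<^sup>2"
proof -
  have "(norm (a + b))\<^sup>2 \<le> (norm a + norm b)\<^sup>2" by (simp add: norm_triangle_ineq)
  also have "\<dots> \<le> 2 * (norm a)\<^sup>2 + 2 * (norm b)\<^sup>2"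
    using sum_squares_bound[of "norm a" "norm b"] by (simp add: power2_sum)
  finally show ?thesis .
qed

lemma L2_mult_integrable:
  fixes B :: "'a::euclidean_space \<Rightarrow> 'b::euclidean_space \<Rightarrow> real"
  assumes "L2 U f" "L2 U g" "(\<lambda>x. B (f x) (g x)) \<in> borel_measurable (lebesgue_on U)"
    and "\<And>a b. \<bar>B a b\<bar> \<le> norm a * norm b"
  shows "integrable (lebesgue_on U) (\<lambda>x. B (f x) (g x))"
proof (rule Bochner_Integration.integrable_bound)
  show "integrable (lebesgue_on U) (\<lambda>x. (norm (f x))\<^sup>2 + (norm (g x))\<^sup>2)"
    using assms by (simp add: L2_square_integrable)
  show "AE x in lebesgue_on U. norm (B (f x) (g x)) \<le> norm ((norm (f x))\<^sup>2 + (norm (g x))\<^sup>2)"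
  proof (rule AE_I2)
    fix x
    have "\<bar>B (f x) (g x)\<bar> \<le> \<bar>norm (f x) * norm (g x)\<bar>" using assms(4) by simp
    also have "\<dots> \<le> (norm (f x))\<^sup>2 + (norm (g x))\<^sup>2" by (rule abs_mult_le_square_sum)
    finally show "norm (B (f x) (g x)) \<le> norm ((norm (f x))\<^sup>2 + (norm (g x))\<^sup>2)" by simp
  qed
qed (fact assms)

lemma L2_inner_integrable:
  assumes "L2 U f" "L2 U g"
  shows "integrable (lebesgue_on U) (\<lambda>x. f x \<bullet> g x)"
proof (rule L2_mult_integrable[where B = inner, OF assms])
  show "(\<lambda>x. f x \<bullet> g x) \<in> borel_measurable (lebesgue_on U)"
    by (intro borel_measurable_inner L2_measurable assms)
qed (rule Cauchy_Schwarz_ineq2)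

lemma L2_times_integrable:
  fixes f g :: "point \<Rightarrow> real"
  assumes "L2 U f" "L2 U g"
  shows "integrable (lebesgue_on U) (\<lambda>x. f x * g x)"
  using L2_inner_integrable[OF assms] by simp

lemma L2_bounded:
  fixes f :: "point \<Rightarrow> 'b::euclidean_space"
  assumes "U \<in> lmeasurable" "f \<in> borel_measurable (lebesgue_on U)" "\<And>x. x \<in> U \<Longrightarrow> norm (f x) \<le> B"
  shows "L2 U f"
  unfolding L2_def
proof (intro conjI)
  interpret finite_measure "lebesgue_on U" by (rule finite_measure_lebesgue_on[OF assms(1)])
  show "integrable (lebesgue_on U) (\<lambda>x. (norm (f x))\<^sup>2)"
    by (rule integrable_const_bound[where B = "B\<^sup>2"])
       (use assms in \<open>auto intro!: AE_I2 power_mono\<close>)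
qed fact

lemma L2_const: "U \<in> lmeasurable \<Longrightarrow> L2 U (\<lambda>_. c)"
  by (rule L2_bounded[where B = "norm c"]) auto

lemma L2_norm_le:
  fixes f :: "point \<Rightarrow> 'b::euclidean_space" and g :: "point \<Rightarrow> 'c::euclidean_space"
  assumes "L2 U g" "f \<in> borel_measurable (lebesgue_on U)" "\<And>x. norm (f x) \<le> norm (g x)"
  shows "L2 U f"
  unfolding L2_def
  by (intro conjI Bochner_Integration.integrable_bound[OF L2_square_integrable[OF assms(1)]])
     (use assms in \<open>auto intro!: AE_I2 power_mono\<close>)

lemma L2_add:
  fixes f g :: "point \<Rightarrow> 'b::euclidean_space"
  assumes "L2 U f" "L2 U g"
  shows "L2 U (\<lambda>x. f x + g x)"
  unfolding L2_def
proof (intro conjI)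
  show m: "(\<lambda>x. f x + g x) \<in> borel_measurable (lebesgue_on U)"
    by (intro borel_measurable_add L2_measurable assms)
  show "integrable (lebesgue_on U) (\<lambda>x. (norm (f x + g x))\<^sup>2)"
    by (rule Bochner_Integration.integrable_bound[where f = "\<lambda>x. 2 * (norm (f x))\<^sup>2 + 2 * (norm (g x))\<^sup>2"])
       (use assms m in \<open>auto intro!: AE_I2 norm_add_square_le simp: L2_square_integrable\<close>)
qed

lemma L2_scaleR: "L2 U f \<Longrightarrow> L2 U (\<lambda>x. c *\<^sub>R f x)"
  by (auto simp: L2_def power_mult_distrib)

lemma L2_diff: "L2 U f \<Longrightarrow> L2 U g \<Longrightarrow> L2 U (\<lambda>x. f x - g x)"
  for f g :: "point \<Rightarrow> 'b::euclidean_space"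
  using L2_add[OF _ L2_scaleR[of U g "-1"]] by simp

lemma L2_nth:
  fixes f :: "point \<Rightarrow> 'b::euclidean_space ^ 'n"
  assumes "L2 U f"
  shows "L2 U (\<lambda>x. f x $ i)"
proof (rule L2_norm_le[OF assms])
  show "(\<lambda>x. f x $ i) \<in> borel_measurable (lebesgue_on U)"
    by (rule borel_measurable_continuous_on[OF linear_continuous_on[OF bounded_linear_vec_nth]
          L2_measurable[OF assms]])
qed (rule Finite_Cartesian_Product.norm_nth_le)

lemma L2_integrable:
  assumes "U \<in> lmeasurable" "L2 U f"
  shows "integrable (lebesgue_on U) f"
proof -
  have "integrable (lebesgue_on U) (\<lambda>x. 1 + (norm (f x))\<^sup>2)"
    using assms L2_square_integrable integrable_on_const[of U "1::real"] finite_measure_lebesgue_on[OF assms(1)]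
    by (auto intro!: Bochner_Integration.integrable_add finite_measure.integrable_const)
  then show ?thesis
  proof (rule Bochner_Integration.integrable_bound)
    have "norm (f x) \<le> 1 + (norm (f x))\<^sup>2" for x
    proof -
      have "2 * norm (f x) \<le> 1 + (norm (f x))\<^sup>2" using sum_squares_bound[of 1 "norm (f x)"] by simp
      then show ?thesis using norm_ge_zero[of "f x"] by linarith
    qed
    then show "AE x in lebesgue_on U. norm (f x) \<le> norm (1 + (norm (f x))\<^sup>2)"
      by (auto intro!: AE_I2 order_trans[OF _ abs_ge_self])
  qed (use assms in \<open>auto simp: L2_measurable\<close>)
qed

lemma L2_subset:
  assumes "L2 U f" "U' \<subseteq> U" "U' \<in> sets lebesgue" "U \<in> sets lebesgue"
  shows "L2 U' f"
  unfolding L2_def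
proof
  show "f \<in> borel_measurable (lebesgue_on U')"
    using measurable_restrict_mono[OF L2_measurable[OF assms(1)] assms(2)] by simp
  have "set_integrable lebesgue U (\<lambda>x. (norm (f x))\<^sup>2)"
    using assms L2_square_integrable[OF assms(1)] integrable_restrict_space[of U lebesgue "\<lambda>x. (norm (f x))\<^sup>2"]
    by (simp add: set_integrable_def)
  then have "set_integrable lebesgue U' (\<lambda>x. (norm (f x))\<^sup>2)"
    using assms by (auto intro: set_integrable_subset)
  then show "integrable (lebesgue_on U') (\<lambda>x. (norm (f x))\<^sup>2)"
    using assms integrable_restrict_space[of U' lebesgue "\<lambda>x. (norm (f x))\<^sup>2"]
    by (simp add: set_integrable_def)
qed

lemma l2inner_eq_norm: "l2inner U f f = (LINT x|lebesgue_on U. (norm (f x))\<^sup>2)"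
  by (simp add: l2inner_def dot_square_norm)

lemma l2norm_square: "(l2norm U f)\<^sup>2 = (LINT x|lebesgue_on U. (norm (f x))\<^sup>2)"
  by (simp add: l2norm_def l2inner_eq_norm)

lemma l2norm_nonneg: "0 \<le> l2norm U f"
  by (simp add: l2norm_def l2inner_eq_norm)

lemma LINT_lebesgue_on:
  fixes f :: "point \<Rightarrow> 'b::euclidean_space"
  assumes "U \<in> sets lebesgue"
  shows "(LINT x|lebesgue_on U. f x) = (LINT x|lebesgue. indicator U x *\<^sub>R f x)"
  using assms by (simp add: integral_restrict_space)

lemma LINT_subset:
  fixes f :: "point \<Rightarrow> 'b::euclidean_space"
  assumes "U \<in> sets lebesgue" "U' \<in> sets lebesgue" "U' \<subseteq> U" "\<And>x. x \<in> U - U' \<Longrightarrow> f x = 0"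
  shows "(LINT x|lebesgue_on U. f x) = (LINT x|lebesgue_on U'. f x)"
  unfolding LINT_lebesgue_on[OF assms(1)] LINT_lebesgue_on[OF assms(2)]
  by (rule Bochner_Integration.integral_cong) (use assms in \<open>auto simp: indicator_def\<close>)

lemma continuous_bounded_support_integrable:
  fixes f :: "point \<Rightarrow> real"
  assumes "continuous_on UNIV f" "bounded S" "\<And>x. x \<notin> S \<Longrightarrow> f x = 0"
  shows "integrable lborel f"
proof -
  obtain a where a: "S \<subseteq> cbox (-a) a" using bounded_subset_cbox_symmetric[OF assms(2)] by blast
  have "integrable lborel (\<lambda>x. indicator (cbox (-a) a) x *\<^sub>R f x)"
    by (rule borel_integrable_compact) (auto intro: continuous_on_subset[OF assms(1)])
  also have "(\<lambda>x. indicator (cbox (-a) a) x *\<^sub>R f x) = f"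
    using a assms(3) by (force simp: indicator_def)
  finally show ?thesis .
qed

lemma LINT_lborel_eq_lebesgue_on:
  fixes f :: "point \<Rightarrow> real"
  assumes "f \<in> borel_measurable borel" "U \<in> sets lebesgue" "\<And>x. x \<notin> U \<Longrightarrow> f x = 0"
  shows "(LINT x|lebesgue_on U. f x) = (LINT x|lborel. f x)"
proof -
  have "(LINT x|lebesgue_on U. f x) = (LINT x|lebesgue. f x)"
    unfolding LINT_lebesgue_on[OF assms(2)]
    by (rule Bochner_Integration.integral_cong) (use assms in \<open>auto simp: indicator_def\<close>)
  then show ?thesis using assms(1) by (simp add: integral_completion)
qed

section \<open>Integration by parts and uniqueness of weak gradients\<close>

lemma has_derivative_gradient_bound:
  fixes f :: "point \<Rightarrow> real"
  assumes "\<And>x. (f has_derivative (\<lambda>h. l x \<bullet> h)) (at x)" "convex S" "\<And>x. x \<in> S \<Longrightarrow> norm (l x) \<le> B"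
    "x \<in> S" "y \<in> S"
  shows "\<bar>f x - f y\<bar> \<le> B * norm (x - y)"
proof -
  have "norm (f x - f y) \<le> B * norm (x - y)"
  proof (rule differentiable_bound[OF assms(2) _ _ \<open>x \<in> S\<close> \<open>y \<in> S\<close>])
    fix z assume "z \<in> S"
    show "(f has_derivative (\<lambda>h. l z \<bullet> h)) (at z within S)"
      using assms(1) has_derivative_at_withinI by blast
    show "onorm (\<lambda>h. l z \<bullet> h) \<le> B"
    proof (rule onorm_bound)
      show "0 \<le> B" using assms(3)[OF \<open>z \<in> S\<close>] norm_ge_zero[of "l z"] by linarith
      show "norm (l z \<bullet> h) \<le> B * norm h" for h
        using Cauchy_Schwarz_ineq2[of "l z" h] mult_right_mono[OF assms(3)[OF \<open>z \<in> S\<close>], of "norm h"] by simp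
    qed
  qed
  then show ?thesis by simp
qed

lemma grd_zero_outside:
  assumes "open V" "x \<in> V" "\<And>y. y \<in> V \<Longrightarrow> f y = 0"
  shows "pderiv_at j f x = 0"
proof -
  have "(f has_derivative (\<lambda>h. 0)) (at x)"
    by (rule has_derivative_transform_within_open[of "\<lambda>_. 0", OF _ assms(1,2)]) (use assms in auto)
  then show ?thesis by (simp add: pderiv_at_eq)
qed

text \<open>Difference quotients in direction j integrate to zero by translation invariance. They
  are bounded by a Lipschitz constant of f on a fixed ball and vanish outside it, so dominated
  convergence carries this over to the derivative.\<close>

lemma integral_pderiv_eq_0:
  fixes f :: "point \<Rightarrow> real"
  assumes diff: "\<And>x. f differentiable (at x)" and cont: "continuous_on UNIV (grd f)"
    and S: "bounded S" "\<And>x. x \<notin> S \<Longrightarrow> f x = 0"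
  shows "(LINT x|lborel. pderiv_at j f x) = 0"
proof -
  define e where "e = (axis j 1 :: point)"
  obtain B where B: "B > 0" "\<And>x. x \<in> S \<Longrightarrow> norm x < B"
    using S(1) by (meson bounded_pos_less)
  have der: "(f has_derivative (\<lambda>h. grd f x \<bullet> h)) (at x)" for x
    using has_derivative_grd[OF diff] .
  have contf: "continuous_on UNIV f"
    by (simp add: continuous_on_eq_continuous_at has_derivative_continuous[OF der])
  have "compact (grd f ` cball 0 (B + 1))"
    by (rule compact_continuous_image[OF continuous_on_subset[OF cont]]) auto
  then obtain L where L: "L > 0" "\<And>x. x \<in> cball 0 (B + 1) \<Longrightarrow> norm (grd f x) \<le> L"
    by (metis bounded_pos compact_imp_bounded imageI)
  have out: "grd f x = 0" if "x \<notin> cball 0 B" for x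
    unfolding grd_def vec_eq_iff
    using that B S(2) by (force intro!: grd_zero_outside[of "- cball 0 B"] intro: less_imp_le)
  have L': "norm (grd f x) \<le> L" for x
    using L out[of x] by (cases "x \<in> cball 0 B") auto
  have Lip: "\<bar>f x - f y\<bar> \<le> L * norm (x - y)" for x y
    by (rule has_derivative_gradient_bound[OF der, of UNIV]) (auto simp: L')
  \<comment> \<open>Step sizes of at most 1 keep all difference quotients supported in the ball of
    radius B + 1.\<close>
  define h where "h = (\<lambda>n. inverse (real (Suc n)))"
  have h: "h n > 0" "h n \<le> 1" for n by (auto simp: h_def field_simps)
  have h0: "h \<longlonglongrightarrow> 0" unfolding h_def by (rule LIMSEQ_inverse_real_of_nat)
  define q where "q = (\<lambda>n x. (f (x + h n *\<^sub>R e) - f x) / h n)"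
  have q_out: "q n x = 0" if "x \<notin> cball 0 (B + 1)" for n x
  proof -
    have "norm (h n *\<^sub>R e) \<le> 1" using h[of n] by (simp add: e_def norm_axis_1)
    then have "norm x - 1 \<le> norm (x + h n *\<^sub>R e)"
      using norm_diff_ineq[of x "h n *\<^sub>R e"] by linarith
    then have "x + h n *\<^sub>R e \<notin> S" "x \<notin> S" using that B(2)[of x] B(2)[of "x + h n *\<^sub>R e"] by auto
    then show ?thesis using S by (simp add: q_def)
  qed
  have q_bound: "\<bar>q n x\<bar> \<le> L * indicator (cball 0 (B + 1)) x" for n x
  proof (cases "x \<in> cball 0 (B + 1)")
    case True
    have "\<bar>q n x\<bar> \<le> L" using Lip[of "x + h n *\<^sub>R e" x] h[of n]
      by (simp add: q_def e_def norm_axis_1 field_simps)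
    then show ?thesis using True by simp
  qed (simp add: q_out)
  have bor: "f \<in> borel_measurable borel" using contf by (rule borel_measurable_continuous_onI)
  have q_lim: "(\<lambda>n. q n x) \<longlonglongrightarrow> pderiv_at j f x" for x
  proof -
    have "((\<lambda>t. f (x + t *\<^sub>R e)) has_derivative (\<lambda>t. grd f (x + 0 *\<^sub>R e) \<bullet> (t *\<^sub>R e))) (at 0)"
      by (rule has_derivative_compose[OF _ der]) (auto intro!: derivative_eq_intros)
    then have "((\<lambda>t. f (x + t *\<^sub>R e)) has_real_derivative pderiv_at j f x) (at 0)"
      by (simp add: has_field_derivative_def e_def inner_axis grd_def mult.commute[of _ "pderiv_at j f x"] mult_commute_abs)
    then have "(\<lambda>t. (f (x + t *\<^sub>R e) - f x) / t) \<midarrow>0\<rightarrow> pderiv_at j f x"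
      by (simp add: DERIV_def)
    then show ?thesis
      unfolding q_def by (rule filterlim_compose) (use h0 h in \<open>auto simp: filterlim_at less_imp_neq[THEN not_sym]\<close>)
  qed
  have int_f: "integrable lborel f" by (rule continuous_bounded_support_integrable[OF contf S])
  have shift: "integrable lborel (\<lambda>x. f (x + c)) \<and> (LINT x|lborel. f (x + c)) = (LINT x|lborel. f x)" for c
  proof -
    have *: "f \<in> borel_measurable (distr lborel borel ((+) c))" using bor by simp
    have "integrable (distr lborel borel ((+) c)) f" using int_f by (simp add: lborel_distr_plus)
    then have "integrable lborel (\<lambda>x. f (c + x))" by (subst (asm) integrable_distr_eq) (auto simp: bor)
    moreover have "(LINT x|distr lborel borel ((+) c). f x) = (LINT x|lborel. f (c + x))"
      by (rule integral_distr) (auto simp: bor)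
    ultimately show ?thesis by (simp add: lborel_distr_plus add.commute)
  qed
  have "(LINT x|lborel. q n x) = 0" for n
    unfolding q_def using shift[of "h n *\<^sub>R e"] int_f by simp
  moreover have "(\<lambda>n. LINT x|lborel. q n x) \<longlonglongrightarrow> (LINT x|lborel. pderiv_at j f x)"
  proof (rule integral_dominated_convergence[where w = "\<lambda>x. L * indicator (cball 0 (B + 1)) x"])
    show "pderiv_at j f \<in> borel_measurable lborel"
      by (rule borel_measurable_LIMSEQ_real[OF q_lim])
         (use bor in \<open>auto simp: q_def intro!: borel_measurable_divide borel_measurable_diff measurable_compose[OF _ bor]\<close>)
    show "q n \<in> borel_measurable lborel" for n
      by (auto simp: q_def intro!: borel_measurable_divide borel_measurable_diff measurable_compose[OF _ bor])
    show "integrable lborel (\<lambda>x. L * indicator (cball (0::point) (B + 1)) x)"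
      by (intro integrable_mult_right integrable_real_indicator) (auto simp: emeasure_lborel_cball_finite[unfolded infinity_ennreal_def])
  qed (use q_lim q_bound in auto)
  ultimately show ?thesis by (simp add: LIMSEQ_const_iff)
qed

text \<open>The product of f and \<phi> is continuously differentiable with bounded support, so its
  derivative integrates to zero. This form covers affine functions as well as test functions in the
  place of f.\<close>

lemma LINT_product_rule:
  fixes f \<phi> :: "point \<Rightarrow> real"
  assumes f: "\<And>x. f differentiable (at x)" "continuous_on UNIV (grd f)"
    and \<phi>: "test_fun U \<phi>" and U: "U \<in> sets lebesgue"
  shows "(LINT x|lebesgue_on U. f x * pderiv_at j \<phi> x) = - (LINT x|lebesgue_on U. pderiv_at j f x * \<phi> x)"
proof -
  note sm = test_fun_smooth[OF \<phi>]
  have K: "compact (closure {x. \<phi> x \<noteq> 0})" "closure {x. \<phi> x \<noteq> 0} \<subseteq> U"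
    using \<phi> by (auto simp: test_fun_def)
  define S where "S = closure {x. \<phi> x \<noteq> 0}"
  have S: "bounded S" "S \<subseteq> U" using K by (auto simp: S_def compact_imp_bounded)
  have z: "\<phi> x = 0" if "x \<notin> S" for x
  proof (rule ccontr)
    assume "\<phi> x \<noteq> 0"
    then have "x \<in> {x. \<phi> x \<noteq> 0}" by simp
    then show False using that closure_subset[THEN subsetD] unfolding S_def by metis
  qed
  have z': "pderiv_at j \<phi> x = 0" if "x \<notin> S" for x
  proof (rule grd_zero_outside[of "- S"])
    show "open (- S)" by (simp add: S_def open_Compl)
  qed (use that z in auto)
  have contf: "continuous_on UNIV f"
    by (simp add: continuous_on_eq_continuous_at f differentiable_imp_continuous_within)
  have contf': "continuous_on UNIV (pderiv_at j f)"
    using continuous_on_component[OF f(2), of j] by (simp add: grd_def)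
  have c1: "continuous_on UNIV (\<lambda>x. f x * pderiv_at j \<phi> x)"
    by (intro continuous_on_mult contf smooth_continuous smooth_pderiv sm)
  have c2: "continuous_on UNIV (\<lambda>x. pderiv_at j f x * \<phi> x)"
    by (intro continuous_on_mult contf' smooth_continuous sm)
  have prod: "pderiv_at j (\<lambda>x. f x * \<phi> x) x = f x * pderiv_at j \<phi> x + pderiv_at j f x * \<phi> x" for j x
    by (rule pderiv_at_mult) (auto simp: f smooth_diff sm)
  have "(LINT x|lborel. pderiv_at j (\<lambda>x. f x * \<phi> x) x) = 0"
  proof (rule integral_pderiv_eq_0[OF _ _ S(1)])
    show "(\<lambda>x. f x * \<phi> x) differentiable at x" for x
      by (intro differentiable_mult f smooth_diff sm)
    have "grd (\<lambda>x. f x * \<phi> x) = (\<lambda>x. f x *\<^sub>R grd \<phi> x + \<phi> x *\<^sub>R grd f x)"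
      by (auto simp: grd_def vec_eq_iff prod)
    then show "continuous_on UNIV (grd (\<lambda>x. f x * \<phi> x))"
      using f(2) by (auto intro!: continuous_intros contf smooth_continuous smooth_continuous_grd sm)
  qed (simp add: z)
  moreover have "integrable lborel (\<lambda>x. f x * pderiv_at j \<phi> x)"
    by (rule continuous_bounded_support_integrable[OF c1 S(1)]) (simp add: z')
  moreover have "integrable lborel (\<lambda>x. pderiv_at j f x * \<phi> x)"
    by (rule continuous_bounded_support_integrable[OF c2 S(1)]) (simp add: z)
  ultimately have "(LINT x|lborel. f x * pderiv_at j \<phi> x) + (LINT x|lborel. pderiv_at j f x * \<phi> x) = 0"
    by (simp add: prod)
  moreover have "(LINT x|lebesgue_on U. f x * pderiv_at j \<phi> x) = (LINT x|lborel. f x * pderiv_at j \<phi> x)"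
    by (rule LINT_lborel_eq_lebesgue_on)
       (use borel_measurable_continuous_onI[OF c1] U S z' in auto)
  moreover have "(LINT x|lebesgue_on U. pderiv_at j f x * \<phi> x) = (LINT x|lborel. pderiv_at j f x * \<phi> x)"
    by (rule LINT_lborel_eq_lebesgue_on)
       (use borel_measurable_continuous_onI[OF c2] U S z in auto)
  ultimately show ?thesis by linarith
qed

section \<open>The fundamental lemma of the calculus of variations\<close>

text \<open>Open boxes form an intersection-stable generator of the Borel sets, so a Dynkin argument
  extends the vanishing to all Borel sets, among them the sets where h is positive and where it is
  negative.\<close>

lemma AE_zero_if_box_integrals_zero:
  fixes h :: "point \<Rightarrow> real"
  assumes h: "integrable lborel h" and 0: "\<And>a b. (LINT x:box a b|lborel. h x) = 0"
  shows "AE x in lborel. h x = 0"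
proof -
  have [measurable]: "h \<in> borel_measurable borel" using h by (auto dest: borel_measurable_integrable)
  have int: "set_integrable lborel A h" if "A \<in> sets borel" for A
    using that h unfolding set_integrable_def by (intro integrable_mult_indicator) auto
  \<comment> \<open>The complement step of the Dynkin argument needs the integral over the whole
    plane, which growing boxes exhaust.\<close>
  have whole: "(LINT x:UNIV|lborel. h x) = 0"
  proof -
    define B where "B = (\<lambda>n::nat. box (- (\<chi> i. real n)) (\<chi> i. real n) :: point set)"
    have "\<exists>n. x \<in> B n" for x :: point
    proof -
      obtain n :: nat where "norm x < n" using reals_Archimedean2 by blast
      then have "\<bar>x $ i\<bar> < n" for i using component_le_norm_cart[of x i] by linarith
      then have "x \<in> B n" by (auto simp: B_def mem_box_cart abs_less_iff minus_less_iff)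
      then show ?thesis ..
    qed
    then have U: "(\<Union>n. B n) = UNIV" by auto
    have "incseq B"
      by (auto simp: incseq_def B_def mem_box_cart intro: order.strict_trans1 order.strict_trans2)
         (smt (verit) of_nat_mono)+
    then have "(\<lambda>n. LINT x:B n|lborel. h x) \<longlonglongrightarrow> (LINT x:(\<Union>n. B n)|lborel. h x)"
      by (intro set_integral_cont_up int) (auto simp: B_def)
    then show ?thesis by (simp add: B_def[abs_def] 0 U[unfolded B_def] LIMSEQ_const_iff)
  qed
  have meas: "(LINT x:A|lborel. h x) = 0" if A: "A \<in> sets borel" for A
  proof -
    have sA: "A \<in> sigma_sets UNIV (range (\<lambda>(a, b). box a b :: point set))"
      using A unfolding borel_eq_box by simp
    have st: "Int_stable (range (\<lambda>(a, b). box a b :: point set))"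
      by (auto simp: Int_stable_def box_Int_box)
    have "range (\<lambda>(a, b). box a b :: point set) \<subseteq> Pow UNIV" by simp
    from st this sA show ?thesis
    proof (induction A rule: sigma_sets_induct_disjoint)
      case (compl A)
      then have A: "A \<in> sets borel" unfolding borel_eq_box by simp
      have "(LINT x:UNIV|lborel. h x) = (LINT x:A|lborel. h x) + (LINT x:UNIV - A|lborel. h x)"
        using set_integral_Un[of A "UNIV - A" lborel h] int A by (auto simp: Un_Diff_cancel)
      then show ?case using compl whole by simp
    next
      case (union A)
      then have "A i \<in> sets borel" for i unfolding borel_eq_box by auto
      then have "(LINT x:(\<Union>i. A i)|lborel. h x) = (\<Sum>i. LINT x:A i|lborel. h x)"
        using union by (intro lebesgue_integral_countable_add int) (auto simp: disjoint_family_on_def)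
      then show ?case using union by simp
    qed (auto simp: 0 set_lebesgue_integral_def[where A = "{}"])
  qed
  have "(LINT x|lborel. max 0 (h x)) = 0" "(LINT x|lborel. max 0 (- h x)) = 0"
  proof -
    have "(LINT x|lborel. max 0 (h x)) = (LINT x:{x. h x > 0}|lborel. h x)"
      unfolding set_lebesgue_integral_def
      by (rule Bochner_Integration.integral_cong) (auto simp: indicator_def)
    then show "(LINT x|lborel. max 0 (h x)) = 0" by (simp add: meas)
    have "(LINT x|lborel. max 0 (- h x)) = - (LINT x:{x. h x < 0}|lborel. h x)"
      unfolding set_lebesgue_integral_def Bochner_Integration.integral_minus[symmetric]
      by (rule Bochner_Integration.integral_cong) (auto simp: indicator_def)
    then show "(LINT x|lborel. max 0 (- h x)) = 0" by (simp add: meas)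
  qed
  moreover have "integrable lborel (\<lambda>x. max 0 (h x))" "integrable lborel (\<lambda>x. max 0 (- h x))"
    by (intro Bochner_Integration.integrable_max Bochner_Integration.integrable_minus
        Bochner_Integration.integrable_zero h)+
  ultimately have "AE x in lborel. max 0 (h x) = 0" "AE x in lborel. max 0 (- h x) = 0"
    by (simp_all add: integral_nonneg_eq_0_iff_AE)
  then show ?thesis by eventually_elim (auto simp: max_def split: if_splits)
qed

text \<open>Bumps are test functions converging to indicators of boxes, so h has zero integral over
  every box whose closure lies in U. Countably many closed boxes cover U, and
  \<open>AE_zero_if_box_integrals_zero\<close> applies on each.\<close>

lemma AE_zero_if_test_orthogonal:
  fixes h :: "point \<Rightarrow> real"
  assumes U: "open U" and h: "integrable (lebesgue_on U) h"
    and orth: "\<And>\<phi>. test_fun U \<phi> \<Longrightarrow> (LINT x|lebesgue_on U. h x * \<phi> x) = 0"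
  shows "AE x in lebesgue_on U. h x = 0"
proof -
  have Um: "U \<in> sets lebesgue" using U by simp
  have "integrable lebesgue (\<lambda>x. indicator U x * h x)"
    using h Um by (simp add: integrable_restrict_space)
  then have "(\<lambda>x. indicator U x * h x) \<in> borel_measurable (completion lborel)" by auto
  \<comment> \<open>The argument with boxes is about Borel functions and \<open>lborel\<close>. As h
    is only Lebesgue measurable, its extension by zero is replaced by a Borel function equal to it
    almost everywhere.\<close>
  then obtain H where H[measurable]: "H \<in> borel_measurable lborel"
    and HAE: "AE x in lborel. indicator U x * h x = H x"
    using completion_ex_borel_measurable_real by blast
  have HAE': "AE x in lebesgue. indicator U x * h x = H x" using HAE by (rule AE_completion)
  have "integrable lebesgue H"
    using \<open>integrable lebesgue (\<lambda>x. indicator U x * h x)\<close> HAE' H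
    by (auto intro: integrable_cong_AE_imp simp: eq_commute measurable_completion)
  then have Hint: "integrable lborel H" using H by (simp add: integrable_completion)
  have Horth: "(LINT x|lborel. H x * \<phi> x) = 0" if "test_fun U \<phi>" for \<phi>
  proof -
    have [measurable]: "\<phi> \<in> borel_measurable borel"
      using smooth_continuous[OF test_fun_smooth[OF that]] by (rule borel_measurable_continuous_onI)
    have "(LINT x|lborel. H x * \<phi> x) = (LINT x|lebesgue. H x * \<phi> x)"
      by (rule integral_completion[symmetric]) simp
    also have "\<dots> = (LINT x|lebesgue. indicator U x *\<^sub>R (h x * \<phi> x))"
    proof (rule integral_cong_AE)
      show "(\<lambda>x. H x * \<phi> x) \<in> borel_measurable lebesgue" by (rule measurable_completion) simp
      show "(\<lambda>x. indicator U x *\<^sub>R (h x * \<phi> x)) \<in> borel_measurable lebesgue"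
        using borel_measurable_times[OF \<open>(\<lambda>x. indicator U x * h x) \<in> borel_measurable (completion lborel)\<close>
            measurable_completion[of \<phi> lborel borel]] by (simp add: mult.assoc)
      show "AE x in lebesgue. H x * \<phi> x = indicator U x *\<^sub>R (h x * \<phi> x)"
        using HAE' by eventually_elim (metis mult.assoc real_scaleR_def)
    qed
    also have "\<dots> = 0" using orth[OF that] by (simp add: LINT_lebesgue_on[OF Um])
    finally show ?thesis .
  qed
  have Hbox: "(LINT x:box a b|lborel. H x) = 0" if "cbox a b \<subseteq> U" for a b
  proof -
    have "(\<lambda>n. LINT x|lborel. H x * bump a b (real (Suc n)) x) \<longlonglongrightarrow> (LINT x|lborel. H x * indicator (box a b) x)"
    proof (rule integral_dominated_convergence[where w = "\<lambda>x. \<bar>H x\<bar>"])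
      have [measurable]: "bump a b s \<in> borel_measurable borel" for s
        using smooth_continuous[OF smooth_bump] by (rule borel_measurable_continuous_onI)
      show "(\<lambda>x. H x * bump a b (real (Suc n)) x) \<in> borel_measurable lborel" for n by simp
      show "AE x in lborel. (\<lambda>n. H x * bump a b (real (Suc n)) x) \<longlonglongrightarrow> H x * indicator (box a b) x"
        by (intro AE_I2 tendsto_mult tendsto_const bump_tendsto)
      show "AE x in lborel. norm (H x * bump a b (real (Suc n)) x) \<le> \<bar>H x\<bar>" for n
        using bump_le_1[of "real (Suc n)" a b] bump_nonneg[of "real (Suc n)" a b]
        by (intro AE_I2) (auto simp: abs_mult intro!: mult_left_le)
    qed (use Hint in auto)
    moreover have "(LINT x|lborel. H x * bump a b (real (Suc n)) x) = 0" for n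
      by (rule Horth) (rule test_fun_bump[OF that], simp)
    ultimately show ?thesis
      by (simp add: LIMSEQ_const_iff set_lebesgue_integral_def mult.commute)
  qed
  obtain \<D> where \<D>: "countable \<D>" "\<And>X. X \<in> \<D> \<Longrightarrow> X \<subseteq> U \<and> (\<exists>a b. X = cbox a b)" "\<Union>\<D> = U"
    using open_countable_Union_open_cbox[OF U] by (smt (verit) Pow_iff subset_iff)
  have "AE x in lborel. x \<in> X \<longrightarrow> H x = 0" if XD: "X \<in> \<D>" for X
  proof -
    obtain c d where X: "X = cbox c d" "cbox c d \<subseteq> U" using \<D>(2)[OF XD] by blast
    have "AE x in lborel. indicator (box c d) x * H x = 0"
    proof (rule AE_zero_if_box_integrals_zero)
      show "integrable lborel (\<lambda>x. indicator (box c d) x * H x)"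
        using integrable_mult_indicator[OF _ Hint, of "box c d"] by simp
      fix a b
      have "\<exists>a' b'. box a b \<inter> box c d = box a' b'" unfolding box_Int_box by blast
      then obtain a' b' where ab: "box a b \<inter> box c d = box a' b'" "box a' b' \<subseteq> box c d"
        by blast
      have "(LINT x:box a b|lborel. indicator (box c d) x * H x) = (LINT x:box a' b'|lborel. H x)"
        unfolding set_lebesgue_integral_def ab(1)[symmetric]
        by (rule Bochner_Integration.integral_cong) (auto simp: indicator_def)
      also have "\<dots> = 0"
      proof (cases "box a' b' = {}")
        case False
        have "closure (box a' b') \<subseteq> closure (box c d)" using ab(2) by (rule closure_mono)
        then have "cbox a' b' \<subseteq> cbox c d"
          using False ab(2) by (metis bot.extremum_uniqueI closure_box)
        then show ?thesis using X(2) by (intro Hbox) auto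
      qed (simp add: set_lebesgue_integral_def)
      finally show "(LINT x:box a b|lborel. indicator (box c d) x * H x) = 0" .
    qed
    \<comment> \<open>Only the open box has been dealt with; its boundary is a null set.\<close>
    moreover have "AE x in lborel. x \<notin> cbox c d - box c d"
    proof (rule AE_not_in)
      have "cbox c d - box c d \<in> null_sets lebesgue"
        using negligible_iff_null_sets negligible_frontier_interval by blast
      then show "cbox c d - box c d \<in> null_sets lborel"
        by (simp add: null_sets_completion_iff)
    qed
    ultimately show ?thesis unfolding X by eventually_elim (auto simp: indicator_def split: if_splits)
  qed
  then have "AE x in lborel. \<forall>X\<in>\<D>. x \<in> X \<longrightarrow> H x = 0"
    by (subst AE_ball_countable[OF \<D>(1)]) blast
  then have "AE x in lborel. x \<in> U \<longrightarrow> H x = 0" by eventually_elim (use \<D>(3) in blast)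
  then have "AE x in lborel. x \<in> U \<longrightarrow> h x = 0"
    using HAE by eventually_elim (auto simp: indicator_def)
  then have "AE x in lebesgue. x \<in> U \<longrightarrow> h x = 0" by (rule AE_completion)
  then show ?thesis using Um by (simp add: AE_restrict_space_iff)
qed

lemma test_fun_bounded:
  assumes "test_fun U \<phi>"
  obtains B where "\<And>x. \<bar>\<phi> x\<bar> \<le> B" "\<And>x j. \<bar>pderiv_at j \<phi> x\<bar> \<le> B"
proof -
  define S where "S = closure {x. \<phi> x \<noteq> 0}"
  have S: "compact S" "closed S" using assms by (auto simp: test_fun_def S_def)
  have z: "\<phi> x = 0" if "x \<notin> S" for x
    using that closure_subset[of "{x. \<phi> x \<noteq> 0}", folded S_def] by auto
  have z': "pderiv_at j \<phi> x = 0" if "x \<notin> S" for x j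
    by (rule grd_zero_outside[of "- S"]) (use that z S in \<open>auto simp: open_Compl\<close>)
  note sm = test_fun_smooth[OF assms]
  have "bounded (\<phi> ` S)" "bounded (grd \<phi> ` S)"
    using S sm by (auto intro!: compact_imp_bounded compact_continuous_image smooth_continuous smooth_continuous_grd)
  then obtain B1 B2 where B: "\<And>x. x \<in> S \<Longrightarrow> norm (\<phi> x) \<le> B1" "\<And>x. x \<in> S \<Longrightarrow> norm (grd \<phi> x) \<le> B2"
    unfolding bounded_iff by auto
  have "\<bar>\<phi> x\<bar> \<le> max 0 (max B1 B2)" for x
    using z[of x] B(1)[of x] by (cases "x \<in> S") auto
  moreover have "\<bar>pderiv_at j \<phi> x\<bar> \<le> max 0 (max B1 B2)" for x j
    using z'[of x j] B(2)[of x] component_le_norm_cart[of "grd \<phi> x" j] by (cases "x \<in> S") (auto simp: grd_def)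
  ultimately show thesis using that by blast
qed

lemma test_fun_L2:
  assumes "test_fun U \<phi>" "U' \<in> lmeasurable"
  shows "L2 U' \<phi>" "L2 U' (pderiv_at j \<phi>)"
proof -
  obtain B where B: "\<And>x. \<bar>\<phi> x\<bar> \<le> B" "\<And>x j. \<bar>pderiv_at j \<phi> x\<bar> \<le> B"
    using test_fun_bounded[OF assms(1)] by blast
  note sm = test_fun_smooth[OF assms(1)]
  show "L2 U' \<phi>" "L2 U' (pderiv_at j \<phi>)"
    using assms(2) B sm by (auto intro!: L2_bounded[of U' _ B] continuous_imp_measurable_on_sets_lebesgue
      smooth_continuous smooth_pderiv)
qed

text \<open>The difference of two weak gradients is orthogonal to all test functions. Since
  \<open>grad\<close> and \<open>broken_grad\<close> pick an arbitrary weak gradient, this is what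
  identifies them with explicitly computed ones.\<close>

lemma weak_gradient_unique:
  assumes U: "open U" "bounded U" and G: "weak_gradient U v G" "weak_gradient U v G'"
  shows "AE x in lebesgue_on U. G x = G' x"
proof -
  have Um: "U \<in> lmeasurable" using U by (simp add: lmeasurable_open)
  have L2: "L2 U G" "L2 U G'" using G by (auto simp: weak_gradient_def)
  have "AE x in lebesgue_on U. G x $ i $ j - G' x $ i $ j = 0" for i j
  proof (rule AE_zero_if_test_orthogonal[OF U(1)])
    show "integrable (lebesgue_on U) (\<lambda>x. G x $ i $ j - G' x $ i $ j)"
      using L2 by (intro L2_integrable[OF Um] L2_diff L2_nth)
    fix \<phi> assume \<phi>: "test_fun U \<phi>"
    have "integrable (lebesgue_on U) (\<lambda>x. G x $ i $ j * \<phi> x)" "integrable (lebesgue_on U) (\<lambda>x. G' x $ i $ j * \<phi> x)"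
      using L2 test_fun_L2[OF \<phi> Um] by (auto intro!: L2_times_integrable L2_nth)
    moreover have "(LINT x|lebesgue_on U. G x $ i $ j * \<phi> x) = (LINT x|lebesgue_on U. G' x $ i $ j * \<phi> x)"
      using G \<phi> by (simp add: weak_gradient_def)
    ultimately show "(LINT x|lebesgue_on U. (G x $ i $ j - G' x $ i $ j) * \<phi> x) = 0"
      by (simp add: left_diff_distrib)
  qed
  then have "AE x in lebesgue_on U. \<forall>i j. G x $ i $ j - G' x $ i $ j = 0"
    by (simp add: AE_all_countable)
  then show ?thesis by eventually_elim (simp add: vec_eq_iff)
qed

section \<open>Lipschitz functions vanishing on the boundary\<close>

lemma norm_vec_le_sum: "norm x \<le> (\<Sum>i\<in>UNIV. norm (x $ i))"
  by (simp add: norm_vec_def L2_set_le_sum)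

section \<open>Mollification\<close>

text \<open>Differentiation under the integral sign moves the derivative onto \<psi>, whose partial
  derivatives are smooth again; hence the induction on the order runs over all \<psi>.\<close>

lemma smooth_convolution:
  assumes f: "continuous_on UNIV f" and "smooth \<psi>"
  shows "smooth (\<lambda>x. integral (cbox a b) (\<lambda>y. f y * \<psi> (x - y)))"
proof -
  have der: "((\<lambda>x. integral (cbox a b) (\<lambda>y. f y * \<psi> (x - y))) has_derivative
      (\<lambda>h. integral (cbox a b) (\<lambda>y. f y * (grd \<psi> (x - y) \<bullet> h)))) (at x)"
    if \<psi>: "smooth \<psi>" for \<psi> :: "point \<Rightarrow> real" and x
  proof -
    \<comment> \<open>\<open>leibniz_rule\<close> takes derivatives as bounded linear functions, so
      the kernel is the functional given by the inner product with the gradient.\<close>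
    let ?fx = "\<lambda>x y. f y *\<^sub>R blinfun_inner_left (grd \<psi> (x - y))"
    have cont: "continuous_on (UNIV \<times> cbox a b) (\<lambda>(x, y). ?fx x y)"
    proof -
      have "continuous_on (UNIV \<times> cbox a b) (\<lambda>p. f (snd p) *\<^sub>R blinfun_inner_left (grd \<psi> (fst p - snd p)))"
        by (intro continuous_intros continuous_on_compose2[OF f]
            continuous_on_compose2[OF smooth_continuous_grd[OF \<psi>, of UNIV]]
            bounded_linear.continuous_on[OF bounded_linear_blinfun_inner_left]) auto
      then show ?thesis by (simp add: case_prod_unfold)
    qed
    have "((\<lambda>x. integral (cbox a b) (\<lambda>y. f y * \<psi> (x - y))) has_derivative
        blinfun_apply (integral (cbox a b) (?fx x))) (at x within UNIV)"
    proof (rule leibniz_rule[OF _ _ cont])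
      fix x :: point and t
      have "((\<lambda>x. \<psi> (x - t)) has_derivative (\<lambda>h. grd \<psi> (x - t) \<bullet> h)) (at x)"
        by (rule has_derivative_compose[OF _ has_derivative_grd[OF smooth_diff[OF \<psi>]]])
           (auto intro!: derivative_eq_intros)
      from has_derivative_mult_right[OF this, of "f t"]
      have *: "((\<lambda>x. f t * \<psi> (x - t)) has_derivative (\<lambda>h. f t * (grd \<psi> (x - t) \<bullet> h))) (at x)" .
      show "((\<lambda>x. f t * \<psi> (x - t)) has_derivative blinfun_apply (?fx x t)) (at x within UNIV)"
      proof -
        have "blinfun_apply (?fx x t) = (\<lambda>h. f t * (grd \<psi> (x - t) \<bullet> h))"
          by (rule ext) (simp add: blinfun.scaleR_left inner_commute)
        then show ?thesis using * by (simp only:)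
      qed
    next
      fix x
      show "(\<lambda>y. f y * \<psi> (x - y)) integrable_on cbox a b"
        by (intro integrable_continuous continuous_on_mult continuous_on_subset[OF f]
            continuous_on_compose2[OF smooth_continuous[OF \<psi>, of UNIV]] continuous_intros) auto
    qed auto
    moreover have "blinfun_apply (integral (cbox a b) (?fx x)) =
        (\<lambda>h. integral (cbox a b) (\<lambda>y. f y * (grd \<psi> (x - y) \<bullet> h)))"
    proof (rule ext)
      fix h
      have "continuous_on (cbox a b) (?fx x)"
        by (intro continuous_intros continuous_on_subset[OF f]
            continuous_on_compose2[OF smooth_continuous_grd[OF \<psi>, of UNIV]]
            bounded_linear.continuous_on[OF bounded_linear_blinfun_inner_left]) auto
      then have "?fx x integrable_on cbox a b" by (rule integrable_continuous)
      from integral_linear[OF this blinfun.bounded_linear_left[of h]]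
      show "blinfun_apply (integral (cbox a b) (?fx x)) h =
          integral (cbox a b) (\<lambda>y. f y * (grd \<psi> (x - y) \<bullet> h))"
        by (simp add: o_def blinfun.scaleR_left inner_commute)
    qed
    ultimately show ?thesis by simp
  qed
  have "Ck n (\<lambda>x. integral (cbox a b) (\<lambda>y. f y * \<psi> (x - y)))" for n
    using \<open>smooth \<psi>\<close>
  proof (induction n arbitrary: \<psi>)
    case 0
    then show ?case
      using has_derivative_continuous[OF der] by (simp add: continuous_on_eq_continuous_at)
  next
    case (Suc n)
    have "pderiv_at j (\<lambda>x. integral (cbox a b) (\<lambda>y. f y * \<psi> (x - y))) =
        (\<lambda>x. integral (cbox a b) (\<lambda>y. f y * pderiv_at j \<psi> (x - y)))" for j
      by (rule ext) (simp add: pderiv_at_eq[OF der[OF Suc.prems]] inner_axis grd_def)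
    then show ?case
      using der[OF Suc.prems] Suc.IH[OF smooth_pderiv[OF Suc.prems]]
      by (auto simp: differentiable_def)
  qed
  then show ?thesis by (simp add: smooth_def)
qed

lemma bump_continuous: "continuous_on S (bump a b s)"
  by (rule smooth_continuous[OF smooth_bump])

lemma bump_integrable:
  assumes "s > 0"
  shows "integrable lborel (bump a b s)"
  by (rule continuous_bounded_support_integrable[OF bump_continuous bounded_box[of a b]])
     (use assms in \<open>simp add: bump_eq\<close>)

lemma bump_integral_pos:
  assumes "s > 0" "box a b \<noteq> {}"
  shows "0 < (LINT x|lborel. bump a b s x)"
proof -
  have "0 \<le> (LINT x|lborel. bump a b s x)" by (simp add: bump_nonneg assms)
  moreover have "(LINT x|lborel. bump a b s x) \<noteq> 0"
  proof
    assume "(LINT x|lborel. bump a b s x) = 0"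
    then have "AE x in lborel. bump a b s x = 0"
      using integral_nonneg_eq_0_iff_AE[OF bump_integrable[OF assms(1)]] bump_nonneg[OF assms(1)] by auto
    then have "AE x in lborel. x \<notin> box a b"
      by eventually_elim (use assms(1) in \<open>auto simp: bump_eq\<close>)
    then have "box a b \<in> null_sets lborel"
      by (subst AE_iff_null_sets) auto
    then have "negligible (box a b)" by (simp add: negligible_iff_null_sets null_sets_completionI)
    then show False using open_not_negligible[OF open_box assms(2)] by blast
  qed
  ultimately show ?thesis by linarith
qed

lemma lborel_integral_reflect:
  fixes g :: "point \<Rightarrow> real"
  assumes "g \<in> borel_measurable borel"
  shows "(LINT y|lborel. g (x - y)) = (LINT y|lborel. g y)"
proof -
  have "lborel = distr lborel borel (\<lambda>y. x - y)"
    using lborel_affine[of "-1" x] by (simp add: density_1)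
  then have "(LINT y|lborel. g y) = (LINT y|distr lborel borel (\<lambda>y. x - y). g y)" by simp
  also have "\<dots> = (LINT y|lborel. g (x - y))" by (rule integral_distr) (use assms in auto)
  finally show ?thesis by simp
qed

text \<open>F averages the translates f (x - y) over small y with a probability density, so an
  estimate valid for all these translates is inherited by F; the last two properties are instances
  of this. In the last one, c = 0 yields Lipschitz bounds for F, and c linear in x - x' yields
  approximation of its gradient.\<close>

lemma mollify:
  fixes f :: "point \<Rightarrow> real"
  assumes f: "continuous_on UNIV f" and S: "bounded S" "\<And>x. x \<notin> S \<Longrightarrow> f x = 0" and e: "\<epsilon> > 0"
  obtains F where "smooth F"
    "\<And>x. F x \<noteq> 0 \<Longrightarrow> \<exists>y. f y \<noteq> 0 \<and> norm (x - y) \<le> 2 * \<epsilon>"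
    "\<And>x d. (\<And>y. norm y \<le> 2 * \<epsilon> \<Longrightarrow> \<bar>f (x - y) - f x\<bar> \<le> d) \<Longrightarrow> \<bar>F x - f x\<bar> \<le> d"
    "\<And>x x' c d. (\<And>y. norm y \<le> 2 * \<epsilon> \<Longrightarrow> \<bar>f (x - y) - f (x' - y) - c\<bar> \<le> d) \<Longrightarrow> \<bar>F x - F x' - c\<bar> \<le> d"
proof -
  obtain A where A: "S \<subseteq> cbox (-A) A" using bounded_subset_cbox_symmetric[OF S(1)] by blast
  \<comment> \<open>The box of half width \<epsilon> lies within norm 2 \<epsilon>, because the norm
    is at most the sum of the moduli of the two coordinates.\<close>
  define v where "v = (\<chi> i::2. \<epsilon>)"
  define I where "I = (LINT x|lborel. bump (-v) v 1 x)"
  define \<rho> where "\<rho> = (\<lambda>x. bump (-v) v 1 x * (1 / I))"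
  have "0 \<in> box (-v) v" using e by (simp add: mem_box_2 v_def)
  then have I: "I > 0" unfolding I_def by (intro bump_integral_pos) auto
  have sm: "smooth \<rho>" unfolding \<rho>_def by (intro smooth_mult smooth_bump smooth_const)
  have \<rho>0: "\<rho> x \<ge> 0" for x using I by (simp add: \<rho>_def bump_nonneg)
  have \<rho>out: "\<rho> x = 0" if "norm x > 2 * \<epsilon>" for x
  proof (rule ccontr)
    assume "\<rho> x \<noteq> 0"
    then have "x \<in> box (-v) v" by (auto simp: \<rho>_def bump_eq split: if_splits)
    then have "\<bar>x $ 1\<bar> < \<epsilon>" "\<bar>x $ 2\<bar> < \<epsilon>" by (auto simp: mem_box_2 v_def)
    then have "(\<Sum>i\<in>UNIV. \<bar>x $ i\<bar>) < 2 * \<epsilon>" by (simp add: sum_2)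
    then show False using norm_le_l1_cart[of x] that by linarith
  qed
  have \<rho>int: "integrable lborel \<rho>" and \<rho>1: "(LINT x|lborel. \<rho> x) = 1"
    using I bump_integrable[of 1 "-v" v] by (auto simp: \<rho>_def I_def)
  have \<rho>c: "continuous_on UNIV \<rho>" by (rule smooth_continuous[OF sm])
  define F where "F = (\<lambda>x. integral (cbox (-A) A) (\<lambda>y. f y * \<rho> (x - y)))"
  have smF: "smooth F" unfolding F_def by (rule smooth_convolution[OF f sm])
  have c1: "continuous_on UNIV (\<lambda>y. f (x - y) * \<rho> y)" for x
    by (intro continuous_on_mult \<rho>c continuous_on_compose2[OF f] continuous_intros) auto
  have c2: "continuous_on UNIV (\<lambda>y. f y * \<rho> (x - y))" for x
    by (intro continuous_on_mult f continuous_on_compose2[OF \<rho>c] continuous_intros) auto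
  have int: "integrable lborel (\<lambda>y. f (x - y) * \<rho> y)" for x
    by (rule continuous_bounded_support_integrable[OF c1 bounded_cball[of 0 "2 * \<epsilon>"]]) (simp add: \<rho>out)
  have Feq: "F x = (LINT y|lborel. f (x - y) * \<rho> y)" for x
  proof -
    have "integrable lborel (\<lambda>y. f y * \<rho> (x - y))"
      by (rule continuous_bounded_support_integrable[OF c2 S(1)]) (simp add: S)
    then have "integral UNIV (\<lambda>y. f y * \<rho> (x - y)) = (LINT y|lborel. f y * \<rho> (x - y))"
      by (rule integral_lborel)
    moreover have "integral UNIV (\<lambda>y. f y * \<rho> (x - y)) = F x"
    proof -
      have "integral UNIV (\<lambda>y. f y * \<rho> (x - y)) =
          integral UNIV (\<lambda>y. if y \<in> cbox (-A) A then f y * \<rho> (x - y) else 0)"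
        by (rule Henstock_Kurzweil_Integration.integral_cong) (use A S in auto)
      then show ?thesis unfolding F_def by (simp only: integral_restrict_UNIV)
    qed
    moreover have "(LINT y|lborel. f y * \<rho> (x - y)) = (LINT y|lborel. f (x - y) * \<rho> (x - (x - y)))"
      by (rule lborel_integral_reflect[symmetric]) (rule borel_measurable_continuous_onI[OF c2])
    ultimately show ?thesis by simp
  qed
  have bound: "\<bar>(LINT y|lborel. g y * \<rho> y)\<bar> \<le> d"
    if g: "integrable lborel (\<lambda>y. g y * \<rho> y)" and le: "\<And>y. norm y \<le> 2 * \<epsilon> \<Longrightarrow> \<bar>g y\<bar> \<le> d" for g d
  proof -
    have "\<bar>(LINT y|lborel. g y * \<rho> y)\<bar> \<le> (LINT y|lborel. \<bar>g y * \<rho> y\<bar>)"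
      by (rule integral_abs_bound)
    also have "\<dots> \<le> (LINT y|lborel. d * \<rho> y)"
    proof (rule integral_mono)
      fix y
      show "\<bar>g y * \<rho> y\<bar> \<le> d * \<rho> y"
        using le[of y] \<rho>out[of y] \<rho>0[of y] by (cases "norm y \<le> 2 * \<epsilon>") (auto simp: abs_mult mult_right_mono)
    qed (use g \<rho>int in auto)
    finally show ?thesis using \<rho>1 by simp
  qed
  show thesis
  proof
    show "smooth F" by (fact smF)
    show "\<exists>y. f y \<noteq> 0 \<and> norm (x - y) \<le> 2 * \<epsilon>" if "F x \<noteq> 0" for x
    proof (rule ccontr)
      assume "\<not> ?thesis"
      then have "f (x - y) * \<rho> y = 0" for y
        using \<rho>out[of y] by (metis diff_diff_eq2 add_diff_cancel_left' linorder_not_le mult_eq_0_iff)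
      then have "(\<lambda>y. f (x - y) * \<rho> y) = (\<lambda>y. 0)" by blast
      then show False using that by (simp only: Feq) simp
    qed
    show "\<bar>F x - f x\<bar> \<le> d" if "\<And>y. norm y \<le> 2 * \<epsilon> \<Longrightarrow> \<bar>f (x - y) - f x\<bar> \<le> d" for x d
    proof -
      have "F x - f x = (LINT y|lborel. (f (x - y) - f x) * \<rho> y)"
        using int[of x] \<rho>int \<rho>1 by (simp add: Feq left_diff_distrib)
      moreover have "integrable lborel (\<lambda>y. (f (x - y) - f x) * \<rho> y)"
        using int[of x] \<rho>int by (simp add: left_diff_distrib)
      ultimately show ?thesis using bound[OF _ that] by simp
    qed
    show "\<bar>F x - F x' - c\<bar> \<le> d" if "\<And>y. norm y \<le> 2 * \<epsilon> \<Longrightarrow> \<bar>f (x - y) - f (x' - y) - c\<bar> \<le> d" for x x' c d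
    proof -
      have "F x - F x' - c = (LINT y|lborel. (f (x - y) - f (x' - y) - c) * \<rho> y)"
        using int[of x] int[of x'] \<rho>int \<rho>1 by (simp add: Feq left_diff_distrib)
      moreover have "integrable lborel (\<lambda>y. (f (x - y) - f (x' - y) - c) * \<rho> y)"
        using int[of x] int[of x'] \<rho>int by (simp add: left_diff_distrib)
      ultimately show ?thesis using bound[OF _ that] by simp
    qed
  qed
qed

section \<open>Strict differentiability and approximation by test functions\<close>

text \<open>Strict differentiability, where both points of the difference quotient move. In this
  form the property passes to convolutions directly, by averaging over translates.\<close>

definition strict_grad :: "(point \<Rightarrow> real) \<Rightarrow> point \<Rightarrow> point \<Rightarrow> bool" where
  "strict_grad W x l \<longleftrightarrow> (\<forall>d>0. \<exists>r>0. \<forall>y\<in>ball x r. \<forall>y'\<in>ball x r.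
     \<bar>W y - W y' - l \<bullet> (y - y')\<bar> \<le> d * norm (y - y'))"

text \<open>Differentiation along h = grd F x - l turns the first-order bound into
  \<open>norm h * norm h \<le> d * norm h\<close>.\<close>

lemma grd_near:
  assumes "F differentiable (at x)" "r > 0"
    and le: "\<And>x'. norm (x - x') < r \<Longrightarrow> \<bar>F x - F x' - l \<bullet> (x - x')\<bar> \<le> d * norm (x - x')"
  shows "norm (grd F x - l) \<le> d"
proof (cases "grd F x = l")
  case True
  define e where "e = (axis 1 1 :: point)"
  \<comment> \<open>Here only d \<ge> 0 remains to be shown; one admissible point at distance r / 2
    suffices.\<close>
  have "0 \<le> d * norm (x - (x + (r / 2) *\<^sub>R e))"
    using \<open>r > 0\<close> by (intro order_trans[OF abs_ge_zero le]) (simp add: e_def norm_axis_1)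
  then show ?thesis using True \<open>r > 0\<close> by (simp add: e_def norm_axis_1 zero_le_mult_iff)
next
  case False
  define h where "h = grd F x - l"
  have h: "norm h > 0" using False by (simp add: h_def)
  have *: "((\<lambda>t. F (x + t *\<^sub>R h) - l \<bullet> (t *\<^sub>R h)) has_derivative
      (\<lambda>t. grd F (x + 0 *\<^sub>R h) \<bullet> (t *\<^sub>R h) - l \<bullet> (t *\<^sub>R h))) (at 0)"
    by (intro has_derivative_diff has_derivative_compose[of "\<lambda>t. x + t *\<^sub>R h" _ 0 UNIV F] has_derivative_inner_right)
       (auto intro!: derivative_eq_intros has_derivative_grd assms)
  then have "((\<lambda>t. F (x + t *\<^sub>R h) - l \<bullet> (t *\<^sub>R h)) has_real_derivative h \<bullet> h) (at 0)"
  proof -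
    have "(\<lambda>t. grd F (x + 0 *\<^sub>R h) \<bullet> (t *\<^sub>R h) - l \<bullet> (t *\<^sub>R h)) = (*) (h \<bullet> h)"
      by (rule ext) (simp add: right_diff_distrib[symmetric] inner_diff_left[symmetric] h_def[symmetric])
    then show ?thesis using * by (simp only: has_field_derivative_def)
  qed
  then have lim: "((\<lambda>t. (F (x + t *\<^sub>R h) - F x - t * (l \<bullet> h)) / t) \<longlongrightarrow> h \<bullet> h) (at_right 0)"
    unfolding DERIV_def by (auto simp: algebra_simps intro: tendsto_mono[OF at_le])
  have "h \<bullet> h \<le> d * norm h"
  proof (rule tendsto_upperbound[OF lim])
    show "\<forall>\<^sub>F t in at_right 0. (F (x + t *\<^sub>R h) - F x - t * (l \<bullet> h)) / t \<le> d * norm h"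
    proof (rule eventually_at_rightI[of 0 "r / norm h"])
      fix t assume t: "t \<in> {0<..<r / norm h}"
      then have "\<bar>F x - F (x + t *\<^sub>R h) - l \<bullet> (x - (x + t *\<^sub>R h))\<bar> \<le> d * norm (x - (x + t *\<^sub>R h))"
        using h by (intro le) (auto simp: field_simps)
      then have "F (x + t *\<^sub>R h) - F x - t * (l \<bullet> h) \<le> d * norm h * t" using t by (auto simp: abs_le_iff algebra_simps)
      then show "(F (x + t *\<^sub>R h) - F x - t * (l \<bullet> h)) / t \<le> d * norm h" using t by (simp add: field_simps)
    qed (use h \<open>r > 0\<close> in auto)
  qed simp
  then have "norm h * norm h \<le> d * norm h" by (simp add: dot_square_norm power2_eq_square)
  then show ?thesis using h by (simp add: h_def)
qed

text \<open>The cutoff is 0 for d \<le> \<delta> and 1 for d \<ge> 2 \<delta>. Its slope 1 /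
  \<delta> matters only where d < 2 \<delta>, and there W is at most 2 L \<delta>. The two terms of
  the product thus cost L and 2 L.\<close>

lemma cutoff_Lipschitz:
  fixes W :: "point \<Rightarrow> real" and d :: "point \<Rightarrow> real"
  assumes W: "\<And>x y. \<bar>W x - W y\<bar> \<le> L * norm (x - y)" and Wd: "\<And>x. \<bar>W x\<bar> \<le> L * d x"
    and d: "\<And>x y. \<bar>d x - d y\<bar> \<le> norm (x - y)" "\<And>x. d x \<ge> 0" and e: "\<delta> > 0" and L: "L \<ge> 0"
  defines "ct \<equiv> \<lambda>x. max 0 (min 1 (d x / \<delta> - 1))"
  shows "\<bar>ct x * W x - ct y * W y\<bar> \<le> 3 * L * norm (x - y)"
proof -
  \<comment> \<open>The product is split so that the difference of the cutoff is multiplied by W at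
    the point nearer to the boundary.\<close>
  have *: "\<bar>ct x * W x - ct y * W y\<bar> \<le> 3 * L * norm (x - y)" if "d y \<le> d x" for x y
  proof -
    have c01: "0 \<le> ct x" "ct x \<le> 1" for x by (auto simp: ct_def)
    have "ct x * W x - ct y * W y = ct x * (W x - W y) + W y * (ct x - ct y)" by (simp add: algebra_simps)
    moreover have "\<bar>ct x * (W x - W y)\<bar> \<le> 1 * (L * norm (x - y))"
      unfolding abs_mult using c01 by (intro mult_mono W) auto
    moreover have "\<bar>W y * (ct x - ct y)\<bar> \<le> 2 * L * norm (x - y)"
    proof (cases "d y \<ge> 2 * \<delta>")
      case True
      then have "ct x = 1" "ct y = 1" using that e by (auto simp: ct_def field_simps)
      then show ?thesis using L by simp
    next
      case False
      have "\<bar>ct x - ct y\<bar> \<le> \<bar>d x / \<delta> - d y / \<delta>\<bar>" by (auto simp: ct_def max_def min_def abs_if)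
      also have "\<dots> = \<bar>d x - d y\<bar> / \<delta>" using e by (simp add: diff_divide_distrib[symmetric])
      also have "\<dots> \<le> norm (x - y) / \<delta>" using e d by (simp add: divide_right_mono)
      finally have 1: "\<bar>ct x - ct y\<bar> \<le> norm (x - y) / \<delta>" .
      have "\<bar>W y\<bar> \<le> L * (2 * \<delta>)"
        by (rule order_trans[OF Wd]) (use False L in \<open>intro mult_left_mono, auto\<close>)
      then have "\<bar>W y\<bar> * \<bar>ct x - ct y\<bar> \<le> L * (2 * \<delta>) * (norm (x - y) / \<delta>)"
        using 1 L e by (intro mult_mono) auto
      then show ?thesis unfolding abs_mult using e by (simp add: field_simps)
    qed
    ultimately show ?thesis by linarith
  qed
  show ?thesis
    using *[of x y] *[of y x] by (cases "d y \<le> d x") (auto simp: abs_minus_commute norm_minus_commute)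
qed

text \<open>Cutting off at distance \<delta> n from the complement and mollifying at a smaller scale
  keeps the supports inside \<Omega>, and the Lipschitz constant 3 L of the cut-off functions bounds
  all gradients. At a fixed point of \<Omega> the cutoff is eventually inactive, which gives the two
  limits.\<close>

lemma test_fun_approximation:
  fixes W :: "point \<Rightarrow> real"
  assumes \<Omega>: "open \<Omega>" "bounded \<Omega>"
    and W: "\<And>x y. \<bar>W x - W y\<bar> \<le> L * norm (x - y)" and W0: "\<And>x. x \<notin> \<Omega> \<Longrightarrow> W x = 0"
  obtains \<phi> :: "nat \<Rightarrow> point \<Rightarrow> real" and B where "\<And>n. test_fun \<Omega> (\<phi> n)"
    "\<And>n x. \<bar>\<phi> n x\<bar> \<le> B" "\<And>n x. norm (grd (\<phi> n) x) \<le> B"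
    "\<And>x. \<bar>W x\<bar> \<le> B"
    "\<And>x. x \<in> \<Omega> \<Longrightarrow> (\<lambda>n. \<phi> n x) \<longlonglongrightarrow> W x"
    "\<And>x l. x \<in> \<Omega> \<Longrightarrow> strict_grad W x l \<Longrightarrow> (\<lambda>n. grd (\<phi> n) x) \<longlonglongrightarrow> l"
proof -
  have "L \<ge> 0" using order_trans[OF abs_ge_zero W[of "axis 1 1" 0]] by (simp add: norm_axis_1)
  obtain R where R: "R > 0" "\<And>x. x \<in> \<Omega> \<Longrightarrow> norm x \<le> R" using \<Omega>(2) by (meson bounded_pos)
  \<comment> \<open>A point outside \<Omega>, where W vanishes: it makes the complement nonempty, so
    that distances to it are attained, and turns the Lipschitz constant into a bound for W.\<close>
  define y0 where "y0 = (R + 1) *\<^sub>R (axis 1 1 :: point)"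
  have "norm y0 = R + 1" using R by (simp add: y0_def norm_axis_1)
  then have y0: "y0 \<notin> \<Omega>" using R by force
  define d where "d = (\<lambda>x. infdist x (- \<Omega>))"
  have d_Lip: "\<bar>d x - d y\<bar> \<le> norm (x - y)" for x y
    unfolding d_def dist_norm[symmetric] by (rule infdist_triangle_abs)
  have d0: "d x \<ge> 0" for x by (simp add: d_def infdist_nonneg)
  have dpos: "d x > 0" if "x \<in> \<Omega>" for x
    unfolding d_def using that y0 \<Omega> by (intro infdist_pos_not_in_closed) auto
  have dout: "d x = 0" if "x \<notin> \<Omega>" for x
    using that by (simp add: d_def)
  have Wd: "\<bar>W x\<bar> \<le> L * d x" for x
  proof -
    obtain y where y: "y \<in> - \<Omega>" "d x = dist x y"
      using infdist_attains_inf[of "- \<Omega>" x] \<Omega> y0 by (auto simp: d_def)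
    then show ?thesis using W[of x y] W0[of y] by (simp add: dist_norm)
  qed
  define B0 where "B0 = L * (2 * R + 1)"
  have WB: "\<bar>W x\<bar> \<le> B0" for x
  proof (cases "x \<in> \<Omega>")
    case True
    have "norm (x - y0) \<le> 2 * R + 1"
      using norm_triangle_ineq4[of x y0] R(2)[OF True] \<open>norm y0 = R + 1\<close> by linarith
    then have "L * norm (x - y0) \<le> B0" unfolding B0_def using \<open>L \<ge> 0\<close> by (rule mult_left_mono)
    then show ?thesis using W[of x y0] W0[OF y0] by simp
  next
    case False
    then show ?thesis using W0 \<open>L \<ge> 0\<close> R by (simp add: B0_def)
  qed
  define \<delta> where "\<delta> = (\<lambda>n. inverse (real (Suc n)))"
  have \<delta>: "\<delta> n > 0" "\<delta> n \<le> 1" for n by (auto simp: \<delta>_def field_simps)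
  have \<delta>0: "\<delta> \<longlonglongrightarrow> 0" unfolding \<delta>_def by (rule LIMSEQ_inverse_real_of_nat)
  define f where "f = (\<lambda>n x. max 0 (min 1 (d x / \<delta> n - 1)) * W x)"
  have f_Lip: "\<bar>f n x - f n y\<bar> \<le> 3 * L * norm (x - y)" for n x y
    unfolding f_def using cutoff_Lipschitz[of W L d "\<delta> n" x y] W Wd d_Lip d0 \<delta> \<open>L \<ge> 0\<close> by simp
  have f_eq: "f n x = W x" if "d x \<ge> 2 * \<delta> n" for n x
    using that \<delta>[of n] by (simp add: f_def field_simps)
  have f_d: "d x > \<delta> n" if "f n x \<noteq> 0" for n x
  proof (rule ccontr)
    assume "\<not> \<delta> n < d x"
    then have "d x / \<delta> n - 1 \<le> 0" using \<delta>(1)[of n] by (simp add: field_simps)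
    then have "max 0 (min 1 (d x / \<delta> n - 1)) = 0" by linarith
    then show False using that by (simp add: f_def)
  qed
  have f_le: "\<bar>f n x\<bar> \<le> B0" for n x
  proof -
    have "\<bar>f n x\<bar> \<le> 1 * \<bar>W x\<bar>" unfolding f_def abs_mult by (intro mult_right_mono) auto
    then show ?thesis using WB[of x] by simp
  qed
  have f_cont: "continuous_on UNIV (f n)" for n
  proof (rule lipschitz_on_continuous_on[of "3 * L"], rule lipschitz_onI)
    show "dist (f n x) (f n y) \<le> 3 * L * dist x y" for x y
      using f_Lip[of n x y] by (simp add: dist_norm)
  qed (use \<open>L \<ge> 0\<close> in simp)
  \<comment> \<open>The kernel reaches as far as 2 \<epsilon> n = \<delta> n / 2, half the width of
    the strip on which \<open>f n\<close> vanishes.\<close>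
  define \<epsilon> where "\<epsilon> = (\<lambda>n. \<delta> n / 4)"
  have \<epsilon>: "\<epsilon> n > 0" for n using \<delta> by (simp add: \<epsilon>_def)
  have "\<exists>F. smooth F \<and> (\<forall>x. F x \<noteq> 0 \<longrightarrow> (\<exists>y. f n y \<noteq> 0 \<and> norm (x - y) \<le> 2 * \<epsilon> n)) \<and>
      (\<forall>x c. (\<forall>y. norm y \<le> 2 * \<epsilon> n \<longrightarrow> \<bar>f n (x - y) - f n x\<bar> \<le> c) \<longrightarrow> \<bar>F x - f n x\<bar> \<le> c) \<and>
      (\<forall>x x' c e. (\<forall>y. norm y \<le> 2 * \<epsilon> n \<longrightarrow> \<bar>f n (x - y) - f n (x' - y) - c\<bar> \<le> e) \<longrightarrow> \<bar>F x - F x' - c\<bar> \<le> e)" for n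
  proof -
    have "f n x = 0" if "x \<notin> \<Omega>" for x using that W0 by (simp add: f_def)
    from mollify[OF f_cont \<Omega>(2) this \<epsilon>] show ?thesis by metis
  qed
  then obtain \<phi> where \<phi>: "\<And>n. smooth (\<phi> n)"
    "\<And>n x. \<phi> n x \<noteq> 0 \<Longrightarrow> \<exists>y. f n y \<noteq> 0 \<and> norm (x - y) \<le> 2 * \<epsilon> n"
    "\<And>n x c. (\<And>y. norm y \<le> 2 * \<epsilon> n \<Longrightarrow> \<bar>f n (x - y) - f n x\<bar> \<le> c) \<Longrightarrow> \<bar>\<phi> n x - f n x\<bar> \<le> c"
    "\<And>n x x' c e. (\<And>y. norm y \<le> 2 * \<epsilon> n \<Longrightarrow> \<bar>f n (x - y) - f n (x' - y) - c\<bar> \<le> e) \<Longrightarrow> \<bar>\<phi> n x - \<phi> n x' - c\<bar> \<le> e"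
    by metis
  have near: "\<bar>\<phi> n x - f n x\<bar> \<le> 3 * L * \<delta> n" for n x
  proof (rule \<phi>(3))
    fix y :: point assume "norm y \<le> 2 * \<epsilon> n"
    then have "norm y \<le> \<delta> n" using \<delta>(1)[of n] unfolding \<epsilon>_def by linarith
    then have "3 * L * norm (x - y - x) \<le> 3 * L * \<delta> n" using \<open>L \<ge> 0\<close> by (intro mult_left_mono) auto
    then show "\<bar>f n (x - y) - f n x\<bar> \<le> 3 * L * \<delta> n" using f_Lip[of n "x - y" x] by linarith
  qed
  have test: "test_fun \<Omega> (\<phi> n)" for n
  proof -
    define S where "S = {x. \<delta> n / 2 \<le> d x}"
    have "continuous_on UNIV d" unfolding d_def by (intro continuous_on_infdist continuous_on_id)
    then have "closed S" unfolding S_def by (intro closed_Collect_le continuous_on_const)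
    have "S \<subseteq> \<Omega>" using dout \<delta>(1)[of n] by (force simp: S_def)
    have "{x. \<phi> n x \<noteq> 0} \<subseteq> S"
    proof
      fix x assume "x \<in> {x. \<phi> n x \<noteq> 0}"
      then obtain y where y: "f n y \<noteq> 0" "norm (x - y) \<le> 2 * \<epsilon> n" using \<phi>(2) by blast
      then show "x \<in> S" using f_d[OF y(1)] d_Lip[of x y] by (simp add: S_def \<epsilon>_def)
    qed
    then have "closure {x. \<phi> n x \<noteq> 0} \<subseteq> S" using \<open>closed S\<close> by (rule closure_minimal)
    moreover have "bounded S" using \<Omega>(2) \<open>S \<subseteq> \<Omega>\<close> by (rule bounded_subset)
    ultimately show ?thesis
      using \<open>S \<subseteq> \<Omega>\<close> \<phi>(1)[of n]
      unfolding test_fun_def smooth_def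
      by (meson bounded_subset closed_closure compact_eq_bounded_closed order_trans)
  qed
  show thesis
  proof (rule that)
    show "test_fun \<Omega> (\<phi> n)" for n by (fact test)
    show "\<bar>\<phi> n x\<bar> \<le> B0 + 3 * L" for n x
    proof -
      have "3 * L * \<delta> n \<le> 3 * L * 1" using \<delta>[of n] \<open>L \<ge> 0\<close> by (intro mult_left_mono) auto
      then show ?thesis using near[of n x] f_le[of n x] by linarith
    qed
    have "B0 \<ge> 0" using WB[of 0] by linarith
    show "norm (grd (\<phi> n) x) \<le> B0 + 3 * L" for n x
    proof -
      have "norm (grd (\<phi> n) x - 0) \<le> 3 * L"
      proof (rule grd_near[of _ _ 1])
        fix x'
        have "\<bar>\<phi> n x - \<phi> n x' - 0\<bar> \<le> 3 * L * norm (x - x')"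
          by (rule \<phi>(4)) (use f_Lip[of n] in \<open>auto intro!: order_trans[OF f_Lip]\<close>)
        then show "\<bar>\<phi> n x - \<phi> n x' - 0 \<bullet> (x - x')\<bar> \<le> 3 * L * norm (x - x')" by simp
      qed (simp_all add: smooth_diff \<phi>)
      then show ?thesis using \<open>B0 \<ge> 0\<close> by simp
    qed
    show "\<bar>W x\<bar> \<le> B0 + 3 * L" for x using WB[of x] \<open>L \<ge> 0\<close> by linarith
    show "(\<lambda>n. \<phi> n x) \<longlonglongrightarrow> W x" if "x \<in> \<Omega>" for x
    proof -
      have "\<forall>\<^sub>F n in sequentially. \<delta> n < d x / 2" using order_tendstoD(2)[OF \<delta>0, of "d x / 2"] dpos[OF that] by linarith
      then have "\<forall>\<^sub>F n in sequentially. norm (\<phi> n x - W x) \<le> 3 * L * \<delta> n"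
      proof eventually_elim
        case (elim n)
        then show ?case using near[of n x] f_eq[of n x] by simp
      qed
      moreover have "(\<lambda>n. 3 * L * \<delta> n) \<longlonglongrightarrow> 0" using tendsto_mult_left[OF \<delta>0, of "3 * L"] by simp
      ultimately have "(\<lambda>n. \<phi> n x - W x) \<longlonglongrightarrow> 0" by (rule Lim_null_comparison)
      then show ?thesis by (simp add: LIM_zero_iff)
    qed
    show "(\<lambda>n. grd (\<phi> n) x) \<longlonglongrightarrow> l" if x: "x \<in> \<Omega>" and l: "strict_grad W x l" for x l
    proof (rule LIMSEQ_I)
      fix e :: real assume "e > 0"
      then obtain r where r: "r > 0" "\<And>y y'. y \<in> ball x r \<Longrightarrow> y' \<in> ball x r \<Longrightarrow>
          \<bar>W y - W y' - l \<bullet> (y - y')\<bar> \<le> e / 2 * norm (y - y')"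
        using l unfolding strict_grad_def by (metis half_gt_zero)
      \<comment> \<open>Within s of x the distance d is at least d x / 2, so for \<delta> n < s / 2
        the cutoff is inactive there; and s \<le> r keeps the linear approximation of W
        valid.\<close>
      define s where "s = min r (d x / 2)"
      have s: "s > 0" using r dpos[OF x] by (simp add: s_def)
      then obtain N where N: "\<And>n. n \<ge> N \<Longrightarrow> \<delta> n < s / 2"
        using order_tendstoD(2)[OF \<delta>0, of "s / 2"] by (auto simp: eventually_sequentially)
      have "norm (grd (\<phi> n) x - l) < e" if "n \<ge> N" for n
      proof -
        have "norm (grd (\<phi> n) x - l) \<le> e / 2"
        proof (rule grd_near[of _ _ "s / 2"])
          fix x' assume x': "norm (x - x') < s / 2"
          show "\<bar>\<phi> n x - \<phi> n x' - l \<bullet> (x - x')\<bar> \<le> e / 2 * norm (x - x')"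
          proof (rule \<phi>(4))
            fix y :: point assume y: "norm y \<le> 2 * \<epsilon> n"
            have "norm y < s / 2" using y N[OF that] \<delta>(1)[of n] unfolding \<epsilon>_def by linarith
            then have b: "norm (x - (x - y)) < s" "norm (x - (x' - y)) < s"
              using x' s norm_triangle_ineq[of "x - x'" y] by (auto simp: algebra_simps)
            then have "d (x - y) \<ge> 2 * \<delta> n" "d (x' - y) \<ge> 2 * \<delta> n"
              using d_Lip[of x "x - y"] d_Lip[of x "x' - y"] N[OF that] unfolding s_def by linarith+
            moreover have "x - y \<in> ball x r" "x' - y \<in> ball x r"
              using b by (auto simp: s_def dist_norm)
            ultimately show "\<bar>f n (x - y) - f n (x' - y) - l \<bullet> (x - x')\<bar> \<le> e / 2 * norm (x - x')"
              using r(2)[of "x - y" "x' - y"] by (simp add: f_eq)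
          qed
        qed (use s in \<open>simp_all add: smooth_diff \<phi>\<close>)
        then show ?thesis using \<open>e > 0\<close> by linarith
      qed
      then show "\<exists>no. \<forall>n\<ge>no. norm (grd (\<phi> n) x - l) < e" by blast
    qed
  qed
qed

lemma grad_AE:
  assumes "open U" "bounded U" "weak_gradient U v G"
  shows "AE x in lebesgue_on U. grad U v x = G x"
  using assms weak_gradient_unique someI[of "weak_gradient U v" G] unfolding grad_def by blast

lemma weak_gradient_diff:
  assumes U: "open U" "bounded U" and v: "L2 U v" "weak_gradient U v G" and w: "L2 U w" "weak_gradient U w H"
  shows "weak_gradient U (\<lambda>x. v x - w x) (\<lambda>x. G x - H x)"
  unfolding weak_gradient_def
proof (intro conjI allI impI)
  have Um: "U \<in> lmeasurable" using U by (simp add: lmeasurable_open)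
  have G: "L2 U G" "L2 U H" using v w by (auto simp: weak_gradient_def)
  show "L2 U (\<lambda>x. G x - H x)" using G by (rule L2_diff)
  fix \<phi> i j assume \<phi>: "test_fun U \<phi>"
  note L = test_fun_L2[OF \<phi> Um]
  have "integrable (lebesgue_on U) (\<lambda>x. v x $ i * pderiv_at j \<phi> x)" "integrable (lebesgue_on U) (\<lambda>x. w x $ i * pderiv_at j \<phi> x)"
    "integrable (lebesgue_on U) (\<lambda>x. G x $ i $ j * \<phi> x)" "integrable (lebesgue_on U) (\<lambda>x. H x $ i $ j * \<phi> x)"
    using v w G L by (auto intro!: L2_times_integrable L2_nth)
  then show "(LINT x|lebesgue_on U. (v x - w x) $ i * pderiv_at j \<phi> x) =
      - (LINT x|lebesgue_on U. (G x - H x) $ i $ j * \<phi> x)"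
    using v w \<phi> by (simp add: weak_gradient_def left_diff_distrib)
qed

lemma weak_gradient_test_field:
  assumes U: "open U" "bounded U" and w: "\<And>i. test_fun U (\<lambda>x. w x $ i)"
  shows "weak_gradient U w (\<lambda>x. \<chi> i. grd (\<lambda>x. w x $ i) x)"
  unfolding weak_gradient_def
proof (intro conjI allI impI)
  have Um: "U \<in> lmeasurable" using U by (simp add: lmeasurable_open)
  have "\<exists>B. \<forall>x j. \<bar>pderiv_at j (\<lambda>x. w x $ i) x\<bar> \<le> B" for i
    using test_fun_bounded[OF w] by metis
  then obtain B where B: "\<And>i x j. \<bar>pderiv_at j (\<lambda>x. w x $ i) x\<bar> \<le> B i" by metis
  have "norm (\<chi> i. grd (\<lambda>x. w x $ i) x) \<le> (\<Sum>i\<in>UNIV. (\<Sum>j\<in>(UNIV::2 set). B i))" for x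
  proof -
    have "norm (\<chi> i. grd (\<lambda>x. w x $ i) x) \<le> (\<Sum>i\<in>UNIV. norm ((\<chi> i. grd (\<lambda>x. w x $ i) x) $ i))"
      by (rule norm_vec_le_sum)
    also have "\<dots> \<le> (\<Sum>i\<in>UNIV. (\<Sum>j\<in>(UNIV::2 set). B i))"
    proof (rule sum_mono)
      fix i :: 2
      show "norm ((\<chi> i. grd (\<lambda>x. w x $ i) x) $ i) \<le> (\<Sum>j\<in>(UNIV::2 set). B i)"
        using B[of 1 i x] B[of 2 i x] norm_le_l1_cart[of "grd (\<lambda>x. w x $ i) x"]
        by (simp add: sum_2 grd_def)
    qed
    finally show ?thesis .
  qed
  moreover have "continuous_on U (\<lambda>x. \<chi> i. grd (\<lambda>x. w x $ i) x)"
    by (intro continuous_on_vec_lambda smooth_continuous_grd test_fun_smooth[OF w])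
  ultimately show "L2 U (\<lambda>x. \<chi> i. grd (\<lambda>x. w x $ i) x)"
    using Um by (auto intro!: L2_bounded continuous_imp_measurable_on_sets_lebesgue)
  fix \<phi> i j assume "test_fun U \<phi>"
  note sm = test_fun_smooth[OF w]
  show "(LINT x|lebesgue_on U. w x $ i * pderiv_at j \<phi> x) =
      - (LINT x|lebesgue_on U. (\<chi> i. grd (\<lambda>x. w x $ i) x) $ i $ j * \<phi> x)"
    using LINT_product_rule[OF smooth_diff[OF sm] smooth_continuous_grd[OF sm] \<open>test_fun U \<phi>\<close>, of i j] U(1)
    by (simp add: grd_def)
qed

lemma l2norm_cong_AE:
  assumes "U \<in> sets lebesgue" "L2 U f" "L2 U g" "AE x in lebesgue_on U. f x = g x"
  shows "l2norm U f = l2norm U g"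
  unfolding l2norm_def l2inner_eq_norm
proof (intro arg_cong[where f = sqrt] integral_cong_AE)
  show "AE x in lebesgue_on U. (norm (f x))\<^sup>2 = (norm (g x))\<^sup>2"
    using assms(4) by eventually_elim simp
qed (use assms L2_square_integrable in auto)

lemma grad_L2:
  assumes "weak_gradient U v G"
  shows "L2 U (grad U v)"
  using someI[of "weak_gradient U v" G] assms unfolding grad_def weak_gradient_def by blast

text \<open>The approximating test fields and their gradients are uniformly bounded and converge
  almost everywhere. Dominated convergence then gives both the weak gradient identity for W and the
  convergence in the H1 norm. The gradient is prescribed almost everywhere only, which spares the
  edges of a mesh.\<close>

theorem V_space_Lipschitz:
  fixes W :: vfield and G :: tensor_field
  assumes \<Omega>: "open \<Omega>" "bounded \<Omega>"
    and W: "\<And>i x y. \<bar>W x $ i - W y $ i\<bar> \<le> L * norm (x - y)" and W0: "\<And>x. x \<notin> \<Omega> \<Longrightarrow> W x = 0"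
    and G: "L2 \<Omega> G" "AE x in lebesgue_on \<Omega>. \<forall>i. strict_grad (\<lambda>x. W x $ i) x (G x $ i)"
  shows "weak_gradient \<Omega> W G" "W \<in> V_space \<Omega>"
proof -
  have Um: "\<Omega> \<in> lmeasurable" using \<Omega> by (simp add: lmeasurable_open)
  then have Us: "\<Omega> \<in> sets lebesgue" by auto
  have "\<exists>\<phi> B. (\<forall>n. test_fun \<Omega> (\<phi> n)) \<and> (\<forall>n x. \<bar>\<phi> n x\<bar> \<le> B) \<and> (\<forall>n x. norm (grd (\<phi> n) x) \<le> B) \<and>
    (\<forall>x. \<bar>W x $ i\<bar> \<le> B) \<and> (\<forall>x\<in>\<Omega>. (\<lambda>n::nat. \<phi> n x) \<longlonglongrightarrow> W x $ i) \<and>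
    (\<forall>x\<in>\<Omega>. \<forall>l. strict_grad (\<lambda>x. W x $ i) x l \<longrightarrow> (\<lambda>n. grd (\<phi> n) x) \<longlonglongrightarrow> l)" for i
    by (rule test_fun_approximation[OF \<Omega>, of "\<lambda>x. W x $ i" L]) (use W W0 in \<open>auto, blast\<close>)
  then obtain \<phi> B where \<phi>: "\<And>i n. test_fun \<Omega> (\<phi> i n)" "\<And>i n x. \<bar>\<phi> i n x\<bar> \<le> B i"
    "\<And>i n x. norm (grd (\<phi> i n) x) \<le> B i" "\<And>i x. \<bar>W x $ i\<bar> \<le> B i"
    "\<And>i x. x \<in> \<Omega> \<Longrightarrow> (\<lambda>n::nat. \<phi> i n x) \<longlonglongrightarrow> W x $ i"
    "\<And>i x l. x \<in> \<Omega> \<Longrightarrow> strict_grad (\<lambda>x. W x $ i) x l \<Longrightarrow> (\<lambda>n. grd (\<phi> i n) x) \<longlonglongrightarrow> l"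
    by metis
  define w :: "nat \<Rightarrow> vfield" where "w = (\<lambda>n x. \<chi> i. \<phi> i n x)"
  define H :: "nat \<Rightarrow> tensor_field" where "H = (\<lambda>n x. \<chi> i. grd (\<phi> i n) x)"
  have w_nth: "(\<lambda>x. w n x $ i) = \<phi> i n" for n i by (simp add: w_def)
  have wt: "test_fun \<Omega> (\<lambda>x. w n x $ i)" for n i by (simp add: w_nth \<phi>)
  have wH: "weak_gradient \<Omega> (w n) (H n)" for n
    using weak_gradient_test_field[OF \<Omega> wt, of n] by (simp add: H_def w_nth)
  define C where "C = (\<Sum>i\<in>UNIV. B i)"
  have wC: "norm (w n x) \<le> C" and HC: "norm (H n x) \<le> C" and WC: "norm (W x) \<le> C" for n x
    unfolding C_def by (rule order_trans[OF norm_vec_le_sum], rule sum_mono, simp add: \<phi> w_def H_def)+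
  have w_lim: "(\<lambda>n. w n x) \<longlonglongrightarrow> W x" if "x \<in> \<Omega>" for x
    using \<phi>(5)[OF that] by (auto intro!: vec_tendstoI simp: w_def)
  have "AE x in lebesgue_on \<Omega>. x \<in> space (lebesgue_on \<Omega>)" by (rule AE_space)
  then have inO: "AE x in lebesgue_on \<Omega>. x \<in> \<Omega>" by simp
  have H_lim: "AE x in lebesgue_on \<Omega>. (\<lambda>n. H n x) \<longlonglongrightarrow> G x"
    using G(2) inO
  proof eventually_elim
    case (elim x)
    show ?case by (rule vec_tendstoI) (use elim in \<open>simp add: H_def \<phi>(6)\<close>)
  qed
  have L2w: "L2 \<Omega> (w n)" for n
    by (rule L2_bounded[OF Um _ wC]) (auto intro!: continuous_imp_measurable_on_sets_lebesgue Us continuous_on_vec_lambda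
        smooth_continuous test_fun_smooth[OF \<phi>(1)] simp: w_def)
  have contW: "continuous_on UNIV W"
  proof -
    have "continuous_on UNIV (\<lambda>x. W x $ i)" for i
    proof (rule lipschitz_on_continuous_on[of "\<bar>L\<bar>"], rule lipschitz_onI)
      fix x y
      have "\<bar>W x $ i - W y $ i\<bar> \<le> \<bar>L\<bar> * norm (x - y)"
        by (rule order_trans[OF W]) (simp add: mult_right_mono)
      then show "dist (W x $ i) (W y $ i) \<le> \<bar>L\<bar> * dist x y" by (simp add: dist_norm)
    qed simp
    then have "continuous_on UNIV (\<lambda>x. \<chi> i. W x $ i)" by (rule continuous_on_vec_lambda)
    then show ?thesis by simp
  qed
  have L2W: "L2 \<Omega> W"
    by (rule L2_bounded[OF Um _ WC])
       (rule continuous_imp_measurable_on_sets_lebesgue[OF continuous_on_subset[OF contW] Us], simp)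
  have L2H: "L2 \<Omega> (H n)" for n using wH by (simp add: weak_gradient_def)
  show WG: "weak_gradient \<Omega> W G"
    unfolding weak_gradient_def
  proof (intro conjI allI impI)
    fix \<psi> i j assume \<psi>: "test_fun \<Omega> \<psi>"
    note L = test_fun_L2[OF \<psi> Um]
    have 1: "(\<lambda>n. LINT x|lebesgue_on \<Omega>. w n x $ i * pderiv_at j \<psi> x) \<longlonglongrightarrow>
        (LINT x|lebesgue_on \<Omega>. W x $ i * pderiv_at j \<psi> x)"
    proof (rule integral_dominated_convergence[where w = "\<lambda>x. C * \<bar>pderiv_at j \<psi> x\<bar>"])
      show "integrable (lebesgue_on \<Omega>) (\<lambda>x. C * \<bar>pderiv_at j \<psi> x\<bar>)"
        using L2_integrable[OF Um L(2)] by auto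
      show "AE x in lebesgue_on \<Omega>. (\<lambda>n. w n x $ i * pderiv_at j \<psi> x) \<longlonglongrightarrow> W x $ i * pderiv_at j \<psi> x"
        using inO by eventually_elim (intro tendsto_mult tendsto_const tendsto_vec_nth w_lim)
      show "AE x in lebesgue_on \<Omega>. norm (w n x $ i * pderiv_at j \<psi> x) \<le> C * \<bar>pderiv_at j \<psi> x\<bar>" for n
        using wC[of n] by (intro AE_I2) (auto simp: abs_mult intro!: mult_right_mono order_trans[OF component_le_norm_cart])
    qed (use L2w L2W L in \<open>auto intro!: borel_measurable_integrable[OF L2_times_integrable] L2_nth\<close>)
    have 2: "(\<lambda>n. LINT x|lebesgue_on \<Omega>. H n x $ i $ j * \<psi> x) \<longlonglongrightarrow> (LINT x|lebesgue_on \<Omega>. G x $ i $ j * \<psi> x)"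
    proof (rule integral_dominated_convergence[where w = "\<lambda>x. C * \<bar>\<psi> x\<bar>"])
      show "integrable (lebesgue_on \<Omega>) (\<lambda>x. C * \<bar>\<psi> x\<bar>)"
        using L2_integrable[OF Um L(1)] by auto
      show "AE x in lebesgue_on \<Omega>. (\<lambda>n. H n x $ i $ j * \<psi> x) \<longlonglongrightarrow> G x $ i $ j * \<psi> x"
        using H_lim by eventually_elim (intro tendsto_mult tendsto_const tendsto_vec_nth)
      show "AE x in lebesgue_on \<Omega>. norm (H n x $ i $ j * \<psi> x) \<le> C * \<bar>\<psi> x\<bar>" for n
        using HC[of n] by (intro AE_I2)
          (auto simp: abs_mult intro!: mult_right_mono order_trans[OF component_le_norm_cart]
             order_trans[OF Finite_Cartesian_Product.norm_nth_le])
    qed (use L2H G L in \<open>auto intro!: borel_measurable_integrable[OF L2_times_integrable] L2_nth\<close>)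
    have "(LINT x|lebesgue_on \<Omega>. w n x $ i * pderiv_at j \<psi> x) = - (LINT x|lebesgue_on \<Omega>. H n x $ i $ j * \<psi> x)" for n
      using wH \<psi> by (simp add: weak_gradient_def)
    with 1 tendsto_minus[OF 2] show "(LINT x|lebesgue_on \<Omega>. W x $ i * pderiv_at j \<psi> x) =
        - (LINT x|lebesgue_on \<Omega>. G x $ i $ j * \<psi> x)"
      by (simp add: LIMSEQ_unique)
  qed (fact G)
  have n1: "(\<lambda>n. (l2norm \<Omega> (\<lambda>x. W x - w n x))\<^sup>2) \<longlonglongrightarrow> 0"
  proof -
    have "(\<lambda>n. LINT x|lebesgue_on \<Omega>. (norm (W x - w n x))\<^sup>2) \<longlonglongrightarrow> (LINT x|lebesgue_on \<Omega>. 0)"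
    proof (rule integral_dominated_convergence[where w = "\<lambda>x. (C + C)\<^sup>2"])
      show "integrable (lebesgue_on \<Omega>) (\<lambda>x. (C + C)\<^sup>2)"
        using finite_measure_lebesgue_on[OF Um] by (simp add: finite_measure.integrable_const)
      show "AE x in lebesgue_on \<Omega>. (\<lambda>n. (norm (W x - w n x))\<^sup>2) \<longlonglongrightarrow> 0"
        using inO by eventually_elim (auto intro!: tendsto_eq_intros w_lim)
      show "AE x in lebesgue_on \<Omega>. norm ((norm (W x - w n x))\<^sup>2) \<le> (C + C)\<^sup>2" for n
      proof (rule AE_I2)
        fix x
        have "norm (W x - w n x) \<le> C + C"
          using norm_triangle_ineq4[of "W x" "w n x"] wC[of n x] WC[of x] by linarith
        from power_mono[OF this norm_ge_zero, of 2]
        show "norm ((norm (W x - w n x))\<^sup>2) \<le> (C + C)\<^sup>2" by simp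
      qed
    qed (use L2W L2w L2_diff[of \<Omega> W "w _"] L2_square_integrable in \<open>auto dest!: borel_measurable_integrable\<close>)
    then show ?thesis by (simp add: l2norm_square)
  qed
  have WwG: "weak_gradient \<Omega> (\<lambda>x. W x - w n x) (\<lambda>x. G x - H n x)" for n
    by (rule weak_gradient_diff[OF \<Omega> L2W WG L2w wH])
  have n2: "(\<lambda>n. (l2norm \<Omega> (grad \<Omega> (\<lambda>x. W x - w n x)))\<^sup>2) \<longlonglongrightarrow> 0"
  proof -
    have "l2norm \<Omega> (grad \<Omega> (\<lambda>x. W x - w n x)) = l2norm \<Omega> (\<lambda>x. G x - H n x)" for n
      using grad_AE[OF \<Omega> WwG] L2_diff[OF G(1) L2H] by (intro l2norm_cong_AE[OF Us] grad_L2[OF WwG])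
    moreover have "(\<lambda>n. LINT x|lebesgue_on \<Omega>. (norm (G x - H n x))\<^sup>2) \<longlonglongrightarrow> (LINT x|lebesgue_on \<Omega>. 0)"
    \<comment> \<open>G is only known to be square integrable, so it enters the dominating function
      itself.\<close>
    proof (rule integral_dominated_convergence[where w = "\<lambda>x. 2 * (norm (G x))\<^sup>2 + 2 * C\<^sup>2"])
      show "integrable (lebesgue_on \<Omega>) (\<lambda>x. 2 * (norm (G x))\<^sup>2 + 2 * C\<^sup>2)"
        using finite_measure_lebesgue_on[OF Um] L2_square_integrable[OF G(1)] by (simp add: finite_measure.integrable_const)
      show "AE x in lebesgue_on \<Omega>. (\<lambda>n. (norm (G x - H n x))\<^sup>2) \<longlonglongrightarrow> 0"
        using H_lim by eventually_elim (auto intro!: tendsto_eq_intros)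
      show "AE x in lebesgue_on \<Omega>. norm ((norm (G x - H n x))\<^sup>2) \<le> 2 * (norm (G x))\<^sup>2 + 2 * C\<^sup>2" for n
      proof (rule AE_I2)
        fix x
        have "(norm (H n x))\<^sup>2 \<le> C\<^sup>2" using HC by (intro power_mono) auto
        then show "norm ((norm (G x - H n x))\<^sup>2) \<le> 2 * (norm (G x))\<^sup>2 + 2 * C\<^sup>2"
          using norm_add_square_le[of "G x" "- H n x"] by simp
      qed
    qed (use L2_diff[OF G(1) L2H] L2_square_integrable in \<open>auto dest!: borel_measurable_integrable\<close>)
    ultimately show ?thesis by (simp add: l2norm_square)
  qed
  have "(\<lambda>n. H1_norm \<Omega> (\<lambda>x. W x - w n x)) \<longlonglongrightarrow> sqrt (0 + 0)"
    unfolding H1_norm_def by (intro tendsto_real_sqrt tendsto_add n1 n2)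
  then show "W \<in> V_space \<Omega>"
    using WG L2W wt unfolding V_space_def H1_def by auto
qed

section \<open>Barycentric coordinates\<close>

text \<open>Twice the signed area of the triangle \<open>a\<close>, \<open>b\<close>, \<open>c\<close>.\<close>

definition dbl :: "point \<Rightarrow> point \<Rightarrow> point \<Rightarrow> real" where
  "dbl a b c = (b $ 1 - a $ 1) * (c $ 2 - a $ 2) - (b $ 2 - a $ 2) * (c $ 1 - a $ 1)"

text \<open>The barycentric coordinate of a, as a quotient of signed areas. Cyclic shifts of the
  first three arguments give the coordinates of b and c, whatever the orientation.\<close>

definition bary :: "point \<Rightarrow> point \<Rightarrow> point \<Rightarrow> point \<Rightarrow> real" where
  "bary a b c x = dbl x b c / dbl a b c"

text \<open>The opposite side turned by a right angle, over twice the signed area.\<close>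

definition bary_grad :: "point \<Rightarrow> point \<Rightarrow> point \<Rightarrow> point" where
  "bary_grad a b c = (1 / dbl a b c) *\<^sub>R (\<chi> i. if i = 1 then b $ 2 - c $ 2 else c $ 1 - b $ 1)"

lemma dbl_rotate: "dbl b c a = dbl a b c" "dbl c a b = dbl a b c"
  by (simp_all add: dbl_def algebra_simps)

lemma dbl_swap: "dbl a c b = - dbl a b c" "dbl b a c = - dbl a b c" "dbl c b a = - dbl a b c"
  by (simp_all add: dbl_def algebra_simps)

lemma dbl_distinct: "dbl a b c \<noteq> 0 \<Longrightarrow> a \<noteq> b \<and> b \<noteq> c \<and> a \<noteq> c"
  by (auto simp: dbl_def)

lemma bary_swap: "bary a c b = bary a b c"
  by (rule ext) (simp add: bary_def dbl_swap(1)[of _ b c])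

lemma dbl_sum: "dbl x b c + dbl x c a + dbl x a b = dbl a b c"
  by (simp add: dbl_def algebra_simps)

lemma bary_sum:
  assumes "dbl a b c \<noteq> 0"
  shows "bary a b c x + bary b c a x + bary c a b x = 1"
  using assms dbl_sum[of x b c a] unfolding bary_def dbl_rotate[where a = a and b = b and c = c]
  by (simp add: add_divide_distrib[symmetric])

lemma bary_combination:
  assumes "dbl a b c \<noteq> 0"
  shows "x = bary a b c x *\<^sub>R a + bary b c a x *\<^sub>R b + bary c a b x *\<^sub>R c"
proof -
  have "dbl a b c * x $ i = dbl x b c * a $ i + dbl x c a * b $ i + dbl x a b * c $ i" for i
    using exhaust_2[of i] by (auto simp: dbl_def algebra_simps)
  then show ?thesis using assms
    by (simp add: vec_eq_iff bary_def dbl_rotate[where a = a and b = b and c = c] add_divide_distrib[symmetric] field_simps)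
qed

lemma bary_of_combination:
  assumes "dbl a b c \<noteq> 0" "u + v + w = 1"
  shows "bary a b c (u *\<^sub>R a + v *\<^sub>R b + w *\<^sub>R c) = u"
proof -
  have u: "u = 1 - v - w" using assms by simp
  have "dbl (u *\<^sub>R a + v *\<^sub>R b + w *\<^sub>R c) b c = u * dbl a b c"
    unfolding u by (simp add: dbl_def algebra_simps)
  then show ?thesis using assms by (simp add: bary_def)
qed

lemma bary_unique:
  assumes "dbl a b c \<noteq> 0" "u + v + w = 1" "x = u *\<^sub>R a + v *\<^sub>R b + w *\<^sub>R c"
  shows "bary a b c x = u" "bary b c a x = v" "bary c a b x = w"
  using assms bary_of_combination[of a b c u v w] bary_of_combination[of b c a v w u]
    bary_of_combination[of c a b w u v] by (simp_all add: dbl_rotate add_ac)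

lemma bary_vertex:
  assumes "dbl a b c \<noteq> 0"
  shows "bary a b c a = 1" "bary a b c b = 0" "bary a b c c = 0"
  using assms by (auto simp: bary_def dbl_def)

lemma mem_triangle_iff:
  assumes "dbl a b c \<noteq> 0"
  shows "x \<in> convex hull {a, b, c} \<longleftrightarrow> 0 \<le> bary a b c x \<and> 0 \<le> bary b c a x \<and> 0 \<le> bary c a b x"
proof
  assume "x \<in> convex hull {a, b, c}"
  then obtain u v w where "0 \<le> u" "0 \<le> v" "0 \<le> w" "u + v + w = 1" "x = u *\<^sub>R a + v *\<^sub>R b + w *\<^sub>R c"
    unfolding convex_hull_3 by blast
  then show "0 \<le> bary a b c x \<and> 0 \<le> bary b c a x \<and> 0 \<le> bary c a b x"
    using bary_unique[OF assms] by metis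
next
  assume "0 \<le> bary a b c x \<and> 0 \<le> bary b c a x \<and> 0 \<le> bary c a b x"
  then show "x \<in> convex hull {a, b, c}"
    unfolding convex_hull_3 using bary_combination[OF assms, of x] bary_sum[OF assms, of x] by blast
qed

lemma bary_diff: "dbl a b c \<noteq> 0 \<Longrightarrow> bary a b c x - bary a b c y = bary_grad a b c \<bullet> (x - y)"
proof -
  assume "dbl a b c \<noteq> 0"
  have "dbl x b c - dbl y b c = (b $ 2 - c $ 2) * (x - y) $ 1 + (c $ 1 - b $ 1) * (x - y) $ 2"
    by (simp add: dbl_def algebra_simps)
  then show ?thesis
    unfolding bary_def bary_grad_def diff_divide_distrib[symmetric]
    by (simp only: inner_scaleR_left) (simp add: inner_vec_def sum_2)
qed

lemma bary_has_derivative: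
  assumes "dbl a b c \<noteq> 0"
  shows "(bary a b c has_derivative (\<lambda>h. bary_grad a b c \<bullet> h)) (at x)"
proof -
  have eq: "bary a b c = (\<lambda>x. bary a b c 0 + bary_grad a b c \<bullet> x)"
  proof (rule ext)
    show "bary a b c x = bary a b c 0 + bary_grad a b c \<bullet> x" for x
      using bary_diff[OF assms, of x 0] by (simp only: diff_zero)
  qed
  have "((\<lambda>x. bary a b c 0 + bary_grad a b c \<bullet> x) has_derivative (\<lambda>h. bary_grad a b c \<bullet> h)) (at x)"
    by (auto intro!: derivative_eq_intros)
  then show ?thesis by (simp only: eq[symmetric])
qed

lemma bary_continuous: "dbl a b c \<noteq> 0 \<Longrightarrow> continuous_on S (bary a b c)"
  by (meson bary_has_derivative has_derivative_continuous continuous_at_imp_continuous_on)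

lemma norm_bary_grad: "norm (bary_grad a b c) = norm (b - c) / \<bar>dbl a b c\<bar>"
  unfolding bary_grad_def norm_scaleR by (simp add: norm_vec_def L2_set_def sum_2 power2_commute add.commute)

lemma bary_grad_sum:
  assumes "dbl a b c \<noteq> 0"
  shows "bary_grad a b c + bary_grad b c a + bary_grad c a b = 0"
  by (simp add: bary_grad_def dbl_rotate[where a = a and b = b and c = c] vec_eq_iff add_divide_distrib[symmetric])

text \<open>From an interior point with a nonpositive coordinate, a short move against
  \<open>bary_grad\<close> would make this coordinate negative without leaving the triangle.
  Conversely, the three strict inequalities define an open subset of the triangle.\<close>

lemma interior_triangle:
  assumes "dbl a b c \<noteq> 0"
  shows "x \<in> interior (convex hull {a, b, c}) \<longleftrightarrow> 0 < bary a b c x \<and> 0 < bary b c a x \<and> 0 < bary c a b x"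
proof
  note nz = assms assms[unfolded dbl_rotate(1)[where a = a and b = b and c = c, symmetric]] assms[unfolded dbl_rotate(2)[where a = a and b = b and c = c, symmetric]]
  have *: "0 < bary a b c x" if nz: "dbl a b c \<noteq> 0" and x: "x \<in> interior (convex hull {a, b, c})" for a b c
  proof (rule ccontr)
    assume neg: "\<not> 0 < bary a b c x"
    obtain e where e: "e > 0" "ball x e \<subseteq> convex hull {a, b, c}"
      using x mem_interior by blast
    have "bary_grad a b c \<noteq> 0"
      using norm_bary_grad[of a b c] dbl_distinct[OF nz] nz by auto
    define t where "t = e / (2 * norm (bary_grad a b c))"
    have t: "t > 0" using e \<open>bary_grad a b c \<noteq> 0\<close> by (simp add: t_def)
    define y where "y = x - t *\<^sub>R bary_grad a b c"
    have "y \<in> ball x e" using e t \<open>bary_grad a b c \<noteq> 0\<close> by (simp add: y_def dist_norm t_def)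
    then have "0 \<le> bary a b c y" using e mem_triangle_iff[OF nz] by blast
    moreover have "bary a b c x - bary a b c y = t * (norm (bary_grad a b c))\<^sup>2"
      unfolding bary_diff[OF nz] y_def by (simp add: dot_square_norm)
    ultimately show False using neg t \<open>bary_grad a b c \<noteq> 0\<close>
      by (smt (verit) mult_pos_pos zero_less_norm_iff zero_less_power)
  qed
  assume x: "x \<in> interior (convex hull {a, b, c})"
  then show "0 < bary a b c x \<and> 0 < bary b c a x \<and> 0 < bary c a b x"
    using *[OF nz(1)] *[OF nz(2)] *[OF nz(3)] by (simp add: insert_commute)
next
  note nz = assms assms[unfolded dbl_rotate(1)[where a = a and b = b and c = c, symmetric]] assms[unfolded dbl_rotate(2)[where a = a and b = b and c = c, symmetric]]
  assume x: "0 < bary a b c x \<and> 0 < bary b c a x \<and> 0 < bary c a b x"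
  have "open {x. 0 < bary a b c x \<and> 0 < bary b c a x \<and> 0 < bary c a b x}"
    by (intro open_Collect_conj open_Collect_less continuous_on_const bary_continuous nz)
  moreover have "{x. 0 < bary a b c x \<and> 0 < bary b c a x \<and> 0 < bary c a b x} \<subseteq> convex hull {a, b, c}"
    unfolding subset_iff mem_triangle_iff[OF assms] by simp
  ultimately have "{x. 0 < bary a b c x \<and> 0 < bary b c a x \<and> 0 < bary c a b x} \<subseteq> interior (convex hull {a, b, c})"
    by (rule interior_maximal[rotated])
  then show "x \<in> interior (convex hull {a, b, c})" using x by blast
qed

lemma measure_triangle: "measure lebesgue (convex hull {a, b, c}) = \<bar>dbl a b c\<bar> / 2"
proof -
  have "compact (convex hull {a, b, c})" by (intro finite_imp_compact_convex_hull) auto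
  then have "measure lebesgue (convex hull {a, b, c}) = measure lborel (convex hull {a, b, c})"
    by (intro measure_completion) (auto dest: compact_imp_closed)
  also have "\<dots> = \<bar>dbl a b c\<bar> / 2"
    unfolding content_triangle by (simp add: dbl_def abs_minus_commute mult.commute)
  finally show ?thesis .
qed

section \<open>Integrals of polynomials in barycentric coordinates\<close>

definition ref_triangle :: "point set" where
  "ref_triangle = {x. 0 \<le> x $ 1 \<and> 0 \<le> x $ 2 \<and> x $ 1 + x $ 2 \<le> 1}"

lemma ref_triangle_eq: "ref_triangle = convex hull {0, axis 1 1, axis 2 1}"
proof -
  have nz: "dbl 0 (axis 1 1) (axis 2 1) \<noteq> 0" by (simp add: dbl_def axis_def)
  show ?thesis
    unfolding set_eq_iff mem_triangle_iff[OF nz]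
    by (auto simp: ref_triangle_def bary_def dbl_def axis_def algebra_simps)
qed

lemma absolutely_integrable_on_compact:
  fixes F :: "point \<Rightarrow> real"
  assumes "compact S" "continuous_on S F"
  shows "F absolutely_integrable_on S"
  using borel_integrable_compact[OF assms] unfolding set_integrable_def
  by (simp add: integrable_completion borel_measurable_integrable)

lemma integral_triangle:
  fixes F :: "point \<Rightarrow> real"
  assumes nz: "dbl a b c \<noteq> 0" and F: "continuous_on UNIV F"
  shows "integral (convex hull {a, b, c}) F =
    \<bar>dbl a b c\<bar> * integral ref_triangle (\<lambda>x. F (a + x $ 1 *\<^sub>R (b - a) + x $ 2 *\<^sub>R (c - a)))"
proof -
  define g where "g = (\<lambda>x::point. a + x $ 1 *\<^sub>R (b - a) + x $ 2 *\<^sub>R (c - a))"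
  define g' where "g' = (\<lambda>x::point. x $ 1 *\<^sub>R (b - a) + x $ 2 *\<^sub>R (c - a))"
  have comp: "compact ref_triangle" unfolding ref_triangle_eq by (intro finite_imp_compact_convex_hull) auto
  have der: "(g has_derivative g') (at x within S)" for x S
    unfolding g_def g'_def
    by (auto intro!: derivative_eq_intros bounded_linear_imp_has_derivative bounded_linear_vec_nth)
  have gcomb: "g x = (1 - x $ 1 - x $ 2) *\<^sub>R a + x $ 1 *\<^sub>R b + x $ 2 *\<^sub>R c" for x
    by (simp add: g_def algebra_simps)
  have bg: "bary a b c (g x) = 1 - x $ 1 - x $ 2" "bary b c a (g x) = x $ 1" "bary c a b (g x) = x $ 2" for x
    using bary_unique[OF nz _ gcomb[of x]] by auto
  have inj: "inj_on g ref_triangle"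
  proof (rule inj_onI)
    fix x y assume "g x = g y"
    then have "x $ 1 = y $ 1" "x $ 2 = y $ 2" using bg(2,3)[of x] bg(2,3)[of y] by simp_all
    then show "x = y" by (simp add: vec_eq_iff forall_2)
  qed
  have img: "g ` ref_triangle = convex hull {a, b, c}"
  proof
    show "g ` ref_triangle \<subseteq> convex hull {a, b, c}"
      by (auto simp: mem_triangle_iff[OF nz] bg ref_triangle_def)
    show "convex hull {a, b, c} \<subseteq> g ` ref_triangle"
    proof
      fix y assume y: "y \<in> convex hull {a, b, c}"
      define x :: point where "x = (\<chi> i. if i = 1 then bary b c a y else bary c a b y)"
      have "g x = y"
      proof -
        have "1 - bary b c a y - bary c a b y = bary a b c y" using bary_sum[OF nz, of y] by linarith
        then have "g x = bary a b c y *\<^sub>R a + bary b c a y *\<^sub>R b + bary c a b y *\<^sub>R c"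
          unfolding gcomb by (simp add: x_def)
        then show ?thesis by (simp only: bary_combination[OF nz, of y, symmetric])
      qed
      moreover have "x \<in> ref_triangle"
        using y bary_sum[OF nz, of y] by (auto simp: mem_triangle_iff[OF nz] ref_triangle_def x_def)
      ultimately show "y \<in> g ` ref_triangle" by blast
    qed
  qed
  have det: "\<bar>det (matrix g')\<bar> = \<bar>dbl a b c\<bar>"
    by (simp add: det_2 matrix_def g'_def axis_def dbl_def algebra_simps)
  have cF: "continuous_on UNIV (\<lambda>x. F (g x))"
    by (rule continuous_on_compose2[OF F]) (auto simp: g_def intro!: continuous_intros)
  \<comment> \<open>The change of variables theorem speaks of functions into \<open>real^'n\<close>,
    hence the detour through \<open>real^1\<close>.\<close>
  define f :: "point \<Rightarrow> real^1" where "f = (\<lambda>x. vec (F x))"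
  have ai: "(\<lambda>x. \<bar>det (matrix g')\<bar> *\<^sub>R f (g x)) absolutely_integrable_on ref_triangle"
    unfolding absolutely_integrable_on_1_iff using comp
    by (intro absolutely_integrable_on_compact) (auto simp: f_def intro!: continuous_intros continuous_on_subset[OF cF])
  have "integral (g ` ref_triangle) f = integral ref_triangle (\<lambda>x. \<bar>det (matrix g')\<bar> *\<^sub>R f (g x))"
    using has_absolute_integral_change_of_variables[OF _ der inj, of f
        "integral ref_triangle (\<lambda>x. \<bar>det (matrix g')\<bar> *\<^sub>R f (g x))"] ai comp
    by (auto dest: compact_imp_closed)
  then have "integral (convex hull {a, b, c}) (\<lambda>x. f x $ 1) =
      integral ref_triangle (\<lambda>x. (\<bar>det (matrix g')\<bar> *\<^sub>R f (g x)) $ 1)"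
    unfolding img integral_on_1_eq by simp
  then show ?thesis unfolding f_def det g_def by simp
qed

lemma LINT_continuous_compact:
  fixes F :: "point \<Rightarrow> real"
  assumes "compact S" "continuous_on S F"
  shows "integrable (lebesgue_on S) F" "(LINT x|lebesgue_on S. F x) = integral S F"
proof -
  have S: "S \<in> sets lebesgue" using assms(1) by (auto dest: compact_imp_closed)
  show i: "integrable (lebesgue_on S) F"
    using absolutely_integrable_on_compact[OF assms] S
    by (simp add: set_integrable_def integrable_restrict_space)
  show "(LINT x|lebesgue_on S. F x) = integral S F"
    by (rule lebesgue_integral_eq_integral[OF i S])
qed

lemma compact_triangle: "compact (convex hull {a, b, c :: point})"
  by (intro finite_imp_compact_convex_hull) auto

text \<open>For a fixed function G of the barycentric coordinates the integral is proportional to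
  the area, with a factor from the reference triangle. This makes all moments below independent of
  the shape of the triangle.\<close>

lemma LINT_triangle:
  fixes F :: "point \<Rightarrow> real"
  assumes nz: "dbl a b c \<noteq> 0" and F: "continuous_on UNIV F"
    and G: "\<And>x. F x = G (bary b c a x) (bary c a b x)"
  shows "(LINT x|lebesgue_on (convex hull {a, b, c}). F x) =
    \<bar>dbl a b c\<bar> * integral ref_triangle (\<lambda>x. G (x $ 1) (x $ 2))"
proof -
  have "a + x $ 1 *\<^sub>R (b - a) + x $ 2 *\<^sub>R (c - a) = (1 - x $ 1 - x $ 2) *\<^sub>R a + x $ 1 *\<^sub>R b + x $ 2 *\<^sub>R c"
    for x :: point by (simp add: algebra_simps)
  then have "F (a + x $ 1 *\<^sub>R (b - a) + x $ 2 *\<^sub>R (c - a)) = G (x $ 1) (x $ 2)" for x :: point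
    using bary_unique(2,3)[OF nz, of "1 - x $ 1 - x $ 2" "x $ 1" "x $ 2"] by (simp add: G)
  then show ?thesis
    using LINT_continuous_compact(2)[OF compact_triangle continuous_on_subset[OF F]] integral_triangle[OF nz F]
    by simp
qed

text \<open>By symmetry the three coordinates have the same integral, and they sum to 1, so each
  gets a third of the area.\<close>

lemma LINT_bary:
  assumes nz: "dbl a b c \<noteq> 0"
  shows "(LINT x|lebesgue_on (convex hull {a, b, c}). bary a b c x) = \<bar>dbl a b c\<bar> / 6"
proof -
  define I where "I = integral ref_triangle (\<lambda>x. x $ 1)"
  have *: "(LINT x|lebesgue_on (convex hull {a, b, c}). bary b c a x) = \<bar>dbl a b c\<bar> * I"
    if "dbl a b c \<noteq> 0" for a b c
    unfolding I_def using that by (intro LINT_triangle bary_continuous) (simp_all add: dbl_rotate)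
  have eq: "{b, c, a} = {a, b, c}" "{c, a, b} = {a, b, c}" by auto
  have nz': "dbl b c a \<noteq> 0" "dbl c a b \<noteq> 0" using nz by (simp_all add: dbl_rotate)
  have 3: "(LINT x|lebesgue_on (convex hull {a, b, c}). bary b c a x) = \<bar>dbl a b c\<bar> * I"
    "(LINT x|lebesgue_on (convex hull {a, b, c}). bary c a b x) = \<bar>dbl a b c\<bar> * I"
    "(LINT x|lebesgue_on (convex hull {a, b, c}). bary a b c x) = \<bar>dbl a b c\<bar> * I"
    using *[OF nz] *[OF nz'(1)] *[OF nz'(2)]
    unfolding eq by (simp_all add: dbl_rotate(1)[where a=a and b=b and c=c] dbl_rotate(2)[where a=a and b=b and c=c])
  have int: "integrable (lebesgue_on (convex hull {a, b, c})) (bary a b c)"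
    "integrable (lebesgue_on (convex hull {a, b, c})) (bary b c a)"
    "integrable (lebesgue_on (convex hull {a, b, c})) (bary c a b)"
    by (intro LINT_continuous_compact compact_triangle bary_continuous nz nz')+
  have "(LINT x|lebesgue_on (convex hull {a, b, c}). bary a b c x + bary b c a x + bary c a b x) = \<bar>dbl a b c\<bar> / 2"
    using compact_triangle[of a b c] measure_triangle[of a b c] by (simp add: bary_sum[OF nz] measure_restrict_space compact_imp_closed)
  then have "\<bar>dbl a b c\<bar> * I * 3 = \<bar>dbl a b c\<bar> / 2"
    using 3 int by simp
  then have "I = 1 / 6" using nz by simp
  then show ?thesis using 3 by simp
qed

text \<open>What counts is that one factor Q serves all triangles and all pairs of coordinates: in
  \<open>LINT_nc_grad\<close> it multiplies the sum of the coordinate gradients, which is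
  zero.\<close>

lemma LINT_bary_product:
  obtains Q where "\<And>a b c. dbl a b c \<noteq> 0 \<Longrightarrow>
    (LINT x|lebesgue_on (convex hull {a, b, c}). bary b c a x * bary c a b x) = \<bar>dbl a b c\<bar> * Q"
proof
  show "(LINT x|lebesgue_on (convex hull {a, b, c}). bary b c a x * bary c a b x) =
      \<bar>dbl a b c\<bar> * integral ref_triangle (\<lambda>x. x $ 1 * x $ 2)" if "dbl a b c \<noteq> 0" for a b c
    using that by (intro LINT_triangle continuous_on_mult bary_continuous) (simp_all add: dbl_rotate)
qed

text \<open>The integral of the cubic element bubble over the reference triangle. It stays symbolic,
  as positivity is all that is asked of its value.\<close>

definition bubble_moment :: real where
  "bubble_moment = integral ref_triangle (\<lambda>x. (1 - x $ 1 - x $ 2) * x $ 1 * x $ 2)"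

text \<open>The bubble is nonnegative on a triangle and positive in its interior, which contains the
  centroid and so is not negligible. Positivity is shown on one concrete triangle, the factor being
  the same for all.\<close>

lemma LINT_bary_bubble:
  shows "dbl a b c \<noteq> 0 \<Longrightarrow>
    (LINT x|lebesgue_on (convex hull {a, b, c}). bary a b c x * bary b c a x * bary c a b x) =
    \<bar>dbl a b c\<bar> * bubble_moment"
    and bubble_moment_pos: "bubble_moment > 0"
proof -
  define J where "J = bubble_moment"
  have *: "(LINT x|lebesgue_on (convex hull {a, b, c}). bary a b c x * bary b c a x * bary c a b x) = \<bar>dbl a b c\<bar> * J"
    if "dbl a b c \<noteq> 0" for a b c
    unfolding J_def bubble_moment_def
  proof (rule LINT_triangle[OF that])
    show "bary a b c x * bary b c a x * bary c a b x =
        (1 - bary b c a x - bary c a b x) * bary b c a x * bary c a b x" for x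
      using bary_sum[OF that, of x] by (metis add_diff_cancel_right' diff_diff_eq2 diff_add_eq diff_diff_eq)
  qed (use that in \<open>auto intro!: continuous_on_mult bary_continuous simp: dbl_rotate\<close>)
  define a b c :: point where "a = 0" and "b = axis 1 1" and "c = axis 2 1"
  define T where "T = convex hull {a, b, c}"
  have nz: "dbl a b c \<noteq> 0" "dbl b c a \<noteq> 0" "dbl c a b \<noteq> 0" by (simp_all add: dbl_def axis_def a_def b_def c_def)
  define F where "F = (\<lambda>x. bary a b c x * bary b c a x * bary c a b x)"
  have F0: "F x \<ge> 0" if "x \<in> T" for x
    using that by (simp add: T_def F_def mem_triangle_iff[OF nz(1)])
  have T: "T \<in> sets lebesgue" using compact_triangle[of a b c] by (auto simp: T_def dest: compact_imp_closed)
  have int: "integrable (lebesgue_on T) F"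
    unfolding T_def F_def by (intro LINT_continuous_compact compact_triangle continuous_on_mult bary_continuous nz)
  have F0': "AE x in lebesgue_on T. F x \<ge> 0" using F0 by (intro AE_I2) simp
  have "0 \<le> (LINT x|lebesgue_on T. F x)" using F0' by (rule integral_nonneg_AE)
  moreover have "(LINT x|lebesgue_on T. F x) \<noteq> 0"
  proof
    assume "(LINT x|lebesgue_on T. F x) = 0"
    then have "AE x in lebesgue_on T. F x = 0"
      using integral_nonneg_eq_0_iff_AE[OF int F0'] by simp
    then have "AE x in lebesgue. x \<in> T \<longrightarrow> F x = 0" using T by (simp add: AE_restrict_space_iff)
    then have "AE x in lebesgue. x \<notin> interior T"
    proof eventually_elim
      case (elim x)
      then show ?case using interior_subset[of T] interior_triangle[OF nz(1), of x] by (auto simp: T_def F_def)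
    qed
    then have "negligible (interior T)"
      unfolding negligible_iff_null_sets by (subst AE_iff_null_sets) auto
    moreover have "(1/3) *\<^sub>R a + (1/3) *\<^sub>R b + (1/3) *\<^sub>R c \<in> interior T"
      unfolding T_def interior_triangle[OF nz(1)]
      using bary_unique[OF nz(1), of "1/3" "1/3" "1/3"] by simp
    ultimately show False using open_not_negligible[OF open_interior] by blast
  qed
  ultimately have "(LINT x|lebesgue_on T. F x) > 0" by linarith
  then have "\<bar>dbl a b c\<bar> * J > 0" using *[OF nz(1)] by (simp only: T_def F_def)
  then have "J > 0" by (simp add: zero_less_mult_iff)
  then show "bubble_moment > 0" by (simp add: J_def)
  show "dbl a b c \<noteq> 0 \<Longrightarrow>
    (LINT x|lebesgue_on (convex hull {a, b, c}). bary a b c x * bary b c a x * bary c a b x) =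
    \<bar>dbl a b c\<bar> * bubble_moment" for a b c
    using * by (simp add: J_def)
qed

section \<open>Triangles of a mesh\<close>

fun verts :: "tri \<Rightarrow> point set" where
  "verts (a, b, c) = {a, b, c}"

fun proper :: "tri \<Rightarrow> bool" where
  "proper (a, b, c) \<longleftrightarrow> dbl a b c \<noteq> 0"

text \<open>Affine on the whole plane, and on K the restriction of the hat function of z. The
  default 0 for points that are no vertices makes \<open>lam_shared\<close> true for every
  z.\<close>

fun lam :: "tri \<Rightarrow> point \<Rightarrow> point \<Rightarrow> real" where
  "lam (a, b, c) z = (if z = a then bary a b c else if z = b then bary b c a
     else if z = c then bary c a b else (\<lambda>_. 0))"

fun lam_grad :: "tri \<Rightarrow> point \<Rightarrow> point" where
  "lam_grad (a, b, c) z = (if z = a then bary_grad a b c else if z = b then bary_grad b c a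
     else if z = c then bary_grad c a b else 0)"

lemma hull_of_eq: "hull_of K = convex hull (verts K)"
  by (cases K) simp

lemma finite_verts: "finite (verts K)"
  by (cases K) simp

lemma bary_grad_swap: "bary_grad a c b = bary_grad a b c"
  by (simp add: bary_grad_def dbl_swap(1)[where a = a and b = b and c = c] vec_eq_iff diff_divide_distrib)

text \<open>Allows the vertices to be named in any order: an odd permutation changes the sign of
  \<open>dbl\<close>, but neither \<open>bary\<close> nor \<open>bary_grad\<close>.\<close>

lemma lam_verts:
  assumes "proper K" "verts K = {x, y, z}" "x \<noteq> y" "y \<noteq> z" "x \<noteq> z"
  shows "dbl x y z \<noteq> 0" "lam K x = bary x y z" "lam K y = bary y z x" "lam K z = bary z x y"
    "lam_grad K x = bary_grad x y z" "lam_grad K y = bary_grad y z x" "lam_grad K z = bary_grad z x y"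
proof -
  obtain a b c where K: "K = (a, b, c)" by (cases K)
  have d: "a \<noteq> b" "b \<noteq> c" "a \<noteq> c" using dbl_distinct[of a b c] assms(1) K by auto
  have "(x, y, z) \<in> {(a, b, c), (b, c, a), (c, a, b), (a, c, b), (c, b, a), (b, a, c)}"
    using assms(2-5) d unfolding K verts.simps by (smt (verit) insert_iff insert_absorb singleton_iff insertE)
  then show "dbl x y z \<noteq> 0" "lam K x = bary x y z" "lam K y = bary y z x" "lam K z = bary z x y"
    "lam_grad K x = bary_grad x y z" "lam_grad K y = bary_grad y z x" "lam_grad K z = bary_grad z x y"
    using d assms(1) unfolding K
    by (auto simp: dbl_rotate[where a=a and b=b and c=c] dbl_swap[where a=a and b=b and c=c]
        bary_swap[of a b c] bary_swap[of b c a] bary_swap[of c a b]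
        bary_grad_swap[of a b c] bary_grad_swap[of b c a] bary_grad_swap[of c a b])
qed

lemma proper_verts:
  assumes "proper K" "x \<in> verts K"
  obtains y z where "verts K = {x, y, z}" "x \<noteq> y" "y \<noteq> z" "x \<noteq> z"
  using assms by (cases K) (auto dest!: dbl_distinct simp: insert_commute)

lemma proper_verts2:
  assumes "proper K" "x \<in> verts K" "y \<in> verts K" "x \<noteq> y"
  obtains z where "verts K = {x, y, z}" "y \<noteq> z" "x \<noteq> z"
proof -
  obtain u v where uv: "verts K = {x, u, v}" "x \<noteq> u" "u \<noteq> v" "x \<noteq> v" using proper_verts[OF assms(1,2)] .
  then have "y = u \<or> y = v" using assms by auto
  then show thesis using that uv by (auto simp: insert_commute)
qed

lemma edges_verts:
  assumes "proper K"
  shows "E \<in> edges K \<Longrightarrow> fst E \<in> verts K \<and> snd E \<in> verts K \<and> fst E \<noteq> snd E"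
    and "x \<in> verts K \<Longrightarrow> y \<in> verts K \<Longrightarrow> x \<noteq> y \<Longrightarrow> (x, y) \<in> edges K \<or> (y, x) \<in> edges K"
  using assms by (cases K; auto dest!: dbl_distinct)+

lemma lam_eq_0: "z \<notin> verts K \<Longrightarrow> lam K z = (\<lambda>_. 0)"
  by (cases K) auto

lemma lam_diff:
  assumes "proper K"
  shows "lam K z x - lam K z y = lam_grad K z \<bullet> (x - y)"
proof (cases K)
  case (fields a b c)
  then have "dbl a b c \<noteq> 0" "dbl b c a \<noteq> 0" "dbl c a b \<noteq> 0" using assms by (auto simp: dbl_rotate)
  then show ?thesis using fields by (auto simp: bary_diff)
qed

lemma lam_affine:
  assumes "proper K" "u + v = 1"
  shows "lam K z (u *\<^sub>R x + v *\<^sub>R y) = u * lam K z x + v * lam K z y"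
proof -
  have v: "v = 1 - u" using assms(2) by simp
  have "u *\<^sub>R x + v *\<^sub>R y - y = u *\<^sub>R (x - y)" by (simp add: v algebra_simps)
  then have "lam K z (u *\<^sub>R x + v *\<^sub>R y) - lam K z y = u * (lam K z x - lam K z y)"
    by (simp only: lam_diff[OF assms(1)] inner_scaleR_right)
  then show ?thesis by (simp add: v algebra_simps)
qed

lemma lam_has_derivative:
  assumes "proper K"
  shows "(lam K z has_derivative (\<lambda>h. lam_grad K z \<bullet> h)) (at x)"
proof (cases K)
  case (fields a b c)
  then have "dbl a b c \<noteq> 0" "dbl b c a \<noteq> 0" "dbl c a b \<noteq> 0" using assms by (auto simp: dbl_rotate)
  moreover have "((\<lambda>_. 0) has_derivative (\<bullet>) (0::point)) (at x)"
    using has_derivative_const[of 0 "at x"] by (simp add: inner_zero_left[abs_def])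
  ultimately show ?thesis using fields by (auto simp: bary_has_derivative)
qed

lemma lam_continuous: "proper K \<Longrightarrow> continuous_on S (lam K z)"
  by (meson lam_has_derivative has_derivative_continuous continuous_at_imp_continuous_on)

lemma lam_sum:
  assumes "proper K"
  shows "(\<Sum>z\<in>verts K. lam K z x) = 1"
proof (cases K)
  case (fields a b c)
  then show ?thesis using assms dbl_distinct[of a b c] bary_sum[of a b c x] by auto
qed

lemma lam_combination:
  assumes "proper K"
  shows "(\<Sum>z\<in>verts K. lam K z x *\<^sub>R z) = x"
proof (cases K)
  case (fields a b c)
  then show ?thesis using assms dbl_distinct[of a b c] bary_combination[of a b c x, symmetric]
    by (auto simp: add.assoc)
qed

lemma lam_vertex:
  assumes "proper K" "y \<in> verts K"
  shows "lam K z y = (if z = y then 1 else 0)"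
proof (cases K)
  case (fields a b c)
  then have "dbl a b c \<noteq> 0" "dbl b c a \<noteq> 0" "dbl c a b \<noteq> 0" using assms by (auto simp: dbl_rotate)
  then show ?thesis using fields assms dbl_distinct[of a b c] by (auto simp: bary_vertex)
qed

lemma mem_hull_iff:
  assumes "proper K"
  shows "x \<in> hull_of K \<longleftrightarrow> (\<forall>z\<in>verts K. 0 \<le> lam K z x)"
proof (cases K)
  case (fields a b c)
  then show ?thesis using assms dbl_distinct[of a b c] by (auto simp: mem_triangle_iff)
qed

lemma interior_hull_iff:
  assumes "proper K"
  shows "x \<in> interior (hull_of K) \<longleftrightarrow> (\<forall>z\<in>verts K. 0 < lam K z x)"
proof (cases K)
  case (fields a b c)
  then show ?thesis using assms dbl_distinct[of a b c] by (auto simp: interior_triangle)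
qed

lemma verts_subset_hull: "verts K \<subseteq> hull_of K"
  by (simp add: hull_of_eq hull_subset)

lemma compact_hull_of: "compact (hull_of K)"
  by (simp add: hull_of_eq finite_imp_compact_convex_hull finite_verts)

lemma convex_hull_of: "convex (hull_of K)"
  by (simp add: hull_of_eq)

lemma closed_hull_of: "closed (hull_of K)"
  by (rule compact_imp_closed[OF compact_hull_of])

definition centroid :: "tri \<Rightarrow> point" where
  "centroid K = (\<Sum>z\<in>verts K. (1/3) *\<^sub>R z)"

lemma card_verts: "proper K \<Longrightarrow> card (verts K) = 3"
  by (cases K) (auto dest!: dbl_distinct simp: card_insert_if)

lemma centroid_interior:
  assumes "proper K"
  shows "centroid K \<in> interior (hull_of K)"
proof -
  obtain a b c where K: "K = (a, b, c)" by (cases K)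
  then have nz: "dbl a b c \<noteq> 0" and d: "a \<noteq> b" "b \<noteq> c" "a \<noteq> c" using assms dbl_distinct[of a b c] by auto
  have "centroid K = (1/3) *\<^sub>R a + (1/3) *\<^sub>R b + (1/3) *\<^sub>R c" using d by (simp add: centroid_def K add.assoc)
  then show ?thesis
    using bary_unique[OF nz, of "1/3" "1/3" "1/3" "centroid K"] interior_triangle[OF nz] K by auto
qed

text \<open>The triangle has an interior point, so its affine dimension is 2, the largest possible
  for three points.\<close>

lemma affine_independent_verts:
  assumes "proper K"
  shows "\<not> affine_dependent (verts K)"
proof -
  have "aff_dim (verts K) = aff_dim (hull_of K)" by (simp add: hull_of_eq aff_dim_convex_hull)
  also have "\<dots> = 2" using aff_dim_nonempty_interior[of "hull_of K"] centroid_interior[OF assms] by auto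
  finally show ?thesis
    using card_verts[OF assms] finite_verts[of K] by (simp add: affine_independent_iff_card)
qed

text \<open>If the signed area is zero, the vertices lie on one line, and the affine dimension is at
  most 1 instead of 2.\<close>

lemma proper_of_simplex:
  assumes "2 simplex (hull_of K)"
  shows "proper K"
proof (rule ccontr)
  assume np: "\<not> proper K"
  obtain a b c where K: "K = (a, b, c)" by (cases K)
  have d: "dbl a b c = 0" using np K by simp
  \<comment> \<open>A normal of that line: a nonzero side turned by a right angle, or any nonzero
    vector if the three points coincide.\<close>
  have "\<exists>n::point. n \<noteq> 0 \<and> (\<forall>x\<in>{a, b, c}. n \<bullet> x = n \<bullet> a)"
  proof (cases "b = a")
    case False
    define n :: point where "n = (\<chi> i. if i = 1 then b $ 2 - a $ 2 else a $ 1 - b $ 1)"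
    have "n \<noteq> 0" using False by (auto simp: n_def vec_eq_iff forall_2)
    moreover have "n \<bullet> b = n \<bullet> a" "n \<bullet> c = n \<bullet> a"
      using d by (auto simp: n_def inner_vec_def sum_2 dbl_def algebra_simps)
    ultimately show ?thesis by auto
  next
    case True
    show ?thesis
    proof (cases "c = a")
      case False
      define n :: point where "n = (\<chi> i. if i = 1 then c $ 2 - a $ 2 else a $ 1 - c $ 1)"
      have "n \<noteq> 0" using False by (auto simp: n_def vec_eq_iff forall_2)
      moreover have "n \<bullet> c = n \<bullet> a"
        by (auto simp: n_def inner_vec_def sum_2 dbl_def algebra_simps)
      ultimately show ?thesis using True by auto
    qed (use True in \<open>auto intro!: exI[of _ "axis 1 1"]\<close>)
  qed
  then obtain n :: point where n: "n \<noteq> 0" "{a, b, c} \<subseteq> {x. n \<bullet> x = n \<bullet> a}" by auto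
  then have "hull_of K \<subseteq> {x. n \<bullet> x = n \<bullet> a}"
    unfolding K hull_of.simps by (intro hull_minimal convex_hyperplane)
  then have "aff_dim (hull_of K) \<le> aff_dim {x. n \<bullet> x = n \<bullet> a}" by (rule aff_dim_subset)
  then have "aff_dim (hull_of K) \<le> 1" using aff_dim_hyperplane[OF n(1)] by simp
  moreover have "aff_dim (hull_of K) = 2" using assms by (rule aff_dim_simplex)
  ultimately show False by simp
qed

section \<open>Conforming meshes\<close>

locale mesh =
  fixes \<Omega> :: "point set" and \<T> :: "tri set"
  assumes openO: "open \<Omega>" and boundedO: "bounded \<Omega>" and regularO: "interior (closure \<Omega>) = \<Omega>"
    and conforming: "conforming_mesh \<Omega> \<T>"
begin

lemma finite_mesh: "finite \<T>"
  using conforming by (simp add: conforming_mesh_def)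

lemma proper_mesh: "K \<in> \<T> \<Longrightarrow> proper K"
  using conforming proper_of_simplex by (auto simp: conforming_mesh_def)

lemma hull_inj: "K \<in> \<T> \<Longrightarrow> K' \<in> \<T> \<Longrightarrow> hull_of K = hull_of K' \<Longrightarrow> K = K'"
  using conforming by (auto simp: conforming_mesh_def inj_on_def)

lemma hull_face: "K \<in> \<T> \<Longrightarrow> K' \<in> \<T> \<Longrightarrow> (hull_of K \<inter> hull_of K') face_of hull_of K"
  using conforming by (auto simp: conforming_mesh_def triangulation_def)

lemma union_mesh: "(\<Union>K\<in>\<T>. hull_of K) = closure \<Omega>"
  using conforming by (auto simp: conforming_mesh_def)

lemma hull_subset_closure: "K \<in> \<T> \<Longrightarrow> hull_of K \<subseteq> closure \<Omega>"
  using union_mesh by blast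

text \<open>A face that meets the interior of a convex set is the whole set. So the intersection is
  all of \<open>hull_of K\<close>; then x is interior to \<open>hull_of K'\<close> too, and the same
  argument makes the hulls equal.\<close>

lemma interior_hull_unique:
  assumes "K \<in> \<T>" "K' \<in> \<T>" "x \<in> interior (hull_of K)" "x \<in> hull_of K'"
  shows "K = K'"
proof -
  have "x \<in> hull_of K" using assms interior_subset by blast
  then have eq: "hull_of K \<inter> hull_of K' = hull_of K"
    using face_of_disjoint_interior[OF hull_face[OF assms(1,2)]] assms(3,4) by blast
  then have "hull_of K \<subseteq> hull_of K'" by blast
  then have "x \<in> interior (hull_of K')" using assms(3) interior_mono by blast
  moreover have "hull_of K face_of hull_of K'" using hull_face[OF assms(2,1)] eq by (simp add: Int_commute)
  ultimately have "hull_of K = hull_of K'"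
    using face_of_disjoint_interior \<open>x \<in> hull_of K\<close> by blast
  then show ?thesis using hull_inj assms by blast
qed

text \<open>Faces of a triangle are hulls of vertex subsets. The intersection is such a hull from
  either side, and its extreme points recover the subset, so both subsets coincide. It is proper,
  since otherwise the centroid of K, an interior point, would lie in K'.\<close>

lemma common_face:
  assumes "K \<in> \<T>" "K' \<in> \<T>" "K \<noteq> K'"
  obtains S where "S \<subseteq> verts K \<inter> verts K'" "S \<noteq> verts K" "hull_of K \<inter> hull_of K' = convex hull S"
proof -
  note ind = affine_independent_verts[OF proper_mesh[OF assms(1)]] affine_independent_verts[OF proper_mesh[OF assms(2)]]
  obtain S where S: "S \<subseteq> verts K" "hull_of K \<inter> hull_of K' = convex hull S"
    using hull_face[OF assms(1,2)] face_of_convex_hull_affine_independent[OF ind(1)] unfolding hull_of_eq by blast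
  obtain S' where S': "S' \<subseteq> verts K'" "hull_of K \<inter> hull_of K' = convex hull S'"
    using hull_face[OF assms(2,1)] face_of_convex_hull_affine_independent[OF ind(2)]
    unfolding hull_of_eq by (metis Int_commute)
  have "\<not> affine_dependent S" "\<not> affine_dependent S'"
    using ind S S' by (meson affine_independent_subset)+
  then have "S = S'"
    using extreme_point_of_convex_hull_affine_independent[of S] extreme_point_of_convex_hull_affine_independent[of S'] S S'
    by (metis subsetI subset_antisym)
  moreover have "S \<noteq> verts K"
  proof
    assume "S = verts K"
    then have "hull_of K \<subseteq> hull_of K'" using S by (auto simp: hull_of_eq)
    then show False
      using interior_hull_unique[OF assms(1,2) centroid_interior[OF proper_mesh[OF assms(1)]]] interior_subset assms(3)
        centroid_interior[OF proper_mesh[OF assms(1)]] by blast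
  qed
  ultimately show thesis using that S S' by blast
qed

text \<open>Both coordinates are affine and agree at the vertices spanning the common face, hence on
  all of it. A vertex of K off this face has coordinate zero there.\<close>

lemma lam_shared:
  assumes "K \<in> \<T>" "K' \<in> \<T>" "K \<noteq> K'" "x \<in> hull_of K" "x \<in> hull_of K'"
  shows "lam K z x = lam K' z x" "\<exists>z\<in>verts K. lam K z x = 0"
proof -
  obtain S where S: "S \<subseteq> verts K \<inter> verts K'" "S \<noteq> verts K" "hull_of K \<inter> hull_of K' = convex hull S"
    using common_face[OF assms(1-3)] .
  note p = proper_mesh[OF assms(1)] proper_mesh[OF assms(2)]
  have x: "x \<in> convex hull S" using S assms by blast
  have cv: "convex {x. lam L1 z x - lam L2 z x = 0}" if "proper L1" "proper L2" for L1 L2 z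
    using that by (auto simp: convex_def lam_affine)
  have "convex hull S \<subseteq> {x. lam K z x - lam K' z x = 0}" for z
  proof (intro hull_minimal cv p subsetI)
    fix s assume "s \<in> S"
    then have "s \<in> verts K" "s \<in> verts K'" using S by auto
    then show "s \<in> {x. lam K z x - lam K' z x = 0}" using p by (simp add: lam_vertex)
  qed
  then show "lam K z x = lam K' z x" for z using x by auto
  obtain z where z: "z \<in> verts K" "z \<notin> S" using S by blast
  have "convex {x. lam K z x = 0}"
    using p by (auto simp: convex_def lam_affine)
  then have "convex hull S \<subseteq> {x. lam K z x = 0}"
  proof (intro hull_minimal subsetI)
    fix s assume "s \<in> S"
    then show "s \<in> {x. lam K z x = 0}" using S(1) z p by (auto simp: lam_vertex[of K s])
  qed
  then show "\<exists>z\<in>verts K. lam K z x = 0" using x z by blast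
qed

text \<open>At a common point the coordinates from both triangles agree, and \<open>lam K'\<close>
  is 0 for points that are no vertices of K'.\<close>

lemma vertex_shared:
  assumes "K \<in> \<T>" "K' \<in> \<T>" "x \<in> hull_of K" "x \<in> hull_of K'" "lam K z x \<noteq> 0"
  shows "z \<in> verts K'"
proof (rule ccontr)
  assume "z \<notin> verts K'"
  then have "lam K' z x = 0" by (simp add: lam_eq_0)
  then show False using assms(5) lam_shared(1)[OF assms(1,2) _ assms(3,4), of z] by (cases "K = K'") simp_all
qed

section \<open>Neighbours across a side\<close>

text \<open>From the midpoint m of the common side a small step towards c' stays in K' by convexity.
  If c' lies on the same side as c, the coordinate of c grows from 0, so the step enters the
  interior of K.\<close>

lemma same_side_eq:
  assumes K: "K \<in> \<T>" "verts K = {a, b, c}" "a \<noteq> b" "b \<noteq> c" "a \<noteq> c"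
    and K': "K' \<in> \<T>" "verts K' = {a, b, c'}" "b \<noteq> c'" "a \<noteq> c'"
    and side: "dbl c a b * dbl c' a b > 0"
  shows "K = K'"
proof -
  note p = proper_mesh[OF K(1)]
  note lc = lam_verts[OF p K(2-5)]
  define m where "m = (1/2) *\<^sub>R a + (1/2) *\<^sub>R b"
  have m: "lam K a m = 1/2" "lam K b m = 1/2" "lam K c m = 0"
    using K p unfolding m_def by (simp_all add: lam_affine lam_vertex)
  have c': "lam K c c' > 0"
    using side by (auto simp: lc bary_def zero_less_mult_iff zero_less_divide_iff)
  define y where "y = (\<lambda>t::real. (1 - t) *\<^sub>R m + t *\<^sub>R c')"
  have ly: "lam K z (y t) = (1 - t) * lam K z m + t * lam K z c'" for z t
    unfolding y_def by (rule lam_affine[OF p]) simp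
  have lim: "((\<lambda>t. lam K z (y t)) \<longlongrightarrow> (1 - 0) * lam K z m + 0 * lam K z c') (at_right 0)" for z
    unfolding ly by (intro tendsto_intros)
  have "\<forall>\<^sub>F t in at_right 0. lam K a (y t) > 0" "\<forall>\<^sub>F t in at_right 0. lam K b (y t) > 0"
    using order_tendstoD(1)[OF lim[of a], of 0] order_tendstoD(1)[OF lim[of b], of 0] m by simp_all
  moreover have "\<forall>\<^sub>F t in at_right (0::real). 0 < t \<and> t < 1"
    by (rule eventually_at_rightI[of 0 1]) auto
  ultimately have "\<forall>\<^sub>F t in at_right 0. lam K a (y t) > 0 \<and> lam K b (y t) > 0 \<and> 0 < t \<and> t < 1"
    by eventually_elim auto
  then obtain t where t: "lam K a (y t) > 0" "lam K b (y t) > 0" "0 < t" "t < 1"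
    using eventually_happens'[OF trivial_limit_at_right_real] by blast
  have "lam K c (y t) > 0" using t c' by (simp add: ly m)
  then have "y t \<in> interior (hull_of K)" using t by (simp add: interior_hull_iff[OF p] K)
  moreover have "y t \<in> hull_of K'"
  proof -
    have "m \<in> hull_of K'" unfolding m_def
      using verts_subset_hull[of K'] K' by (intro convexD[OF convex_hull_of]) auto
    then show ?thesis unfolding y_def
      using verts_subset_hull[of K'] K' t by (intro convexD[OF convex_hull_of]) auto
  qed
  ultimately show ?thesis using interior_hull_unique K K' by blast
qed

lemma opposite_sides:
  assumes K: "K \<in> \<T>" "verts K = {a, b, c}" "a \<noteq> b" "b \<noteq> c" "a \<noteq> c"
    and K': "K' \<in> \<T>" "verts K' = {a, b, c'}" "b \<noteq> c'" "a \<noteq> c'" and "K \<noteq> K'"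
  shows "dbl c a b * dbl c' a b < 0"
proof -
  have "dbl c a b \<noteq> 0" using lam_verts(1)[OF proper_mesh[OF K(1)] K(2-5)] by (simp add: dbl_rotate)
  moreover have "dbl c' a b \<noteq> 0"
    using lam_verts(1)[OF proper_mesh[OF K'(1)] K'(2) K(3) K'(3,4)] by (simp add: dbl_rotate)
  ultimately show ?thesis using same_side_eq[OF K K'] \<open>K \<noteq> K'\<close> by (meson linorder_neqE_linordered_idom mult_eq_0_iff)
qed

text \<open>Any two triangles at a common side lie on opposite sides of it, which is impossible for
  three.\<close>

lemma neighbour_unique:
  assumes "K \<in> \<T>" "K' \<in> \<T>" "K'' \<in> \<T>" "K' \<noteq> K" "K'' \<noteq> K" "a \<noteq> b"
    "{a, b} \<subseteq> verts K" "{a, b} \<subseteq> verts K'" "{a, b} \<subseteq> verts K''"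
  shows "K' = K''"
proof (rule ccontr)
  assume ne: "K' \<noteq> K''"
  have "\<exists>c. verts L = {a, b, c} \<and> b \<noteq> c \<and> a \<noteq> c" if "L \<in> \<T>" "{a, b} \<subseteq> verts L" for L
    using proper_verts2[OF proper_mesh[OF that(1)], of a b] that assms(6) by auto
  then obtain c c' c'' where c: "verts K = {a, b, c}" "b \<noteq> c" "a \<noteq> c" "verts K' = {a, b, c'}" "b \<noteq> c'" "a \<noteq> c'"
    "verts K'' = {a, b, c''}" "b \<noteq> c''" "a \<noteq> c''"
    using assms by metis
  have "dbl c a b * dbl c' a b < 0" "dbl c a b * dbl c'' a b < 0" "dbl c' a b * dbl c'' a b < 0"
    using opposite_sides assms c ne by metis+
  then show False by (auto simp: mult_less_0_iff)
qed

text \<open>Suppose x lies on the side itself. Near x the coordinates of a and b are positive in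
  both triangles, and as these lie on opposite sides, the sign of the remaining coordinate decides
  which of them contains a nearby point.\<close>

lemma edge_point_interior:
  assumes "K \<in> \<T>" "K' \<in> \<T>" "K \<noteq> K'" "a \<noteq> b" "{a, b} \<subseteq> verts K" "{a, b} \<subseteq> verts K'"
    and x: "x \<in> hull_of K" "lam K a x > 0" "lam K b x > 0"
  shows "x \<in> interior (hull_of K \<union> hull_of K')"
proof -
  note p = proper_mesh[OF assms(1)] proper_mesh[OF assms(2)]
  obtain c where c: "verts K = {a, b, c}" "b \<noteq> c" "a \<noteq> c" using proper_verts2[OF p(1), of a b] assms by auto
  obtain c' where c': "verts K' = {a, b, c'}" "b \<noteq> c'" "a \<noteq> c'" using proper_verts2[OF p(2), of a b] assms by auto
  note lc = lam_verts[OF p(1) c(1) assms(4) c(2,3)] and lc' = lam_verts[OF p(2) c'(1) assms(4) c'(2,3)]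
  have opp: "dbl c a b * dbl c' a b < 0" using opposite_sides[of K a b c K' c'] assms c c' by auto
  show ?thesis
  proof (cases "lam K c x = 0")
    case False
    then have "x \<in> interior (hull_of K)" using x c by (auto simp: interior_hull_iff[OF p(1)] mem_hull_iff[OF p(1)])
    then show ?thesis using interior_mono[of "hull_of K" "hull_of K \<union> hull_of K'"] by blast
  next
    case True
    have xab: "x = lam K a x *\<^sub>R a + lam K b x *\<^sub>R b" "lam K a x + lam K b x = 1"
      using lam_combination[OF p(1), of x] lam_sum[OF p(1), of x] True c assms(4) by auto
    have l': "lam K' a x = lam K a x" "lam K' b x = lam K b x"
      by (subst xab(1), subst lam_affine[OF p(2) xab(2)], use assms c' in \<open>simp add: lam_vertex[OF p(2)]\<close>)+
    define U where "U = {y. 0 < lam K a y \<and> 0 < lam K b y \<and> 0 < lam K' a y \<and> 0 < lam K' b y}"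
    have "open U" unfolding U_def
      by (intro open_Collect_conj open_Collect_less continuous_on_const lam_continuous p)
    moreover have "x \<in> U" using x l' by (simp add: U_def)
    moreover have "U \<subseteq> hull_of K \<union> hull_of K'"
    proof
      fix y assume y: "y \<in> U"
      show "y \<in> hull_of K \<union> hull_of K'"
      proof (cases "lam K c y \<ge> 0")
        case True
        then show ?thesis using y c by (auto simp: U_def mem_hull_iff[OF p(1)])
      next
        case False
        then have "dbl y a b / dbl c a b < 0" by (simp add: lc bary_def)
        then have "dbl y a b / dbl c' a b > 0"
          using opp by (auto simp: zero_less_divide_iff divide_less_0_iff mult_less_0_iff)
        then have "lam K' c' y \<ge> 0" by (simp add: lc' bary_def)
        then show ?thesis using y c' by (auto simp: U_def mem_hull_iff[OF p(2)])
      qed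
    qed
    ultimately show ?thesis by (rule interiorI)
  qed
qed

lemma frontier_notin: "x \<in> frontier \<Omega> \<Longrightarrow> x \<notin> \<Omega>"
  using openO by (simp add: frontier_def interior_open)

text \<open>This is where slits are excluded: a point with a neighbourhood covered by elements
  belongs to \<Omega>.\<close>

lemma interior_closure_mem: "x \<in> interior S \<Longrightarrow> S \<subseteq> closure \<Omega> \<Longrightarrow> x \<in> \<Omega>"
  using regularO interior_mono by blast

text \<open>Take a point x of the open segment inside \<Omega>. If K were the only triangle
  containing x, it would contain a neighbourhood of x, which is impossible on a side of K. Another
  triangle containing x has a and b as vertices, since x has positive coordinates at both.\<close>

lemma neighbour_exists:
  assumes K: "K \<in> \<T>" "{a, b} \<subseteq> verts K" "a \<noteq> b" and E: "\<not> closed_segment a b \<subseteq> frontier \<Omega>"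
  shows "\<exists>K'\<in>\<T>. K' \<noteq> K \<and> {a, b} \<subseteq> verts K'"
proof -
  note p = proper_mesh[OF K(1)]
  obtain c where c: "verts K = {a, b, c}" "b \<noteq> c" "a \<noteq> c" using proper_verts2[OF p, of a b] K by auto
  \<comment> \<open>The frontier is closed and the closed segment is the closure of the open one, so
    the point off the frontier can be taken between the end points.\<close>
  have "\<not> open_segment a b \<subseteq> frontier \<Omega>"
  proof
    assume "open_segment a b \<subseteq> frontier \<Omega>"
    then have "closure (open_segment a b) \<subseteq> frontier \<Omega>" by (rule closure_minimal) simp
    then show False using E K(3) by (simp add: closure_open_segment)
  qed
  then obtain x where x: "x \<in> open_segment a b" "x \<notin> frontier \<Omega>" by blast
  then obtain t where t: "0 < t" "t < 1" "x = (1 - t) *\<^sub>R a + t *\<^sub>R b" by (auto simp: in_segment)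
  have l: "lam K a x = 1 - t" "lam K b x = t" "lam K c x = 0"
    using t c K by (simp_all add: lam_affine[OF p] lam_vertex[OF p])
  have xK: "x \<in> hull_of K" using l t c by (simp add: mem_hull_iff[OF p])
  have xO: "x \<in> \<Omega>" using x(2) xK hull_subset_closure[OF K(1)] openO by (auto simp: frontier_def interior_open)
  have "\<exists>K'\<in>\<T>. K' \<noteq> K \<and> x \<in> hull_of K'"
  proof (rule ccontr)
    assume neg: "\<not> ?thesis"
    define C where "C = (\<Union>K'\<in>\<T> - {K}. hull_of K')"
    have "closed C" unfolding C_def using finite_mesh closed_hull_of by auto
    then have "open (\<Omega> - C)" using openO by (simp add: open_Diff)
    moreover have "x \<in> \<Omega> - C" using xO neg by (auto simp: C_def)
    moreover have "\<Omega> - C \<subseteq> hull_of K"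
    proof
      fix y assume y: "y \<in> \<Omega> - C"
      then have "y \<in> (\<Union>K\<in>\<T>. hull_of K)" using union_mesh closure_subset by blast
      then show "y \<in> hull_of K" using y by (auto simp: C_def)
    qed
    ultimately have "x \<in> interior (hull_of K)" by (rule interiorI)
    then show False using l(3) c by (auto simp: interior_hull_iff[OF p])
  qed
  then obtain K' where K': "K' \<in> \<T>" "K' \<noteq> K" "x \<in> hull_of K'" by blast
  then have "a \<in> verts K'" "b \<in> verts K'"
    using vertex_shared[OF K(1) K'(1) xK K'(3)] l t by auto
  then show ?thesis using K' by blast
qed

lemma edge_interior:
  assumes "K \<in> \<T>" "{a, b} \<subseteq> verts K" "a \<noteq> b" "\<not> closed_segment a b \<subseteq> frontier \<Omega>"
    and "x \<in> hull_of K" "lam K a x > 0" "lam K b x > 0"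
  shows "x \<in> \<Omega>"
proof -
  obtain K' where K': "K' \<in> \<T>" "K' \<noteq> K" "{a, b} \<subseteq> verts K'" using neighbour_exists[OF assms(1-4)] by blast
  then have "x \<in> interior (hull_of K \<union> hull_of K')" using edge_point_interior[of K K' a b x] assms by auto
  then show ?thesis
    by (rule interior_closure_mem) (use hull_subset_closure assms K' in auto)
qed

lemma neighbours_eq:
  assumes "K \<in> \<T>" "E \<in> edges K"
  shows "neighbours \<T> K E = {K'\<in>\<T>. K' \<noteq> K \<and> {fst E, snd E} \<subseteq> verts K'}"
proof -
  have d: "fst E \<noteq> snd E" using edges_verts(1)[OF proper_mesh[OF assms(1)] assms(2)] by blast
  have "(E \<in> edges K' \<or> prod.swap E \<in> edges K') \<longleftrightarrow> {fst E, snd E} \<subseteq> verts K'" if "K' \<in> \<T>" for K'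
    using edges_verts[OF proper_mesh[OF that]] d by (cases E) fastforce
  then show ?thesis by (auto simp: neighbours_def)
qed

section \<open>Triangles around a vertex\<close>

definition adjacent :: "point \<Rightarrow> (tri \<times> tri) set" where
  "adjacent z = {(K, K'). K \<in> \<T> \<and> K' \<in> \<T> \<and> K \<noteq> K' \<and> (\<exists>a. a \<noteq> z \<and> {z, a} \<subseteq> verts K \<and> {z, a} \<subseteq> verts K')}"

lemma adjacent_reachable:
  assumes "K0 \<in> \<T>" "z \<in> verts K0" "(K0, K) \<in> (adjacent z)\<^sup>*"
  shows "K \<in> \<T>" "z \<in> verts K"
  using assms(3,1,2) by (induction) (auto simp: adjacent_def)

lemma star_covers_ball:
  assumes K0: "K0 \<in> \<T>" "z \<in> verts K0"
    and nb: "\<And>K a. (K0, K) \<in> (adjacent z)\<^sup>* \<Longrightarrow> a \<in> verts K \<Longrightarrow> a \<noteq> z \<Longrightarrow> \<not> closed_segment z a \<subseteq> frontier \<Omega>"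
  shows "\<exists>r>0. ball z r \<subseteq> (\<Union>K\<in>(adjacent z)\<^sup>* `` {K0}. hull_of K)"
proof -
  define F where "F = (adjacent z)\<^sup>* `` {K0}"
  have F: "K \<in> \<T>" "z \<in> verts K" if "K \<in> F" for K
    using adjacent_reachable[OF K0] that by (auto simp: F_def)
  have "finite F" using F(1) finite_mesh by (meson finite_subset subsetI)
  have step: "K' \<in> F" if "K \<in> F" "(K, K') \<in> adjacent z" for K K'
    using that by (auto simp: F_def)
  define U where "U = (\<Union>K\<in>F. hull_of K)"
  have "closed U" unfolding U_def using \<open>finite F\<close> closed_hull_of by auto
  \<comment> \<open>Close to z the coordinate of z is positive in all reached triangles. A point of
    such a triangle there, other than z, lies in its interior or on a side through z, never on the
    opposite side.\<close>
  have "\<forall>K\<in>F. \<forall>\<^sub>F y in nhds z. 0 < lam K z y"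
  proof
    fix K assume "K \<in> F"
    note p = proper_mesh[OF F(1)[OF this]]
    have "open {y. 0 < lam K z y}" by (intro open_Collect_less continuous_on_const lam_continuous p)
    moreover have "z \<in> {y. 0 < lam K z y}" using lam_vertex[OF p] F[OF \<open>K \<in> F\<close>] by simp
    ultimately show "\<forall>\<^sub>F y in nhds z. 0 < lam K z y" using eventually_nhds by blast
  qed
  then have "\<forall>\<^sub>F y in nhds z. \<forall>K\<in>F. 0 < lam K z y" using \<open>finite F\<close> by (simp add: eventually_ball_finite)
  then obtain r where r: "r > 0" "\<And>y K. dist y z < r \<Longrightarrow> K \<in> F \<Longrightarrow> 0 < lam K z y"
    unfolding eventually_nhds_metric by blast
  define B where "B = ball z r - {z}"
  have inU: "y \<in> interior U" if "y \<in> U" "y \<in> B" for y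
  proof -
    obtain K where K: "K \<in> F" "y \<in> hull_of K" using \<open>y \<in> U\<close> by (auto simp: U_def)
    note p = proper_mesh[OF F(1)[OF K(1)]]
    have lz: "0 < lam K z y" using r(2)[of y K] K \<open>y \<in> B\<close> by (simp add: B_def dist_commute)
    \<comment> \<open>The neighbour across the side from z to a is reached as well, and the two
      triangles together form a neighbourhood of y.\<close>
    have edge: "y \<in> interior U" if a: "a \<in> verts K" "a \<noteq> z" "lam K a y > 0" for a
    proof -
      have "\<not> closed_segment z a \<subseteq> frontier \<Omega>" using nb[of K a] K a by (auto simp: F_def)
      then obtain K' where K': "K' \<in> \<T>" "K' \<noteq> K" "{z, a} \<subseteq> verts K'"
        using neighbour_exists[OF F(1)[OF K(1)], of z a] a F(2)[OF K(1)] by auto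
      then have "(K, K') \<in> adjacent z" using a F[OF K(1)] by (auto simp: adjacent_def)
      then have "K' \<in> F" using step K by blast
      have "y \<in> interior (hull_of K \<union> hull_of K')"
        using edge_point_interior[of K K' z a y] K K' a F[OF K(1)] lz by auto
      moreover have "hull_of K \<union> hull_of K' \<subseteq> U" using K \<open>K' \<in> F\<close> by (auto simp: U_def)
      ultimately show ?thesis using interior_mono by blast
    qed
    obtain a b where ab: "verts K = {z, a, b}" "z \<noteq> a" "a \<noteq> b" "z \<noteq> b" using proper_verts[OF p F(2)[OF K(1)]] .
    have "lam K a y \<noteq> 0 \<or> lam K b y \<noteq> 0"
    proof (rule ccontr)
      assume "\<not> ?thesis"
      then have "y = z" using lam_combination[OF p, of y] lam_sum[OF p, of y] ab by simp
      then show False using \<open>y \<in> B\<close> by (simp add: B_def)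
    qed
    moreover have "lam K a y \<ge> 0" "lam K b y \<ge> 0" using K ab by (auto simp: mem_hull_iff[OF p])
    ultimately show ?thesis using edge[of a] edge[of b] ab by fastforce
  qed
  have "connected B" unfolding B_def
    using r(1) by (intro connected_punctured_convex) (auto simp: aff_dim_open)
  have "B \<inter> interior U \<noteq> {}"
  proof -
    obtain a b where ab: "verts K0 = {z, a, b}" "z \<noteq> a" using proper_verts[OF proper_mesh[OF K0(1)] K0(2)] .
    define t where "t = min 1 (r / (2 * norm (a - z)))"
    have t: "0 < t" "t \<le> 1" using r(1) ab by (auto simp: t_def)
    define y where "y = (1 - t) *\<^sub>R z + t *\<^sub>R a"
    have yz: "y - z = t *\<^sub>R (a - z)" by (simp add: y_def algebra_simps)
    have "t * norm (a - z) \<le> r / (2 * norm (a - z)) * norm (a - z)"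
      by (intro mult_right_mono) (simp_all add: t_def)
    then have "norm (y - z) \<le> r / 2" using ab t by (simp add: yz)
    then have "y \<in> B" using yz t ab r(1) by (auto simp: B_def dist_norm norm_minus_commute)
    moreover have "y \<in> hull_of K0" unfolding y_def
      using verts_subset_hull[of K0] ab t by (intro convexD[OF convex_hull_of]) auto
    then have "y \<in> U" by (auto simp: U_def F_def)
    ultimately show ?thesis using inU by blast
  qed
  then have "B \<inter> - U = {}"
    using connectedD[OF \<open>connected B\<close> open_interior[of U] open_Compl[OF \<open>closed U\<close>]] inU interior_subset[of U] by blast
  then have "ball z r \<subseteq> U"
    using K0 verts_subset_hull[of K0] by (auto simp: B_def U_def F_def)
  then show ?thesis using r(1) by (auto simp: U_def F_def)
qed

text \<open>Otherwise a covered ball would put z into \<Omega>. Only some boundary edge is claimed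
  to be reached: where \<Omega> touches itself at z, the triangles at z need not be reachable from
  one another.\<close>

lemma star_boundary_edge:
  assumes K0: "K0 \<in> \<T>" "z \<in> verts K0" and z: "z \<in> frontier \<Omega>"
  shows "\<exists>K a. (K0, K) \<in> (adjacent z)\<^sup>* \<and> a \<in> verts K \<and> a \<noteq> z \<and> closed_segment z a \<subseteq> frontier \<Omega>"
proof (rule ccontr)
  assume "\<not> ?thesis"
  then obtain r where r: "r > 0" "ball z r \<subseteq> (\<Union>K\<in>(adjacent z)\<^sup>* `` {K0}. hull_of K)"
    using star_covers_ball[OF K0] by blast
  then have "z \<in> interior (\<Union>K\<in>(adjacent z)\<^sup>* `` {K0}. hull_of K)"
    using mem_interior by blast
  then have "z \<in> \<Omega>"
    by (rule interior_closure_mem) (use adjacent_reachable(1)[OF K0] hull_subset_closure in blast)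
  then show False using frontier_notin z by blast
qed

text \<open>The reached triangles cover a ball around z. A point of this ball between z and the
  centroid of \<open>K1\<close> is interior to \<open>K1\<close>, so the reached triangle that
  contains it is \<open>K1\<close>.\<close>

lemma star_connected:
  assumes K0: "K0 \<in> \<T>" "z \<in> verts K0" and z: "z \<notin> frontier \<Omega>" and K1: "K1 \<in> \<T>" "z \<in> verts K1"
  shows "(K0, K1) \<in> (adjacent z)\<^sup>*"
proof -
  have "\<not> closed_segment z a \<subseteq> frontier \<Omega>" for a using z by auto
  then obtain r where r: "r > 0" "ball z r \<subseteq> (\<Union>K\<in>(adjacent z)\<^sup>* `` {K0}. hull_of K)"
    using star_covers_ball[OF K0] by blast
  note p = proper_mesh[OF K1(1)]
  define g where "g = centroid K1"
  have g: "g \<in> interior (hull_of K1)" unfolding g_def by (rule centroid_interior[OF p])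
  define t where "t = min (1/2) (r / (2 * (norm (g - z) + 1)))"
  have t: "0 < t" "t < 1"
    using r(1) by (auto simp: t_def add_nonneg_pos)
  define y where "y = (1 - t) *\<^sub>R z + t *\<^sub>R g"
  have "norm (y - z) = t * norm (g - z)"
  proof -
    have "y - z = t *\<^sub>R (g - z)" by (simp add: y_def algebra_simps)
    then show ?thesis using t by simp
  qed
  also have "\<dots> \<le> (r / (2 * (norm (g - z) + 1))) * (norm (g - z) + 1)"
    using t r(1) by (intro mult_mono) (auto simp: t_def)
  also have "\<dots> = r / 2"
  proof -
    have "norm (g - z) + 1 > 0" by (simp add: add_nonneg_pos)
    then show ?thesis by (simp add: field_simps)
  qed
  finally have "y \<in> ball z r" using r(1) by (simp add: dist_norm norm_minus_commute)
  then obtain K where K: "(K0, K) \<in> (adjacent z)\<^sup>*" "y \<in> hull_of K" using r(2) by auto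
  have "y \<in> interior (hull_of K1)"
    unfolding interior_hull_iff[OF p] y_def
  proof
    fix v assume v: "v \<in> verts K1"
    have "0 < lam K1 v g" using g v by (simp add: interior_hull_iff[OF p])
    moreover have "0 \<le> lam K1 v z" using K1 by (simp add: lam_vertex[OF p])
    ultimately show "0 < lam K1 v ((1 - t) *\<^sub>R z + t *\<^sub>R g)"
      using t by (simp add: lam_affine[OF p] add_nonneg_pos)
  qed
  then have "K1 = K" using interior_hull_unique[OF K1(1) adjacent_reachable(1)[OF K0 K(1)]] K by blast
  then show ?thesis using K by simp
qed

end

section \<open>Shape regularity\<close>

lemma mesh_size_square: "(mesh_size (a, b, c))\<^sup>2 = \<bar>dbl a b c\<bar> / 2"
  by (simp add: mesh_size_def measure_triangle)

lemma mesh_size_pos: "proper K \<Longrightarrow> mesh_size K > 0"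
  by (cases K) (simp add: mesh_size_def measure_triangle)

lemma measure_hull_of: "measure lebesgue (hull_of K) = (mesh_size K)\<^sup>2"
  by (simp add: mesh_size_def)

definition shape_regular :: "real \<Rightarrow> tri set \<Rightarrow> bool" where
  "shape_regular \<kappa> \<T> \<longleftrightarrow> (\<forall>K\<in>\<T>. \<forall>x\<in>verts K. \<forall>y\<in>verts K. norm (x - y) \<le> \<kappa> * mesh_size K)"

text \<open>If \<open>e\<close> is half the refinement edge and \<open>f\<close> the median from the newest vertex, then the
  corresponding vectors of both children are, up to order and sign, \<open>(e + f) / 2\<close> and
  \<open>(e - f) / 2\<close>. Hence a bisection halves \<open>\<bar>e\<bar>\<^sup>2 + \<bar>f\<bar>\<^sup>2\<close>, just as it halves the area, and the ratio of
  the two bounds the diameter of all refined triangles by the square root of their area.\<close>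

fun edge_median :: "tri \<Rightarrow> real" where
  "edge_median (a, b, c) = (norm (c - b))\<^sup>2 / 4 + (norm (a - midpoint b c))\<^sup>2"

fun double_area :: "tri \<Rightarrow> real" where
  "double_area (a, b, c) = \<bar>dbl a b c\<bar>"

lemma norm_square_2: "(norm x)\<^sup>2 = (x $ 1)\<^sup>2 + (x $ 2)\<^sup>2" for x :: point
  by (simp add: norm_vec_def L2_set_def sum_2)

lemma children_halve:
  assumes "K' \<in> children K"
  shows "edge_median K' = edge_median K / 2" "double_area K' = double_area K / 2"
proof -
  obtain a b c where K: "K = (a, b, c)" by (cases K)
  have "dbl (midpoint b c) a b = dbl a b c / 2" "dbl (midpoint b c) c a = dbl a b c / 2"
    by (simp_all add: dbl_def midpoint_def algebra_simps)
  then show "double_area K' = double_area K / 2"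
    using assms K by auto
  show "edge_median K' = edge_median K / 2"
    using assms K unfolding children.simps
    by (auto simp: norm_square_2 midpoint_def) (simp_all add: power2_eq_square field_simps)
qed

lemma nvb_invariant:
  assumes "bisect_step\<^sup>*\<^sup>* \<T> \<T>'" "\<forall>K\<in>\<T>. edge_median K \<le> c * double_area K"
  shows "\<forall>K\<in>\<T>'. edge_median K \<le> c * double_area K"
  using assms
proof (induction rule: rtranclp_induct)
  case (step \<T>' \<T>'')
  then obtain L where L: "L \<in> \<T>'" "\<T>'' = (\<T>' - {L}) \<union> children L" by (auto simp: bisect_step_def)
  show ?case
  proof
    fix K assume "K \<in> \<T>''"
    then consider "K \<in> \<T>'" | "K \<in> children L" using L by auto
    then show "edge_median K \<le> c * double_area K"
      using step L by cases (auto simp: children_halve)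
  qed
qed simp

text \<open>In terms of the half edge e and the median f, the sides are, up to sign, 2 e, f + e and
  f - e.\<close>

lemma edge_median_diameter:
  assumes "x \<in> verts K" "y \<in> verts K"
  shows "(norm (x - y))\<^sup>2 \<le> 4 * edge_median K"
proof -
  obtain a b c where K: "K = (a, b, c)" by (cases K)
  define e f where "e = (1/2) *\<^sub>R (c - b)" and "f = a - midpoint b c"
  have S: "edge_median K = (norm e)\<^sup>2 + (norm f)\<^sup>2" by (simp add: K e_def f_def power_divide)
  have m: "midpoint b c = b + e" by (simp add: vec_eq_iff e_def midpoint_def field_simps)
  have eqs: "c - b = e + e" "a - b = f + e" "a - c = f + - e"
    by (simp_all add: vec_eq_iff f_def e_def midpoint_def field_simps)
  have "(norm (c - b))\<^sup>2 \<le> 4 * edge_median K" "(norm (a - b))\<^sup>2 \<le> 4 * edge_median K" "(norm (a - c))\<^sup>2 \<le> 4 * edge_median K"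
    unfolding eqs S by (rule order_trans[OF norm_add_square_le], simp)+
  then show ?thesis using assms K by (auto simp: norm_minus_commute S)
qed

lemma nvb_shape_regular:
  assumes "finite \<T>\<^sub>0" "\<forall>K\<in>\<T>\<^sub>0. proper K"
  obtains \<kappa> where "\<kappa> > 0" "\<And>\<T>. bisect_step\<^sup>*\<^sup>* \<T>\<^sub>0 \<T> \<Longrightarrow> shape_regular \<kappa> \<T>"
proof -
  \<comment> \<open>The sum bounds the ratio for every single initial triangle; the summand 1 makes
    c positive.\<close>
  define c where "c = 1 + (\<Sum>K\<in>\<T>\<^sub>0. edge_median K / double_area K)"
  have em: "edge_median K \<ge> 0" for K by (cases K) simp
  have da: "double_area K \<ge> 0" for K by (cases K) simp
  have "c \<ge> 1" unfolding c_def by (simp add: sum_nonneg em da)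
  have "edge_median K \<le> c * double_area K" if "K \<in> \<T>\<^sub>0" for K
  proof -
    have "edge_median K / double_area K \<le> (\<Sum>K\<in>\<T>\<^sub>0. edge_median K / double_area K)"
      using that assms(1) em da by (intro member_le_sum) auto
    then have "edge_median K / double_area K \<le> c" by (simp add: c_def)
    moreover have "double_area K > 0" using assms(2) that by (cases K) auto
    ultimately show ?thesis by (simp add: field_simps)
  qed
  then have inv: "edge_median K \<le> c * double_area K" if "bisect_step\<^sup>*\<^sup>* \<T>\<^sub>0 \<T>" "K \<in> \<T>" for \<T> K
    using nvb_invariant[OF that(1), of c] that(2) by blast
  show thesis
  proof
    \<comment> \<open>The factor 8 is 4 from \<open>edge_median_diameter\<close> times 2, as
      \<open>double_area\<close> is twice the squared mesh size.\<close>
    show "0 < sqrt (8 * c)" using \<open>c \<ge> 1\<close> by simp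
    fix \<T> assume T: "bisect_step\<^sup>*\<^sup>* \<T>\<^sub>0 \<T>"
    show "shape_regular (sqrt (8 * c)) \<T>"
      unfolding shape_regular_def
    proof (intro ballI)
      fix K x y assume K: "K \<in> \<T>" and xy: "x \<in> verts K" "y \<in> verts K"
      have "double_area K = 2 * (mesh_size K)\<^sup>2" by (cases K) (simp add: mesh_size_square)
      then have "(norm (x - y))\<^sup>2 \<le> 8 * c * (mesh_size K)\<^sup>2"
        using edge_median_diameter[OF xy] inv[OF T K] by simp
      then have "norm (x - y) \<le> sqrt (8 * c * (mesh_size K)\<^sup>2)" by (rule real_le_rsqrt)
      then show "norm (x - y) \<le> sqrt (8 * c) * mesh_size K"
        by (simp add: real_sqrt_mult mesh_size_def)
    qed
  qed
qed

section \<open>Nodal averaging\<close>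

text \<open>Let N = \<open>unit_ball_vol 2 * \<kappa>\<^sup>2\<close>, which bounds the number of
  triangles at a vertex. Then 2 N^2 + 1 bounds the number of half edges passed on a walk in
  \<open>nodal_error\<close>, and 3 N comes from exchanging sums over triangles and vertices in
  \<open>nodal_error_sum\<close>.\<close>

definition nodal_const :: "real \<Rightarrow> real" where
  "nodal_const \<kappa> = ((2 * (unit_ball_vol 2 * \<kappa>\<^sup>2)\<^sup>2 + 1) * \<kappa>)\<^sup>2 * (3 * (unit_ball_vol 2 * \<kappa>\<^sup>2))"

context mesh
begin

lemma hull_Int_negligible:
  assumes "K \<in> \<T>" "K' \<in> \<T>" "K \<noteq> K'"
  shows "negligible (hull_of K \<inter> hull_of K')"
proof (rule negligible_subset[OF negligible_convex_frontier[OF convex_hull_of]])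
  show "hull_of K \<inter> hull_of K' \<subseteq> frontier (hull_of K)"
    using interior_hull_unique[OF assms(1,2)] assms(3) closed_hull_of[of K]
    by (auto simp: frontier_def)
qed

text \<open>Each triangle at z is shrunk towards z by the factor r / (\<kappa> h), where h is its
  mesh size. The images have the common area \<open>r\<^sup>2 / \<kappa>\<^sup>2\<close>, lie in the
  disc of radius r around z and overlap in null sets only, so comparing areas bounds their
  number.\<close>

lemma card_star:
  assumes reg: "shape_regular \<kappa> \<T>" and \<kappa>: "\<kappa> > 0"
  shows "real (card {K\<in>\<T>. z \<in> verts K}) \<le> unit_ball_vol 2 * \<kappa>\<^sup>2"
proof (cases "{K\<in>\<T>. z \<in> verts K} = {}")
  case False
  define S where "S = {K\<in>\<T>. z \<in> verts K}"
  have S: "finite S" "S \<noteq> {}" using False finite_mesh by (auto simp: S_def)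
  have p: "proper K" if "K \<in> S" for K using that proper_mesh by (auto simp: S_def)
  \<comment> \<open>The minimum makes every shrinking factor at most 1, so the images stay inside
    their triangles.\<close>
  define r where "r = Min ((\<lambda>K. \<kappa> * mesh_size K) ` S)"
  have r: "r > 0" "\<And>K. K \<in> S \<Longrightarrow> r \<le> \<kappa> * mesh_size K"
    using S \<kappa> by (auto simp: r_def mesh_size_pos p)
  have "\<exists>T. T \<in> lmeasurable \<and> T \<subseteq> hull_of K \<and> T \<subseteq> cball z r \<and> measure lebesgue T = r\<^sup>2 / \<kappa>\<^sup>2" if K: "K \<in> S" for K
  proof -
    have zK: "z \<in> verts K" using K by (simp add: S_def)
    obtain a b where ab: "verts K = {z, a, b}" "z \<noteq> a" "a \<noteq> b" "z \<noteq> b" using proper_verts[OF p[OF K] zK] .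
    define t where "t = r / (\<kappa> * mesh_size K)"
    have hp: "mesh_size K > 0" by (rule mesh_size_pos[OF p[OF K]])
    have t: "0 < t" "t \<le> 1" using r(1) r(2)[OF K] \<kappa> hp by (auto simp: t_def)
    define T where "T = convex hull {z, (1 - t) *\<^sub>R z + t *\<^sub>R a, (1 - t) *\<^sub>R z + t *\<^sub>R b}"
    have "T \<in> lmeasurable" unfolding T_def by (rule lmeasurable_compact[OF compact_triangle])
    moreover have "T \<subseteq> hull_of K"
      unfolding T_def using ab verts_subset_hull[of K] t
      by (intro hull_minimal convex_hull_of) (auto intro!: convexD[OF convex_hull_of])
    moreover have "T \<subseteq> cball z r"
    proof -
      have "norm (z - ((1 - t) *\<^sub>R z + t *\<^sub>R x)) \<le> r" if "x \<in> verts K" for x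
      proof -
        have "norm (z - ((1 - t) *\<^sub>R z + t *\<^sub>R x)) = norm (t *\<^sub>R (z - x))" by (simp add: algebra_simps)
        also have "\<dots> \<le> t * (\<kappa> * mesh_size K)"
          using reg K that zK t by (auto simp: shape_regular_def S_def intro!: mult_left_mono)
        also have "\<dots> = r" using \<kappa> hp by (simp add: t_def)
        finally show ?thesis .
      qed
      then show ?thesis unfolding T_def using ab r(1)
        by (intro hull_minimal convex_cball) (auto simp: dist_norm)
    qed
    moreover have "measure lebesgue T = r\<^sup>2 / \<kappa>\<^sup>2"
    proof -
      have "dbl z ((1 - t) *\<^sub>R z + t *\<^sub>R a) ((1 - t) *\<^sub>R z + t *\<^sub>R b) = t\<^sup>2 * dbl z a b"
        by (simp add: dbl_def power2_eq_square algebra_simps)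
      then have "measure lebesgue T = t\<^sup>2 * measure lebesgue (hull_of K)"
        by (simp add: T_def hull_of_eq ab measure_triangle abs_mult)
      also have "\<dots> = r\<^sup>2 / \<kappa>\<^sup>2"
        unfolding measure_hull_of t_def using hp by (simp add: power_divide power_mult_distrib)
      finally show ?thesis .
    qed
    ultimately show ?thesis by blast
  qed
  then obtain T where T: "\<And>K. K \<in> S \<Longrightarrow> T K \<in> lmeasurable" "\<And>K. K \<in> S \<Longrightarrow> T K \<subseteq> hull_of K"
    "\<And>K. K \<in> S \<Longrightarrow> T K \<subseteq> cball z r" "\<And>K. K \<in> S \<Longrightarrow> measure lebesgue (T K) = r\<^sup>2 / \<kappa>\<^sup>2" by metis
  have "measure lebesgue (\<Union> (T ` S)) = (\<Sum>K\<in>S. measure lebesgue (T K))"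
  proof (rule measure_negligible_finite_Union_image[OF S(1) T(1)])
    show "pairwise (\<lambda>K K'. negligible (T K \<inter> T K')) S"
      unfolding pairwise_def using T(2) hull_Int_negligible
      by (metis (no_types, lifting) Int_mono S_def mem_Collect_eq negligible_subset)
  qed
  also have "\<dots> = real (card S) * (r\<^sup>2 / \<kappa>\<^sup>2)" using T(4) by simp
  finally have "real (card S) * (r\<^sup>2 / \<kappa>\<^sup>2) = measure lebesgue (\<Union> (T ` S))" ..
  also have "\<dots> \<le> measure lebesgue (cball z r)"
  proof (rule measure_mono_fmeasurable)
    show "\<Union> (T ` S) \<subseteq> cball z r" using T(3) by (rule UN_least)
    show "\<Union> (T ` S) \<in> sets lebesgue" using T(1) S(1) by (intro sets.finite_UN) auto
  qed simp
  also have "\<dots> = measure lborel (cball z r)" by (intro measure_completion) auto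
  also have "\<dots> = unit_ball_vol 2 * r\<^sup>2" using content_cball[of r z] r(1) by simp
  finally have "real (card S) * (r\<^sup>2 / \<kappa>\<^sup>2) \<le> unit_ball_vol 2 * r\<^sup>2" .
  then show ?thesis using r(1) \<kappa> by (simp add: S_def field_simps)
next
  case True
  show ?thesis unfolding True by (simp add: unit_ball_vol_nonneg)
qed

text \<open>The average gives all its weight to one chosen triangle; this is enough since all values
  at a vertex off the boundary are close to each other. On the boundary the value is 0, as the
  companion has to vanish there.\<close>

definition nodal :: "(tri \<Rightarrow> point \<Rightarrow> real) \<Rightarrow> point \<Rightarrow> real" where
  "nodal A z = (if z \<in> frontier \<Omega> then 0 else A (SOME K. K \<in> \<T> \<and> z \<in> verts K) z)"

text \<open>One component of a nonconforming function: \<open>A K\<close> is the affine piece of K,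
  defined on the whole plane, and \<open>m K\<close> its gradient. The conditions on edge integrals
  appear as midpoint values, which is equivalent for affine functions.\<close>

definition crouzeix_raviart :: "(tri \<Rightarrow> point \<Rightarrow> real) \<Rightarrow> (tri \<Rightarrow> point) \<Rightarrow> bool" where
  "crouzeix_raviart A m \<longleftrightarrow>
     (\<forall>K\<in>\<T>. \<forall>x y. A K x - A K y = m K \<bullet> (x - y)) \<and>
     (\<forall>K\<in>\<T>. \<forall>a\<in>verts K. \<forall>b\<in>verts K. a \<noteq> b \<longrightarrow> closed_segment a b \<subseteq> frontier \<Omega> \<longrightarrow> A K (midpoint a b) = 0) \<and>
     (\<forall>K\<in>\<T>. \<forall>K'\<in>\<T>. \<forall>a\<in>verts K \<inter> verts K'. \<forall>b\<in>verts K \<inter> verts K'. a \<noteq> b \<longrightarrow>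
        A K (midpoint a b) = A K' (midpoint a b))"

text \<open>Between z and the midpoint of an edge at z a piece changes by at most \<kappa> M, and at
  the midpoint the pieces of both neighbours agree. Passing to a neighbour thus costs 2 \<kappa> M,
  and going to the midpoint of a boundary edge, where the value is 0, costs \<kappa> M.\<close>

lemma nodal_error:
  assumes reg: "shape_regular \<kappa> \<T>" and \<kappa>: "\<kappa> > 0" and cr: "crouzeix_raviart A m"
    and K: "K \<in> \<T>" "z \<in> verts K"
    and M: "\<And>K. K \<in> \<T> \<Longrightarrow> z \<in> verts K \<Longrightarrow> mesh_size K * norm (m K) \<le> M"
  shows "\<bar>A K z - nodal A z\<bar> \<le> (2 * (unit_ball_vol 2 * \<kappa>\<^sup>2)\<^sup>2 + 1) * \<kappa> * M"
proof -
  define S where "S = {K\<in>\<T>. z \<in> verts K}"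
  define N where "N = unit_ball_vol 2 * \<kappa>\<^sup>2"
  have cardS: "real (card S) \<le> N" unfolding S_def N_def by (rule card_star[OF reg \<kappa>])
  have "M \<ge> 0" using M[OF K] mesh_size_pos[OF proper_mesh[OF K(1)]] by (meson mult_nonneg_nonneg norm_ge_zero less_imp_le order_trans)
  have near: "\<bar>A K z - A K (midpoint z a)\<bar> \<le> \<kappa> * M" if "K \<in> \<T>" "z \<in> verts K" "a \<in> verts K" for K a
  proof -
    have "A K z - A K (midpoint z a) = m K \<bullet> (z - midpoint z a)"
      using cr that by (simp add: crouzeix_raviart_def)
    also have "z - midpoint z a = (1/2) *\<^sub>R (z - a)"
      by (simp add: midpoint_def algebra_simps flip: scaleR_add_left)
    finally have "A K z - A K (midpoint z a) = (1/2) * (m K \<bullet> (z - a))" by simp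
    then have "\<bar>A K z - A K (midpoint z a)\<bar> = (1/2) * \<bar>m K \<bullet> (z - a)\<bar>" by (simp only: abs_mult)
    also have "\<dots> \<le> \<bar>m K \<bullet> (z - a)\<bar>" by simp
    also have "\<dots> \<le> norm (m K) * norm (z - a)" by (rule Cauchy_Schwarz_ineq2)
    also have "\<dots> \<le> norm (m K) * (\<kappa> * mesh_size K)"
      using reg that by (intro mult_left_mono) (auto simp: shape_regular_def)
    also have "\<dots> = \<kappa> * (mesh_size K * norm (m K))" by (simp add: mult_ac)
    also have "\<dots> \<le> \<kappa> * M" using M[OF that(1,2)] \<kappa> by (intro mult_left_mono) auto
    finally show ?thesis .
  qed
  have step: "\<bar>A L z - A L' z\<bar> \<le> 2 * (\<kappa> * M)" if adj: "(L, L') \<in> adjacent z" for L L'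
  proof -
    obtain a where a: "a \<noteq> z" "{z, a} \<subseteq> verts L" "{z, a} \<subseteq> verts L'" "L \<in> \<T>" "L' \<in> \<T>"
      using adj unfolding adjacent_def by blast
    then have "A L (midpoint z a) = A L' (midpoint z a)"
      using cr unfolding crouzeix_raviart_def by (metis IntI insert_subset)
    then show ?thesis using near[of L a] near[of L' a] a by auto
  qed
  have path: "\<bar>A L z - A L' z\<bar> \<le> 2 * real n * (\<kappa> * M)" if "(L, L') \<in> adjacent z ^^ n" for L L' n
    using that
  proof (induction n arbitrary: L')
    case (Suc n)
    then obtain L'' where "(L, L'') \<in> adjacent z ^^ n" "(L'', L') \<in> adjacent z" by auto
    then have "\<bar>A L z - A L'' z\<bar> \<le> 2 * real n * (\<kappa> * M)" "\<bar>A L'' z - A L' z\<bar> \<le> 2 * (\<kappa> * M)"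
      using Suc.IH step by auto
    then show ?case by (simp add: algebra_simps)
  qed simp
  have reach: "\<bar>A L z - A L' z\<bar> \<le> 2 * N\<^sup>2 * (\<kappa> * M)" if adj: "(L, L') \<in> (adjacent z)\<^sup>*" for L L'
  proof -
    have sub: "adjacent z \<subseteq> S \<times> S" by (auto simp: adjacent_def S_def)
    have finS: "finite S" using finite_mesh by (simp add: S_def)
    then have fin: "finite (adjacent z)" using sub by (meson finite_SigmaI finite_subset)
    \<comment> \<open>The walk need not be longer than the number of pairs in
      \<open>adjacent z\<close>, which is at most the square of the number of triangles at
      z.\<close>
    obtain n where n: "n \<le> card (adjacent z)" "(L, L') \<in> adjacent z ^^ n"
      using adj unfolding rtrancl_finite_eq_relpow[OF fin] by auto
    have "card (adjacent z) \<le> card S * card S"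
      using card_mono[OF _ sub] finS by (simp add: card_cartesian_product)
    then have "n \<le> card S * card S" using n(1) by linarith
    then have "real n \<le> real (card S * card S)" by (rule of_nat_mono)
    also have "\<dots> = (real (card S))\<^sup>2" by (simp add: power2_eq_square)
    also have "\<dots> \<le> N\<^sup>2" using cardS by (intro power_mono) auto
    finally have "2 * real n * (\<kappa> * M) \<le> 2 * N\<^sup>2 * (\<kappa> * M)"
      using \<kappa> \<open>M \<ge> 0\<close> by (intro mult_right_mono) auto
    then show ?thesis using path[OF n(2)] by linarith
  qed
  have "\<bar>A K z - nodal A z\<bar> \<le> 2 * N\<^sup>2 * (\<kappa> * M) + \<kappa> * M"
  proof (cases "z \<in> frontier \<Omega>")
    case True
    obtain L a where L: "(K, L) \<in> (adjacent z)\<^sup>*" "a \<in> verts L" "a \<noteq> z" "closed_segment z a \<subseteq> frontier \<Omega>"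
      using star_boundary_edge[OF K True] by blast
    have L': "L \<in> \<T>" "z \<in> verts L" using adjacent_reachable[OF K L(1)] .
    have "A L (midpoint z a) = 0" using cr L L' unfolding crouzeix_raviart_def by metis
    then have "\<bar>A L z\<bar> \<le> \<kappa> * M" using near[OF L' L(2)] by simp
    then show ?thesis using reach[OF L(1)] True by (simp add: nodal_def)
  next
    case False
    define L where "L = (SOME K. K \<in> \<T> \<and> z \<in> verts K)"
    have "L \<in> \<T> \<and> z \<in> verts L" unfolding L_def by (rule someI[of _ K]) (use K in auto)
    then have "(K, L) \<in> (adjacent z)\<^sup>*" using star_connected[OF K False] by blast
    then have "\<bar>A K z - A L z\<bar> \<le> 2 * N\<^sup>2 * (\<kappa> * M)" by (rule reach)
    moreover have "\<kappa> * M \<ge> 0" using \<kappa> \<open>M \<ge> 0\<close> by simp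
    ultimately show ?thesis using False by (simp add: nodal_def L_def)
  qed
  then show ?thesis by (simp add: N_def algebra_simps)
qed

text \<open>The error at a vertex is bounded through the sum over its star. Every triangle lies in
  the stars of its three vertices, and each star is counted once for each of its triangles, that is,
  at most \<open>unit_ball_vol 2 * \<kappa>\<^sup>2\<close> times.\<close>

lemma nodal_error_sum:
  assumes reg: "shape_regular \<kappa> \<T>" and \<kappa>: "\<kappa> > 0" and cr: "crouzeix_raviart A m"
  shows "(\<Sum>K\<in>\<T>. \<Sum>z\<in>verts K. (A K z - nodal A z)\<^sup>2) \<le>
    nodal_const \<kappa> * (\<Sum>K\<in>\<T>. (mesh_size K * norm (m K))\<^sup>2)"
proof -
  define C where "C = (2 * (unit_ball_vol 2 * \<kappa>\<^sup>2)\<^sup>2 + 1) * \<kappa>"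
  define s where "s = (\<lambda>K. (mesh_size K * norm (m K))\<^sup>2)"
  have "C \<ge> 0" using \<kappa> by (simp add: C_def)
  define St where "St = (\<lambda>z. {K\<in>\<T>. z \<in> verts K})"
  define V where "V = (\<Union>K\<in>\<T>. verts K)"
  have fin: "finite V" "finite (St z)" for z using finite_mesh finite_verts by (auto simp: V_def St_def)
  have bound: "(A K z - nodal A z)\<^sup>2 \<le> C\<^sup>2 * (\<Sum>L\<in>St z. s L)" if K: "K \<in> \<T>" "z \<in> verts K" for K z
  proof -
    define M where "M = sqrt (\<Sum>L\<in>St z. s L)"
    have "mesh_size L * norm (m L) \<le> M" if "L \<in> \<T>" "z \<in> verts L" for L
    proof -
      have "s L \<le> (\<Sum>L\<in>St z. s L)"
        using that fin by (intro member_le_sum) (auto simp: s_def St_def)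
      then show ?thesis unfolding M_def s_def by (rule real_le_rsqrt)
    qed
    then have "\<bar>A K z - nodal A z\<bar> \<le> C * M" unfolding C_def by (rule nodal_error[OF reg \<kappa> cr K])
    then have "\<bar>A K z - nodal A z\<bar>\<^sup>2 \<le> (C * M)\<^sup>2" by (rule power_mono) simp
    also have "\<dots> = C\<^sup>2 * (\<Sum>L\<in>St z. s L)"
      by (simp add: power_mult_distrib M_def sum_nonneg s_def)
    finally show ?thesis by simp
  qed
  have "(\<Sum>K\<in>\<T>. \<Sum>z\<in>verts K. (A K z - nodal A z)\<^sup>2) \<le> (\<Sum>K\<in>\<T>. \<Sum>z\<in>verts K. C\<^sup>2 * (\<Sum>L\<in>St z. s L))"
    using bound by (intro sum_mono)
  also have "\<dots> = (\<Sum>K\<in>\<T>. \<Sum>z\<in>{z\<in>V. z \<in> verts K}. C\<^sup>2 * (\<Sum>L\<in>St z. s L))"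
    by (intro sum.cong refl) (auto simp: V_def)
  also have "\<dots> = (\<Sum>z\<in>V. \<Sum>K\<in>St z. C\<^sup>2 * (\<Sum>L\<in>St z. s L))"
    unfolding St_def by (rule sum.swap_restrict[OF finite_mesh fin(1)])
  also have "\<dots> = (\<Sum>z\<in>V. real (card (St z)) * (C\<^sup>2 * (\<Sum>L\<in>St z. s L)))" by simp
  also have "\<dots> \<le> (\<Sum>z\<in>V. (unit_ball_vol 2 * \<kappa>\<^sup>2) * (C\<^sup>2 * (\<Sum>L\<in>St z. s L)))"
    using card_star[OF reg \<kappa>]
    by (intro sum_mono mult_right_mono) (auto simp: St_def s_def intro!: mult_nonneg_nonneg sum_nonneg)
  also have "\<dots> = (unit_ball_vol 2 * \<kappa>\<^sup>2) * C\<^sup>2 * (\<Sum>z\<in>V. \<Sum>L\<in>St z. s L)"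
    by (simp add: sum_distrib_left mult.assoc)
  also have "(\<Sum>z\<in>V. \<Sum>L\<in>St z. s L) = (\<Sum>L\<in>\<T>. \<Sum>z\<in>{z\<in>V. z \<in> verts L}. s L)"
    unfolding St_def by (rule sum.swap_restrict[OF finite_mesh fin(1), symmetric])
  also have "\<dots> = (\<Sum>L\<in>\<T>. 3 * s L)"
  proof (rule sum.cong[OF refl])
    fix L assume L: "L \<in> \<T>"
    then have "{z\<in>V. z \<in> verts L} = verts L" by (auto simp: V_def)
    then show "(\<Sum>z\<in>{z\<in>V. z \<in> verts L}. s L) = 3 * s L" using card_verts[OF proper_mesh[OF L]] by simp
  qed
  also have "\<dots> = 3 * (\<Sum>L\<in>\<T>. s L)" by (simp only: sum_distrib_left)
  finally show ?thesis
    unfolding nodal_const_def C_def[symmetric] s_def by (simp only: mult_ac)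
qed

end

section \<open>The local difference between a nonconforming function and its companion\<close>

text \<open>On an edge with end points \<open>z\<close> and \<open>y\<close>, where \<open>lam K z + lam K y = 1\<close>, the function
  \<open>3 (lam K z)\<^sup>2 - 2 lam K z\<close> is the hat function of \<open>z\<close> minus three times the edge bubble
  \<open>lam K z * lam K y\<close>, a combination with mean zero on the edge. In place of the divergence theorem,
  \<open>6 lam K z - 2\<close> has mean zero on \<open>K\<close>. The coefficient of the element bubble is left to make the
  whole function orthogonal to constants.\<close>

definition nc_diff :: "tri \<Rightarrow> (point \<Rightarrow> real) \<Rightarrow> real \<Rightarrow> point \<Rightarrow> real" where
  "nc_diff K \<delta> d x = (\<Sum>z\<in>verts K. \<delta> z * (3 * (lam K z x)\<^sup>2 - 2 * lam K z x)) - d * (\<Prod>z\<in>verts K. lam K z x)"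

definition nc_grad :: "tri \<Rightarrow> (point \<Rightarrow> real) \<Rightarrow> real \<Rightarrow> point \<Rightarrow> point" where
  "nc_grad K \<delta> d x = (\<Sum>z\<in>verts K. (\<delta> z * (6 * lam K z x - 2)) *\<^sub>R lam_grad K z)
     - d *\<^sub>R (\<Sum>z\<in>verts K. (\<Prod>y\<in>verts K - {z}. lam K y x) *\<^sub>R lam_grad K z)"

definition nc_coef :: "tri \<Rightarrow> (point \<Rightarrow> real) \<Rightarrow> real" where
  "nc_coef K \<delta> = (\<Sum>z\<in>verts K. \<delta> z * (LINT x|lebesgue_on (hull_of K). 3 * (lam K z x)\<^sup>2 - 2 * lam K z x))
     / (LINT x|lebesgue_on (hull_of K). (\<Prod>z\<in>verts K. lam K z x))"

lemma nc_diff_has_derivative: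
  assumes "proper K"
  shows "(nc_diff K \<delta> d has_derivative (\<lambda>h. nc_grad K \<delta> d x \<bullet> h)) (at x)"
proof -
  have 1: "((\<lambda>x. \<delta> z * (3 * (lam K z x)\<^sup>2 - 2 * lam K z x)) has_derivative
      (\<lambda>h. ((\<delta> z * (6 * lam K z x - 2)) *\<^sub>R lam_grad K z) \<bullet> h)) (at x)" for z
    by (rule has_derivative_eq_rhs, (rule derivative_eq_intros lam_has_derivative[OF assms] refl)+)
       (auto simp: fun_eq_iff algebra_simps)
  have "((\<lambda>x. \<Prod>z\<in>verts K. lam K z x) has_derivative
      (\<lambda>h. \<Sum>z\<in>verts K. (lam_grad K z \<bullet> h) * (\<Prod>y\<in>verts K - {z}. lam K y x))) (at x)"
    by (rule has_derivative_prod) (rule lam_has_derivative[OF assms])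
  then have 2: "((\<lambda>x. d * (\<Prod>z\<in>verts K. lam K z x)) has_derivative
      (\<lambda>h. d * (\<Sum>z\<in>verts K. (lam_grad K z \<bullet> h) * (\<Prod>y\<in>verts K - {z}. lam K y x)))) (at x)"
    by (rule has_derivative_mult_right)
  have "nc_diff K \<delta> d = (\<lambda>x. (\<Sum>z\<in>verts K. \<delta> z * (3 * (lam K z x)\<^sup>2 - 2 * lam K z x)) - d * (\<Prod>z\<in>verts K. lam K z x))"
    by (simp add: nc_diff_def fun_eq_iff)
  moreover have "(\<lambda>h. nc_grad K \<delta> d x \<bullet> h) = (\<lambda>h. (\<Sum>z\<in>verts K. ((\<delta> z * (6 * lam K z x - 2)) *\<^sub>R lam_grad K z) \<bullet> h)
      - d * (\<Sum>z\<in>verts K. (lam_grad K z \<bullet> h) * (\<Prod>y\<in>verts K - {z}. lam K y x)))"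
    by (simp add: nc_grad_def inner_diff_left inner_sum_left fun_eq_iff mult.commute)
  ultimately show ?thesis
    using has_derivative_diff[OF has_derivative_sum[of "verts K", OF 1] 2] by simp
qed

lemma nc_diff_continuous: "proper K \<Longrightarrow> continuous_on S (nc_diff K \<delta> d)"
  by (meson nc_diff_has_derivative has_derivative_continuous continuous_at_imp_continuous_on)

lemma nc_grad_continuous: "proper K \<Longrightarrow> continuous_on S (nc_grad K \<delta> d)"
  unfolding nc_grad_def by (intro continuous_intros lam_continuous)

lemma hull_of_sets: "hull_of K \<in> sets lebesgue"
  using compact_hull_of[of K] by (auto dest: compact_imp_closed)

lemma hull_of_lmeasurable: "hull_of K \<in> lmeasurable"
  by (rule lmeasurable_compact[OF compact_hull_of])

lemma measure_on_hull: "measure (lebesgue_on (hull_of K)) (hull_of K) = (mesh_size K)\<^sup>2"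
  using hull_of_sets[of K] by (simp add: measure_restrict_space measure_hull_of)

lemma hull_integrable:
  fixes f :: "point \<Rightarrow> real"
  assumes "continuous_on UNIV f"
  shows "integrable (lebesgue_on (hull_of K)) f"
  by (intro LINT_continuous_compact(1) compact_hull_of continuous_on_subset[OF assms]) simp

section \<open>Vanishing means of the local difference and its gradient\<close>

lemma LINT_lam:
  assumes "proper K" "z \<in> verts K"
  shows "(LINT x|lebesgue_on (hull_of K). lam K z x) = (mesh_size K)\<^sup>2 / 3"
proof -
  obtain a b where ab: "verts K = {z, a, b}" "z \<noteq> a" "a \<noteq> b" "z \<noteq> b" using proper_verts[OF assms] .
  note l = lam_verts[OF assms(1) ab]
  show ?thesis
    using LINT_bary[OF l(1)] by (simp add: l measure_hull_of[symmetric] hull_of_eq ab measure_triangle)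
qed

lemma LINT_lam_product:
  obtains Q where "\<And>K z. proper K \<Longrightarrow> z \<in> verts K \<Longrightarrow>
    (LINT x|lebesgue_on (hull_of K). (\<Prod>y\<in>verts K - {z}. lam K y x)) = (mesh_size K)\<^sup>2 * Q"
proof -
  obtain Q where Q: "\<And>a b c. dbl a b c \<noteq> 0 \<Longrightarrow>
      (LINT x|lebesgue_on (convex hull {a, b, c}). bary b c a x * bary c a b x) = \<bar>dbl a b c\<bar> * Q"
    using LINT_bary_product by blast
  have "(LINT x|lebesgue_on (hull_of K). (\<Prod>y\<in>verts K - {z}. lam K y x)) = (mesh_size K)\<^sup>2 * (2 * Q)"
    if K: "proper K" "z \<in> verts K" for K z
  proof -
    obtain a b where ab: "verts K = {z, a, b}" "z \<noteq> a" "a \<noteq> b" "z \<noteq> b" using proper_verts[OF K] .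
    note l = lam_verts[OF K(1) ab]
    have "verts K - {z} = {a, b}" using ab by auto
    then show ?thesis
      using Q[OF l(1)] ab by (simp add: l measure_hull_of[symmetric] hull_of_eq measure_triangle)
  qed
  then show thesis using that by blast
qed

lemma LINT_lam_bubble:
  assumes "proper K"
  shows "(LINT x|lebesgue_on (hull_of K). (\<Prod>z\<in>verts K. lam K z x)) = (mesh_size K)\<^sup>2 * (2 * bubble_moment)"
proof -
  obtain a b c where K: "K = (a, b, c)" by (cases K)
  then have nz: "dbl a b c \<noteq> 0" and d: "a \<noteq> b" "b \<noteq> c" "a \<noteq> c" using assms dbl_distinct[of a b c] by auto
  have v: "verts K = {a, b, c}" using K by simp
  note l = lam_verts[OF assms v d]
  show ?thesis
    using LINT_bary_bubble(1)[OF nz] d unfolding v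
    by (simp add: l measure_hull_of[symmetric] hull_of_eq v measure_triangle mult.assoc)
qed

lemma LINT_nc_diff:
  assumes "proper K"
  shows "(LINT x|lebesgue_on (hull_of K). nc_diff K \<delta> (nc_coef K \<delta>) x) = 0"
proof -
  have "mesh_size K > 0" by (rule mesh_size_pos[OF assms])
  \<comment> \<open>Positivity of the bubble moment makes the division in \<open>nc_coef\<close> a
    proper one.\<close>
  then have nz: "(LINT x|lebesgue_on (hull_of K). (\<Prod>z\<in>verts K. lam K z x)) \<noteq> 0"
    using bubble_moment_pos by (simp add: LINT_lam_bubble[OF assms])
  have "continuous_on UNIV (\<lambda>x. 3 * (lam K z x)\<^sup>2 - 2 * lam K z x)"
    "continuous_on UNIV (\<lambda>x. \<Prod>z\<in>verts K. lam K z x)" for z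
    by (intro continuous_intros lam_continuous assms)+
  note int = this[THEN hull_integrable]
  show ?thesis
    unfolding nc_diff_def using int nz by (simp add: nc_coef_def)
qed

lemma lam_grad_sum:
  assumes "proper K"
  shows "(\<Sum>z\<in>verts K. lam_grad K z) = 0"
proof -
  obtain a b c where K: "K = (a, b, c)" by (cases K)
  then have nz: "dbl a b c \<noteq> 0" and d: "a \<noteq> b" "b \<noteq> c" "a \<noteq> c" using assms dbl_distinct[of a b c] by auto
  then show ?thesis using bary_grad_sum[OF nz] K by (simp add: add.assoc)
qed

text \<open>The gradient of the element bubble drops out as well: its three products have the same
  integral, which leaves the sum of the coordinate gradients, the gradient of the constant
  1.\<close>

lemma LINT_nc_grad:
  assumes "proper K"
  shows "(LINT x|lebesgue_on (hull_of K). nc_grad K \<delta> d x $ j) = 0"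
proof -
  obtain Q where Q: "\<And>z. z \<in> verts K \<Longrightarrow>
    (LINT x|lebesgue_on (hull_of K). (\<Prod>y\<in>verts K - {z}. lam K y x)) = (mesh_size K)\<^sup>2 * Q"
    using LINT_lam_product assms by metis
  have "continuous_on UNIV (lam K z)" "continuous_on UNIV (\<lambda>x. \<Prod>y\<in>verts K - {z}. lam K y x)" for z
    by (intro continuous_intros lam_continuous assms)+
  note int = this[THEN hull_integrable]
  have c: "integrable (lebesgue_on (hull_of K)) (\<lambda>x. c)" for c :: real by (rule hull_integrable) simp
  have eq: "nc_grad K \<delta> d x $ j = (\<Sum>z\<in>verts K. (\<delta> z * lam_grad K z $ j) * (6 * lam K z x - 2))
      - d * (\<Sum>z\<in>verts K. lam_grad K z $ j * (\<Prod>y\<in>verts K - {z}. lam K y x))" for x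
    by (simp add: nc_grad_def mult_ac)
  have "(LINT x|lebesgue_on (hull_of K). nc_grad K \<delta> d x $ j) =
      (\<Sum>z\<in>verts K. (\<delta> z * lam_grad K z $ j) * (6 * ((mesh_size K)\<^sup>2 / 3) - (mesh_size K)\<^sup>2 * 2))
      - d * (\<Sum>z\<in>verts K. lam_grad K z $ j * ((mesh_size K)\<^sup>2 * Q))"
    unfolding eq using int c by (simp add: LINT_lam[OF assms] Q measure_on_hull)
  also have "\<dots> = - (d * ((\<Sum>z\<in>verts K. lam_grad K z) $ j * ((mesh_size K)\<^sup>2 * Q)))"
    by (simp add: sum_distrib_right)
  finally show ?thesis by (simp add: lam_grad_sum[OF assms])
qed

section \<open>Pointwise bounds for the local difference and its gradient\<close>

lemma lam_le_1:
  assumes "proper K" "x \<in> hull_of K" "z \<in> verts K"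
  shows "0 \<le> lam K z x" "lam K z x \<le> 1"
proof -
  show 0: "0 \<le> lam K z x" using assms mem_hull_iff by blast
  have "lam K z x \<le> (\<Sum>z\<in>verts K. lam K z x)"
    using assms mem_hull_iff finite_verts by (intro member_le_sum) auto
  then show "lam K z x \<le> 1" using lam_sum[OF assms(1)] by simp
qed

text \<open>On [0, 1] the values range from -1/3 to 1.\<close>

lemma edge_function_bound: "0 \<le> l \<Longrightarrow> l \<le> 1 \<Longrightarrow> \<bar>3 * l\<^sup>2 - 2 * l\<bar> \<le> 1" for l :: real
proof -
  assume l: "0 \<le> l" "l \<le> 1"
  have "3 * l\<^sup>2 - 2 * l - 1 = (l - 1) * (3 * l + 1)" by (simp add: power2_eq_square algebra_simps)
  moreover have "(l - 1) * (3 * l + 1) \<le> 0" using l by (intro mult_nonpos_nonneg) auto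
  moreover have "0 \<le> 3 * (l - 1/3)\<^sup>2" by simp
  then have "0 \<le> 3 * l\<^sup>2 - 2 * l + 1/3" by (simp add: power2_eq_square algebra_simps)
  ultimately show ?thesis by linarith
qed

text \<open>Each integral in the numerator is at most the area, and the denominator is the area
  times \<open>2 * bubble_moment\<close>, so the size of K cancels.\<close>

lemma nc_coef_bound:
  assumes "proper K"
  shows "\<bar>nc_coef K \<delta>\<bar> \<le> (\<Sum>z\<in>verts K. \<bar>\<delta> z\<bar>) / (2 * bubble_moment)"
proof -
  have h: "mesh_size K > 0" by (rule mesh_size_pos[OF assms])
  have I: "\<bar>LINT x|lebesgue_on (hull_of K). 3 * (lam K z x)\<^sup>2 - 2 * lam K z x\<bar> \<le> (mesh_size K)\<^sup>2" if "z \<in> verts K" for z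
  proof -
    have c: "continuous_on UNIV (\<lambda>x. 3 * (lam K z x)\<^sup>2 - 2 * lam K z x)"
      by (intro continuous_intros lam_continuous assms)
    have "\<bar>LINT x|lebesgue_on (hull_of K). 3 * (lam K z x)\<^sup>2 - 2 * lam K z x\<bar>
        \<le> (LINT x|lebesgue_on (hull_of K). \<bar>3 * (lam K z x)\<^sup>2 - 2 * lam K z x\<bar>)"
      by (rule integral_abs_bound)
    also have "\<dots> \<le> (LINT x|lebesgue_on (hull_of K). 1)"
    proof (rule integral_mono)
      show "\<bar>3 * (lam K z x)\<^sup>2 - 2 * lam K z x\<bar> \<le> 1" if "x \<in> space (lebesgue_on (hull_of K))" for x
        using lam_le_1[OF assms _ \<open>z \<in> verts K\<close>, of x] that by (intro edge_function_bound) auto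
    qed (use hull_integrable[OF c] hull_integrable[of "\<lambda>_. 1"] in auto)
    finally show ?thesis by (simp add: measure_on_hull)
  qed
  have "\<bar>\<Sum>z\<in>verts K. \<delta> z * (LINT x|lebesgue_on (hull_of K). 3 * (lam K z x)\<^sup>2 - 2 * lam K z x)\<bar>
      \<le> (\<Sum>z\<in>verts K. \<bar>\<delta> z\<bar> * (mesh_size K)\<^sup>2)"
    using I by (intro order_trans[OF sum_abs] sum_mono) (auto simp: abs_mult intro!: mult_left_mono)
  also have "\<dots> = (\<Sum>z\<in>verts K. \<bar>\<delta> z\<bar>) * (mesh_size K)\<^sup>2" by (simp add: sum_distrib_right)
  finally show ?thesis
    unfolding nc_coef_def LINT_lam_bubble[OF assms] abs_divide
    using h bubble_moment_pos by (simp add: abs_mult field_simps)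
qed

lemma nc_diff_bound:
  assumes "proper K" "x \<in> hull_of K"
  shows "\<bar>nc_diff K \<delta> (nc_coef K \<delta>) x\<bar> \<le> (1 + 1 / (2 * bubble_moment)) * (\<Sum>z\<in>verts K. \<bar>\<delta> z\<bar>)"
proof -
  note l = lam_le_1[OF assms]
  have p: "\<bar>\<Prod>z\<in>verts K. lam K z x\<bar> \<le> 1"
    using l by (simp add: abs_prod) (intro prod_le_1, auto)
  have "\<bar>nc_coef K \<delta> * (\<Prod>z\<in>verts K. lam K z x)\<bar> \<le> (\<Sum>z\<in>verts K. \<bar>\<delta> z\<bar>) / (2 * bubble_moment) * 1"
    unfolding abs_mult using nc_coef_bound[OF assms(1)] p
    by (intro mult_mono) (auto intro: order_trans[OF abs_ge_zero])
  moreover have "\<bar>\<Sum>z\<in>verts K. \<delta> z * (3 * (lam K z x)\<^sup>2 - 2 * lam K z x)\<bar> \<le> (\<Sum>z\<in>verts K. \<bar>\<delta> z\<bar>)"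
    using l edge_function_bound by (intro order_trans[OF sum_abs] sum_mono) (auto simp: abs_mult intro!: mult_left_le)
  ultimately show ?thesis unfolding nc_diff_def by (simp add: algebra_simps)
qed

text \<open>The factor 4 bounds 6 l - 2 for l in [0, 1], and 3 is the number of vertices. The size
  of K enters only through g.\<close>

lemma nc_grad_bound:
  assumes "proper K" "x \<in> hull_of K" and g: "\<And>z. z \<in> verts K \<Longrightarrow> norm (lam_grad K z) \<le> g"
  shows "norm (nc_grad K \<delta> (nc_coef K \<delta>) x) \<le> (4 + 3 / (2 * bubble_moment)) * g * (\<Sum>z\<in>verts K. \<bar>\<delta> z\<bar>)"
proof -
  note l = lam_le_1[OF assms(1,2)]
  define s where "s = (\<Sum>z\<in>verts K. \<bar>\<delta> z\<bar>)"
  have s: "s \<ge> 0" by (simp add: s_def sum_nonneg)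
  obtain z0 where "z0 \<in> verts K" by (cases K) auto
  then have "g \<ge> 0" using g[of z0] norm_ge_zero[of "lam_grad K z0"] by linarith
  have "norm (\<Sum>z\<in>verts K. (\<delta> z * (6 * lam K z x - 2)) *\<^sub>R lam_grad K z) \<le> (\<Sum>z\<in>verts K. \<bar>\<delta> z\<bar> * 4 * g)"
  proof (rule order_trans[OF norm_sum sum_mono])
    fix z assume z: "z \<in> verts K"
    have "\<bar>6 * lam K z x - 2\<bar> \<le> 4" using l[OF z] by auto
    then show "norm ((\<delta> z * (6 * lam K z x - 2)) *\<^sub>R lam_grad K z) \<le> \<bar>\<delta> z\<bar> * 4 * g"
      using g[OF z] by (auto simp: abs_mult intro!: mult_mono)
  qed
  also have "\<dots> = 4 * g * s" by (simp add: s_def sum_distrib_left sum_distrib_right mult_ac)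
  finally have 1: "norm (\<Sum>z\<in>verts K. (\<delta> z * (6 * lam K z x - 2)) *\<^sub>R lam_grad K z) \<le> 4 * g * s" .
  have "norm (\<Sum>z\<in>verts K. (\<Prod>y\<in>verts K - {z}. lam K y x) *\<^sub>R lam_grad K z) \<le> (\<Sum>z\<in>verts K. 1 * g)"
  proof (rule order_trans[OF norm_sum sum_mono])
    fix z assume z: "z \<in> verts K"
    have "\<bar>\<Prod>y\<in>verts K - {z}. lam K y x\<bar> \<le> 1"
      using l by (simp add: abs_prod) (intro prod_le_1, auto)
    then show "norm ((\<Prod>y\<in>verts K - {z}. lam K y x) *\<^sub>R lam_grad K z) \<le> 1 * g"
      using g[OF z] unfolding norm_scaleR real_norm_def by (intro mult_mono) auto
  qed
  also have "\<dots> = 3 * g" using card_verts[OF assms(1)] by simp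
  finally have "norm (nc_coef K \<delta> *\<^sub>R (\<Sum>z\<in>verts K. (\<Prod>y\<in>verts K - {z}. lam K y x) *\<^sub>R lam_grad K z))
      \<le> s / (2 * bubble_moment) * (3 * g)"
    using nc_coef_bound[OF assms(1), of \<delta>] s bubble_moment_pos unfolding norm_scaleR s_def
    by (intro mult_mono) auto
  then show ?thesis
    using 1 norm_triangle_ineq4[of "\<Sum>z\<in>verts K. (\<delta> z * (6 * lam K z x - 2)) *\<^sub>R lam_grad K z"
        "nc_coef K \<delta> *\<^sub>R (\<Sum>z\<in>verts K. (\<Prod>y\<in>verts K - {z}. lam K y x) *\<^sub>R lam_grad K z)"]
    unfolding nc_grad_def s_def[symmetric] by (simp add: algebra_simps)
qed

text \<open>The length of the gradient is that of the opposite side over twice the area, hence of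
  the order of the inverse mesh size.\<close>

lemma lam_grad_bound:
  assumes "proper K" "shape_regular \<kappa> {K}" "z \<in> verts K"
  shows "norm (lam_grad K z) \<le> \<kappa> / (2 * mesh_size K)"
proof -
  obtain a b where ab: "verts K = {z, a, b}" "z \<noteq> a" "a \<noteq> b" "z \<noteq> b" using proper_verts[OF assms(1,3)] .
  note l = lam_verts[OF assms(1) ab]
  have h: "mesh_size K > 0" by (rule mesh_size_pos[OF assms(1)])
  have "(mesh_size K)\<^sup>2 = \<bar>dbl z a b\<bar> / 2"
    by (simp add: measure_hull_of[symmetric] hull_of_eq ab measure_triangle)
  then have "norm (lam_grad K z) = norm (a - b) / (2 * (mesh_size K)\<^sup>2)"
    by (simp add: l norm_bary_grad)
  also have "\<dots> \<le> \<kappa> * mesh_size K / (2 * (mesh_size K)\<^sup>2)"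
    using assms(2) ab by (intro divide_right_mono) (auto simp: shape_regular_def)
  also have "\<dots> = \<kappa> / (2 * mesh_size K)" using h by (simp add: power2_eq_square)
  finally show ?thesis .
qed

section \<open>The conforming companion\<close>

text \<open>The mean value inequality is applied to P minus its linear part at x, whose gradient is
  at most d near x.\<close>

lemma strict_grad_C1:
  assumes der: "\<And>y. (P has_derivative (\<lambda>h. GP y \<bullet> h)) (at y)" and cont: "continuous_on UNIV GP"
    and S: "open S" "x \<in> S" "\<And>y. y \<in> S \<Longrightarrow> W y = P y"
  shows "strict_grad W x (GP x)"
  unfolding strict_grad_def
proof (intro allI impI)
  fix d :: real assume "d > 0"
  obtain r1 where r1: "r1 > 0" "ball x r1 \<subseteq> S" using S open_contains_ball by blast
  have "isCont GP x" using cont by (simp add: continuous_on_eq_continuous_at)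
  then obtain r2 where r2: "r2 > 0" "\<And>y. dist y x < r2 \<Longrightarrow> dist (GP y) (GP x) < d"
    using \<open>d > 0\<close> unfolding continuous_at_eps_delta by blast
  show "\<exists>r>0. \<forall>y\<in>ball x r. \<forall>y'\<in>ball x r. \<bar>W y - W y' - GP x \<bullet> (y - y')\<bar> \<le> d * norm (y - y')"
  proof (intro exI[of _ "min r1 r2"] conjI ballI)
    fix y y' assume y: "y \<in> ball x (min r1 r2)" "y' \<in> ball x (min r1 r2)"
    have "\<bar>(P y - GP x \<bullet> y) - (P y' - GP x \<bullet> y')\<bar> \<le> d * norm (y - y')"
    proof (rule has_derivative_gradient_bound[where l = "\<lambda>y. GP y - GP x" and S = "ball x (min r1 r2)"])
      show "((\<lambda>y. P y - GP x \<bullet> y) has_derivative (\<lambda>h. (GP y - GP x) \<bullet> h)) (at y)" for y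
        unfolding inner_diff_left by (intro derivative_intros der)
      show "norm (GP y - GP x) \<le> d" if "y \<in> ball x (min r1 r2)" for y
        using r2(2)[of y] that by (simp add: dist_norm norm_minus_commute)
    qed (use y in auto)
    moreover have "W y = P y" "W y' = P y'" using y r1 by (auto intro!: S)
    ultimately show "\<bar>W y - W y' - GP x \<bullet> (y - y')\<bar> \<le> d * norm (y - y')"
      by (simp add: inner_diff_right algebra_simps)
  qed (use r1 r2 in auto)
qed

context mesh
begin

definition deviation :: "(tri \<Rightarrow> point \<Rightarrow> real) \<Rightarrow> tri \<Rightarrow> point \<Rightarrow> real" where
  "deviation A K z = A K z - nodal A z"

text \<open>Since 3 l^2 - 2 l = l - 3 l (1 - l), subtracting this from \<open>A K\<close> leaves the
  affine interpolant of the nodal values, plus edge bubbles and a multiple of the element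
  bubble.\<close>

definition diff_poly :: "(tri \<Rightarrow> point \<Rightarrow> real) \<Rightarrow> tri \<Rightarrow> point \<Rightarrow> real" where
  "diff_poly A K = nc_diff K (deviation A K) (nc_coef K (deviation A K))"

definition diff_grad :: "(tri \<Rightarrow> point \<Rightarrow> real) \<Rightarrow> tri \<Rightarrow> point \<Rightarrow> point" where
  "diff_grad A K = nc_grad K (deviation A K) (nc_coef K (deviation A K))"

text \<open>In \<Omega> the piece of an arbitrary triangle containing x is used. By
  \<open>companion_shared\<close> the choice does not matter, and by
  \<open>companion_frontier\<close> the pieces fit the value 0 outside.\<close>

definition companion :: "(tri \<Rightarrow> point \<Rightarrow> real) \<Rightarrow> point \<Rightarrow> real" where
  "companion A x = (if x \<in> \<Omega> then (\<lambda>K. A K x - diff_poly A K x) (SOME K. K \<in> \<T> \<and> x \<in> hull_of K) else 0)"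

text \<open>Zero on the sides of the triangles, a null set. Written as a sum over the mesh with
  indicators of open sets, it is plainly Borel measurable.\<close>

definition companion_grad :: "(tri \<Rightarrow> point \<Rightarrow> real) \<Rightarrow> (tri \<Rightarrow> point) \<Rightarrow> point \<Rightarrow> point" where
  "companion_grad A m x = (\<Sum>K\<in>\<T>. indicator (interior (hull_of K)) x *\<^sub>R (m K - diff_grad A K x))"

lemma cr_affine:
  assumes "crouzeix_raviart A m" "K \<in> \<T>"
  shows "A K x - A K y = m K \<bullet> (x - y)"
  using assms by (simp add: crouzeix_raviart_def)

lemma cr_combination:
  assumes "crouzeix_raviart A m" "K \<in> \<T>" "s + t = 1"
  shows "A K (s *\<^sub>R x + t *\<^sub>R y) = s * A K x + t * A K y"
proof -
  have t: "t = 1 - s" using assms(3) by simp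
  have "A K (s *\<^sub>R x + t *\<^sub>R y) - A K y = m K \<bullet> (s *\<^sub>R x + t *\<^sub>R y - y)"
    by (rule cr_affine[OF assms(1,2)])
  also have "s *\<^sub>R x + t *\<^sub>R y - y = s *\<^sub>R (x - y)" by (simp add: t algebra_simps)
  also have "m K \<bullet> (s *\<^sub>R (x - y)) = s * (A K x - A K y)"
    by (simp add: cr_affine[OF assms(1,2), of x y])
  finally show ?thesis by (simp add: t algebra_simps)
qed

lemma cr_midpoint:
  assumes "crouzeix_raviart A m" "K \<in> \<T>"
  shows "A K (midpoint a b) = (A K a + A K b) / 2"
  using cr_combination[OF assms, of "1/2" "1/2" a b] by (simp add: midpoint_def scaleR_add_right inverse_eq_divide)

text \<open>The right-hand side below is the same for both triangles at an edge; this makes the companion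
  continuous.\<close>

lemma companion_trace:
  assumes cr: "crouzeix_raviart A m" and K: "K \<in> \<T>" "verts K = {a, b, c}" "a \<noteq> b" "b \<noteq> c" "a \<noteq> c"
    and x: "lam K c x = 0"
  shows "A K x - diff_poly A K x =
    nodal A a * (3 * (lam K a x)\<^sup>2 - 2 * lam K a x) + nodal A b * (3 * (lam K b x)\<^sup>2 - 2 * lam K b x)
    + 6 * lam K a x * lam K b x * A K (midpoint a b)"
proof -
  note p = proper_mesh[OF K(1)]
  define s t where "s = lam K a x" and "t = lam K b x"
  have st: "s + t = 1" and xab: "x = s *\<^sub>R a + t *\<^sub>R b"
    using lam_sum[OF p, of x] lam_combination[OF p, of x] K x by (auto simp: s_def t_def)
  have "(\<Prod>z\<in>verts K. lam K z x) = 0" using K x by simp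
  then have d: "diff_poly A K x = (A K a - nodal A a) * (3 * s\<^sup>2 - 2 * s) + (A K b - nodal A b) * (3 * t\<^sup>2 - 2 * t)"
    unfolding diff_poly_def nc_diff_def using K x by (simp add: deviation_def s_def t_def)
  have Ax: "A K x = s * A K a + t * A K b" unfolding xab by (rule cr_combination[OF cr K(1) st])
  have t: "t = 1 - s" using st by simp
  show ?thesis
    unfolding d Ax cr_midpoint[OF cr K(1)] s_def[symmetric] t_def[symmetric]
    unfolding t by (simp add: power2_eq_square field_simps)
qed

lemma frontier_outside: "x \<in> hull_of K \<Longrightarrow> K \<in> \<T> \<Longrightarrow> x \<notin> \<Omega> \<Longrightarrow> x \<in> frontier \<Omega>"
  using hull_subset_closure[of K] openO unfolding frontier_def interior_open[OF openO] by blast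

text \<open>A point of K outside \<Omega> lies on a side of K. It may be a vertex on the frontier,
  where the nodal value is 0. Otherwise \<open>edge_interior\<close> puts the whole side into the
  frontier, so that both nodal values and the midpoint value in \<open>companion_trace\<close>
  vanish.\<close>

lemma companion_frontier:
  assumes cr: "crouzeix_raviart A m" and K: "K \<in> \<T>" and x: "x \<in> hull_of K" "x \<notin> \<Omega>"
  shows "A K x - diff_poly A K x = 0"
proof -
  note p = proper_mesh[OF K]
  have "x \<notin> interior (hull_of K)" using interior_closure_mem[OF _ hull_subset_closure[OF K]] x by blast
  then obtain c where c: "c \<in> verts K" "lam K c x = 0"
    using x(1) by (auto simp: interior_hull_iff[OF p] mem_hull_iff[OF p])
  obtain a b where ab: "verts K = {c, a, b}" "c \<noteq> a" "a \<noteq> b" "c \<noteq> b" using proper_verts[OF p c(1)] .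
  have v: "verts K = {a, b, c}" "a \<noteq> b" "b \<noteq> c" "a \<noteq> c" using ab by auto
  note tr = companion_trace[OF cr K v c(2)]
  have st: "lam K a x + lam K b x = 1" "x = lam K a x *\<^sub>R a + lam K b x *\<^sub>R b"
    using lam_sum[OF p, of x] lam_combination[OF p, of x] v c by auto
  have ge: "lam K a x \<ge> 0" "lam K b x \<ge> 0" using x(1) v by (auto simp: mem_hull_iff[OF p])
  have fr: "x \<in> frontier \<Omega>" by (rule frontier_outside[OF x(1) K x(2)])
  consider "lam K a x = 0" | "lam K b x = 0" | "lam K a x > 0" "lam K b x > 0" using ge by fastforce
  then show ?thesis
  proof cases
    case 1
    then have "lam K b x = 1" "x = b" using st by auto
    then have "nodal A b = 0" using fr by (simp add: nodal_def)
    then show ?thesis using tr 1 by simp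
  next
    case 2
    then have "lam K a x = 1" "x = a" using st by auto
    then have "nodal A a = 0" using fr by (simp add: nodal_def)
    then show ?thesis using tr 2 by simp
  next
    case 3
    have seg: "closed_segment a b \<subseteq> frontier \<Omega>"
      using edge_interior[OF K, of a b x] v x 3 by blast
    then have "nodal A a = 0" "nodal A b = 0" by (auto simp: nodal_def)
    moreover have "A K (midpoint a b) = 0"
      using cr K v seg unfolding crouzeix_raviart_def by (metis insertI1 insertI2)
    ultimately show ?thesis using tr by simp
  qed
qed

text \<open>A point common to two different triangles lies on a side of K. If it is no vertex, the
  side belongs to both triangles, and everything in the formula of \<open>companion_trace\<close> is
  common to both.\<close>

lemma companion_shared:
  assumes cr: "crouzeix_raviart A m" and K: "K \<in> \<T>" "K' \<in> \<T>" and x: "x \<in> hull_of K" "x \<in> hull_of K'"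
  shows "A K x - diff_poly A K x = A K' x - diff_poly A K' x"
proof (cases "K = K'")
  case False
  note p = proper_mesh[OF K(1)] and p' = proper_mesh[OF K(2)]
  note sh = lam_shared[OF K False x]
  obtain c where c: "c \<in> verts K" "lam K c x = 0" using sh(2) by blast
  obtain a b where ab: "verts K = {c, a, b}" "c \<noteq> a" "a \<noteq> b" "c \<noteq> b" using proper_verts[OF p c(1)] .
  have v: "verts K = {a, b, c}" "a \<noteq> b" "b \<noteq> c" "a \<noteq> c" using ab by auto
  have st: "lam K a x + lam K b x = 1"
    using lam_sum[OF p, of x] v c by auto
  note tr = companion_trace[OF cr K(1) v c(2)]
  \<comment> \<open>At a vertex the trace formula reduces to the nodal value, whichever triangle and
    side are used.\<close>
  have one: "A L x - diff_poly A L x = nodal A y" if L: "L \<in> \<T>" "y \<in> verts L" "lam L y x = 1" "x \<in> hull_of L" for L y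
  proof -
    note q = proper_mesh[OF L(1)]
    obtain a b where w: "verts L = {y, a, b}" "y \<noteq> a" "a \<noteq> b" "y \<noteq> b" using proper_verts[OF q L(2)] .
    have "lam L a x \<ge> 0" "lam L b x \<ge> 0" using L(4) w by (auto simp: mem_hull_iff[OF q])
    moreover have "lam L y x + lam L a x + lam L b x = 1" using lam_sum[OF q, of x] w by (simp add: add.assoc)
    ultimately have 0: "lam L a x = 0" "lam L b x = 0" using L(3) by linarith+
    show ?thesis using companion_trace[OF cr L(1) w(1,2,3,4) 0(2)] 0 L(3) by simp
  qed
  consider "lam K a x = 0" | "lam K b x = 0" | "lam K a x \<noteq> 0" "lam K b x \<noteq> 0" by blast
  then show ?thesis
  proof cases
    case 1
    then have "lam K b x = 1" using st by simp
    moreover then have "b \<in> verts K'" using vertex_shared[OF K x, of b] by simp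
    ultimately show ?thesis using one[of K b] one[of K' b] K v x sh(1) by simp
  next
    case 2
    then have "lam K a x = 1" using st by simp
    moreover then have "a \<in> verts K'" using vertex_shared[OF K x, of a] by simp
    ultimately show ?thesis using one[of K a] one[of K' a] K v x sh(1) by simp
  next
    case 3
    have in': "a \<in> verts K'" "b \<in> verts K'" using vertex_shared[OF K x] 3 by blast+
    then obtain c' where v': "verts K' = {a, b, c'}" "b \<noteq> c'" "a \<noteq> c'"
      using proper_verts2[OF p' in' v(2)] by blast
    have "lam K' a x + lam K' b x + lam K' c' x = 1"
      using lam_sum[OF p', of x] v' v(2) by (simp add: add.assoc)
    then have "lam K' c' x = 0" using st sh(1) by simp
    note tr' = companion_trace[OF cr K(2) v'(1) v(2) v'(2,3) this]
    have "A K (midpoint a b) = A K' (midpoint a b)"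
      using cr K v v' unfolding crouzeix_raviart_def by (metis IntI insertI1 insertI2)
    then show ?thesis using tr tr' sh(1) by simp
  qed
qed simp

lemma companion_eq:
  assumes cr: "crouzeix_raviart A m" and K: "K \<in> \<T>" "x \<in> hull_of K"
  shows "companion A x = A K x - diff_poly A K x"
proof (cases "x \<in> \<Omega>")
  case True
  define L where "L = (SOME K. K \<in> \<T> \<and> x \<in> hull_of K)"
  have L: "L \<in> \<T> \<and> x \<in> hull_of L" unfolding L_def by (rule someI[of _ K]) (use K in auto)
  then have "companion A x = A L x - diff_poly A L x" using True by (simp add: companion_def L_def)
  then show ?thesis using companion_shared[OF cr, of L K x] L K by simp
next
  case False
  then show ?thesis using companion_frontier[OF cr K] by (simp add: companion_def)
qed

lemma diff_poly_has_derivative: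
  "K \<in> \<T> \<Longrightarrow> (diff_poly A K has_derivative (\<lambda>h. diff_grad A K x \<bullet> h)) (at x)"
  unfolding diff_poly_def diff_grad_def by (rule nc_diff_has_derivative[OF proper_mesh])

lemma cr_has_derivative:
  assumes "crouzeix_raviart A m" "K \<in> \<T>"
  shows "(A K has_derivative (\<lambda>h. m K \<bullet> h)) (at x)"
proof -
  have eq: "A K = (\<lambda>x. A K 0 + m K \<bullet> x)"
  proof (rule ext)
    show "A K x = A K 0 + m K \<bullet> x" for x using cr_affine[OF assms, of x 0] by (simp only: diff_zero)
  qed
  have "((\<lambda>x. A K 0 + m K \<bullet> x) has_derivative (\<lambda>h. m K \<bullet> h)) (at x)"
    by (auto intro!: derivative_eq_intros)
  then show ?thesis by (simp only: eq[symmetric])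
qed

lemma companion_piece_derivative:
  assumes "crouzeix_raviart A m" "K \<in> \<T>"
  shows "((\<lambda>x. A K x - diff_poly A K x) has_derivative (\<lambda>h. (m K - diff_grad A K x) \<bullet> h)) (at x)"
  unfolding inner_diff_left
  by (intro has_derivative_diff cr_has_derivative[OF assms] diff_poly_has_derivative[OF assms(2)])

lemma companion_piece_grad_continuous: "K \<in> \<T> \<Longrightarrow> continuous_on S (\<lambda>x. m K - diff_grad A K x)"
  unfolding diff_grad_def by (intro continuous_intros nc_grad_continuous proper_mesh)

lemma companion_piece_grad_bounded:
  "\<exists>B\<ge>0. \<forall>K\<in>\<T>. \<forall>x\<in>hull_of K. norm (m K - diff_grad A K x) \<le> B"
proof -
  have "\<exists>B\<ge>0. \<forall>x\<in>hull_of K. norm (m K - diff_grad A K x) \<le> B" if "K \<in> \<T>" for K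
    using compact_imp_bounded[OF compact_continuous_image[OF companion_piece_grad_continuous[OF that] compact_hull_of]]
    unfolding bounded_pos by (metis imageI less_imp_le)
  then obtain B where B: "\<And>K. K \<in> \<T> \<Longrightarrow> B K \<ge> 0" "\<And>K x. K \<in> \<T> \<Longrightarrow> x \<in> hull_of K \<Longrightarrow> norm (m K - diff_grad A K x) \<le> B K"
    by metis
  have "B K \<le> (\<Sum>K\<in>\<T>. B K)" if "K \<in> \<T>" for K
    using that B finite_mesh by (intro member_le_sum) auto
  then have "\<forall>K\<in>\<T>. \<forall>x\<in>hull_of K. norm (m K - diff_grad A K x) \<le> (\<Sum>K\<in>\<T>. B K)"
    using B(2) order_trans by blast
  moreover have "(\<Sum>K\<in>\<T>. B K) \<ge> 0" using B(1) by (rule sum_nonneg)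
  ultimately show ?thesis by blast
qed

text \<open>Triangles are convex, so the gradient bound B is a Lipschitz constant on each, and
  outside \<Omega> the companion is 0. A segment is covered by finitely many closed sets on which
  this constant is valid, so it is valid along the segment.\<close>

lemma companion_Lipschitz:
  assumes cr: "crouzeix_raviart A m"
  shows "\<exists>L\<ge>0. \<forall>x y. \<bar>companion A x - companion A y\<bar> \<le> L * norm (x - y)"
proof -
  obtain B where B: "B \<ge> 0" "\<And>K x. K \<in> \<T> \<Longrightarrow> x \<in> hull_of K \<Longrightarrow> norm (m K - diff_grad A K x) \<le> B"
    using companion_piece_grad_bounded by blast
  have piece: "\<bar>companion A x - companion A y\<bar> \<le> B * norm (x - y)" if "K \<in> \<T>" "x \<in> hull_of K" "y \<in> hull_of K" for K x y
    using has_derivative_gradient_bound[OF companion_piece_derivative[OF cr that(1)] convex_hull_of[of K] B(2)[OF that(1)] that(2,3)]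
    by (simp add: companion_eq[OF cr that(1)] that)
  have "\<bar>companion A x - companion A y\<bar> \<le> B * norm (x - y)" for x y
  proof -
    define l where "l = (\<lambda>t::real. (1 - t) *\<^sub>R x + t *\<^sub>R y)"
    have l: "continuous_on UNIV l" unfolding l_def by (intro continuous_intros)
    have ld: "l s - l t = (s - t) *\<^sub>R (y - x)" for s t by (simp add: l_def algebra_simps)
    \<comment> \<open>\<open>None\<close> stands for the complement of \<Omega>,
      \<open>Some K\<close> for the triangle K.\<close>
    define U where "U = (\<lambda>i. case i of None \<Rightarrow> l -` (- \<Omega>) | Some K \<Rightarrow> l -` hull_of K)"
    have "(B * norm (x - y))-lipschitz_on {0..1} (\<lambda>t. companion A (l t))"
    proof (rule lipschitz_on_closed_Union[where U = U and I = "insert None (Some ` \<T>)"])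
      show "(B * norm (x - y))-lipschitz_on (U i) (\<lambda>t. companion A (l t))" if "i \<in> insert None (Some ` \<T>)" for i
      proof (rule lipschitz_onI)
        fix s t assume st: "s \<in> U i" "t \<in> U i"
        show "dist (companion A (l s)) (companion A (l t)) \<le> B * norm (x - y) * dist s t"
        proof (cases i)
          case None
          then show ?thesis using st B by (auto simp: U_def companion_def)
        next
          case (Some K)
          then have "\<bar>companion A (l s) - companion A (l t)\<bar> \<le> B * norm (l s - l t)"
            using st that by (intro piece) (auto simp: U_def)
          then show ?thesis by (simp add: ld dist_norm norm_minus_commute mult_ac)
        qed
      qed (use B in auto)
      show "closed (U i)" if "i \<in> insert None (Some ` \<T>)" for i
      proof (cases i)
        case None
        then show ?thesis using openO by (simp add: U_def closed_vimage l closed_Compl)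
      next
        case (Some K)
        then show ?thesis by (simp add: U_def closed_vimage l closed_hull_of)
      qed
      show "finite (insert None (Some ` \<T>))" using finite_mesh by simp
      show "0 \<le> B * norm (x - y)" using B by simp
      show "{0..1} \<subseteq> (\<Union>i\<in>insert None (Some ` \<T>). U i)"
      proof
        fix t :: real
        show "t \<in> (\<Union>i\<in>insert None (Some ` \<T>). U i)"
        proof (cases "l t \<in> \<Omega>")
          case True
          then obtain K where "K \<in> \<T>" "l t \<in> hull_of K" using union_mesh closure_subset by blast
          then show ?thesis by (auto simp: U_def)
        qed (auto simp: U_def)
      qed
    qed
    from lipschitz_onD[OF this, of 0 1] show ?thesis by (simp add: l_def dist_norm)
  qed
  then show ?thesis using B(1) by blast
qed

lemma companion_grad_eq:
  assumes "K \<in> \<T>" "x \<in> interior (hull_of K)"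
  shows "companion_grad A m x = m K - diff_grad A K x"
proof -
  have "indicator (interior (hull_of L)) x *\<^sub>R (m L - diff_grad A L x) = (if L = K then m K - diff_grad A K x else 0)"
    if "L \<in> \<T>" for L
    using interior_hull_unique[OF assms(1) that assms(2)] interior_subset[of "hull_of L"] assms
    by (auto simp: indicator_def)
  then have "companion_grad A m x = (\<Sum>L\<in>\<T>. if L = K then m K - diff_grad A K x else 0)"
    unfolding companion_grad_def by (intro sum.cong) auto
  then show ?thesis using assms(1) finite_mesh by simp
qed

lemma companion_strict_grad:
  assumes cr: "crouzeix_raviart A m" and K: "K \<in> \<T>" "x \<in> interior (hull_of K)"
  shows "strict_grad (companion A) x (companion_grad A m x)"
  unfolding companion_grad_eq[OF K]
proof (rule strict_grad_C1[where P = "\<lambda>x. A K x - diff_poly A K x" and GP = "\<lambda>x. m K - diff_grad A K x"])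
  show "companion A y = A K y - diff_poly A K y" if "y \<in> interior (hull_of K)" for y
    using companion_eq[OF cr K(1), of y] that interior_subset[of "hull_of K"] by blast
qed (use K in \<open>auto intro: companion_piece_derivative[OF cr K(1)] companion_piece_grad_continuous\<close>)

lemma O_lmeasurable: "\<Omega> \<in> lmeasurable"
  using openO boundedO by (simp add: lmeasurable_open)

lemma O_sets: "\<Omega> \<in> sets lebesgue"
  using O_lmeasurable by auto

lemma interior_hull_AE: "AE x in lebesgue_on \<Omega>. \<exists>K\<in>\<T>. x \<in> interior (hull_of K)"
proof -
  have "negligible (\<Union>K\<in>\<T>. frontier (hull_of K))"
    using finite_mesh negligible_convex_frontier[OF convex_hull_of] by (intro negligible_Union) auto
  then have "AE x in lebesgue. x \<notin> (\<Union>K\<in>\<T>. frontier (hull_of K))"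
    by (intro AE_not_in) (simp add: negligible_iff_null_sets)
  then have "AE x in lebesgue. x \<in> \<Omega> \<longrightarrow> (\<exists>K\<in>\<T>. x \<in> interior (hull_of K))"
  proof eventually_elim
    case (elim x)
    show ?case
    proof
      assume "x \<in> \<Omega>"
      then obtain K where K: "K \<in> \<T>" "x \<in> hull_of K" using union_mesh closure_subset by blast
      then have "x \<notin> frontier (hull_of K)" using elim by blast
      then show "\<exists>K\<in>\<T>. x \<in> interior (hull_of K)" using K closed_hull_of[of K] by (auto simp: frontier_def)
    qed
  qed
  then show ?thesis using O_sets by (simp add: AE_restrict_space_iff)
qed

lemma companion_grad_measurable:
  "(\<lambda>x. companion_grad A m x) \<in> borel_measurable borel"
proof -
  have "(\<lambda>x. indicator (interior (hull_of K)) x *\<^sub>R (m K - diff_grad A K x)) \<in> borel_measurable borel" if "K \<in> \<T>" for K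
    by (intro borel_measurable_scaleR borel_measurable_indicator borel_measurable_continuous_onI
        companion_piece_grad_continuous[OF that]) auto
  then show ?thesis unfolding companion_grad_def by (intro borel_measurable_sum) auto
qed

lemma companion_grad_bounded: "\<exists>B. \<forall>x. norm (companion_grad A m x) \<le> B"
proof -
  obtain B where B: "B \<ge> 0" "\<And>K x. K \<in> \<T> \<Longrightarrow> x \<in> hull_of K \<Longrightarrow> norm (m K - diff_grad A K x) \<le> B"
    using companion_piece_grad_bounded by blast
  have "norm (companion_grad A m x) \<le> B" for x
  proof (cases "\<exists>K\<in>\<T>. x \<in> interior (hull_of K)")
    case True
    then obtain K where K: "K \<in> \<T>" "x \<in> interior (hull_of K)" by blast
    then show ?thesis using B(2)[OF K(1), of x] interior_subset[of "hull_of K"] by (auto simp: companion_grad_eq[OF K])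
  next
    case False
    then have "companion_grad A m x = (\<Sum>K\<in>\<T>. 0)"
      unfolding companion_grad_def by (intro sum.cong) auto
    then show ?thesis using B by simp
  qed
  then show ?thesis by blast
qed

lemma companion_V_space:
  assumes cr: "\<And>i. crouzeix_raviart (A i) (m i)"
  defines "W \<equiv> (\<lambda>x. \<chi> i. companion (A i) x) :: vfield" and "G \<equiv> (\<lambda>x. \<chi> i. companion_grad (A i) (m i) x) :: tensor_field"
  shows "W \<in> V_space \<Omega>" "weak_gradient \<Omega> W G"
proof -
  have "\<exists>L\<ge>0. \<forall>x y. \<bar>companion (A i) x - companion (A i) y\<bar> \<le> L * norm (x - y)" for i
    by (rule companion_Lipschitz[OF cr])
  then obtain L where L: "\<And>i. L i \<ge> 0" "\<And>i x y. \<bar>companion (A i) x - companion (A i) y\<bar> \<le> L i * norm (x - y)"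
    by metis
  have "\<bar>W x $ i - W y $ i\<bar> \<le> (\<Sum>i\<in>UNIV. L i) * norm (x - y)" for i x y
  proof -
    have "L i \<le> (\<Sum>i\<in>UNIV. L i)" using L by (intro member_le_sum) auto
    then have "L i * norm (x - y) \<le> (\<Sum>i\<in>UNIV. L i) * norm (x - y)" by (rule mult_right_mono) simp
    then show ?thesis using L(2)[of i x y] by (simp add: W_def)
  qed
  moreover have "W x = 0" if "x \<notin> \<Omega>" for x
    using that by (simp add: W_def companion_def vec_eq_iff)
  moreover have "L2 \<Omega> G"
  proof -
    have "\<exists>B. \<forall>x. norm (companion_grad (A i) (m i) x) \<le> B" for i by (rule companion_grad_bounded)
    then obtain B where B: "\<And>i x. norm (companion_grad (A i) (m i) x) \<le> B i" by metis
    have "G \<in> borel_measurable borel"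
      unfolding borel_measurable_euclidean_space[of G]
      by (auto simp: Basis_vec_def[where 'a = point] G_def inner_axis intro!: borel_measurable_inner companion_grad_measurable)
    then have "G \<in> borel_measurable (lebesgue_on \<Omega>)"
      by (intro measurable_restrict_space1 measurable_completion) simp
    moreover have "norm (G x) \<le> (\<Sum>i\<in>UNIV. B i)" for x
      by (rule order_trans[OF norm_vec_le_sum sum_mono]) (simp add: G_def B)
    ultimately show ?thesis by (intro L2_bounded[OF O_lmeasurable])
  qed
  moreover have "AE x in lebesgue_on \<Omega>. \<forall>i. strict_grad (\<lambda>x. W x $ i) x (G x $ i)"
    using interior_hull_AE
    by eventually_elim (auto simp: W_def G_def intro: companion_strict_grad[OF cr])
  ultimately show "W \<in> V_space \<Omega>" "weak_gradient \<Omega> W G"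
    using V_space_Lipschitz[OF openO boundedO, of W "\<Sum>i\<in>UNIV. L i" G] by blast+
qed

end

section \<open>Integrals over the elements\<close>

text \<open>Serves to pass from \<Omega> to the union of the triangles, and from a triangle to its
  interior and back.\<close>

lemma LINT_null_change:
  fixes f :: "point \<Rightarrow> 'b::euclidean_space"
  assumes U: "U \<in> sets lebesgue" "U' \<in> sets lebesgue" and ae: "AE x in lebesgue. x \<in> U \<longleftrightarrow> x \<in> U'"
    and f: "f \<in> borel_measurable (lebesgue_on U)"
  shows "f \<in> borel_measurable (lebesgue_on U')"
    and "(LINT x|lebesgue_on U. f x) = (LINT x|lebesgue_on U'. f x)"
    and "integrable (lebesgue_on U) f \<Longrightarrow> integrable (lebesgue_on U') f"
proof -
  have eq: "AE x in lebesgue. indicator U x *\<^sub>R f x = indicator U' x *\<^sub>R f x"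
    using ae by eventually_elim (auto simp: indicator_def)
  have mU: "(\<lambda>x. indicator U x *\<^sub>R f x) \<in> borel_measurable lebesgue"
    using f U by (simp add: borel_measurable_restrict_space_iff)
  then have mU': "(\<lambda>x. indicator U' x *\<^sub>R f x) \<in> borel_measurable lebesgue"
    using eq by (rule borel_measurable_AE)
  then show "f \<in> borel_measurable (lebesgue_on U')" using U by (simp add: borel_measurable_restrict_space_iff)
  show "(LINT x|lebesgue_on U. f x) = (LINT x|lebesgue_on U'. f x)"
    unfolding LINT_lebesgue_on[OF U(1)] LINT_lebesgue_on[OF U(2)]
    by (rule integral_cong_AE[OF mU mU' eq])
  show "integrable (lebesgue_on U') f" if "integrable (lebesgue_on U) f"
  proof -
    have "integrable lebesgue (\<lambda>x. indicator U x *\<^sub>R f x)" using that U by (simp add: integrable_restrict_space)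
    then have "integrable lebesgue (\<lambda>x. indicator U' x *\<^sub>R f x)"
      using integrable_cong_AE[OF mU mU' eq] by blast
    then show ?thesis using U by (simp add: integrable_restrict_space)
  qed
qed

lemma L2_null_change:
  assumes "U \<in> sets lebesgue" "U' \<in> sets lebesgue" "AE x in lebesgue. x \<in> U \<longleftrightarrow> x \<in> U'" "L2 U f"
  shows "L2 U' f"
proof -
  have "(\<lambda>x. (norm (f x))\<^sup>2) \<in> borel_measurable (lebesgue_on U)"
    using L2_square_integrable[OF assms(4)] by auto
  then show ?thesis
    unfolding L2_def using LINT_null_change(1)[OF assms(1-3) L2_measurable[OF assms(4)]]
      LINT_null_change(3)[OF assms(1-3) _ L2_square_integrable[OF assms(4)]] by blast
qed

lemma L2_cong_AE:
  assumes U: "U \<in> sets lebesgue" and f: "L2 U f" and ae: "AE x in lebesgue_on U. f x = g x"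
  shows "L2 U g"
proof -
  have "AE x in lebesgue. indicator U x *\<^sub>R f x = indicator U x *\<^sub>R g x"
    using ae U by (auto simp: AE_restrict_space_iff indicator_def elim: eventually_mono)
  moreover have "(\<lambda>x. indicator U x *\<^sub>R f x) \<in> borel_measurable lebesgue"
    using L2_measurable[OF f] U by (simp add: borel_measurable_restrict_space_iff)
  ultimately have "(\<lambda>x. indicator U x *\<^sub>R g x) \<in> borel_measurable lebesgue" by (rule borel_measurable_AE[rotated])
  then have g: "g \<in> borel_measurable (lebesgue_on U)" using U by (simp add: borel_measurable_restrict_space_iff)
  moreover have "integrable (lebesgue_on U) (\<lambda>x. (norm (g x))\<^sup>2)"
    by (rule integrable_cong_AE_imp[OF L2_square_integrable[OF f]])
       (use g ae in \<open>auto elim: eventually_mono\<close>)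
  ultimately show ?thesis by (simp add: L2_def)
qed

text \<open>Cauchy-Schwarz against the constant 1, obtained from Young's inequality with a nearly
  optimal parameter.\<close>

lemma hull_L1_le_L2:
  assumes K: "proper K" and f: "L2 (hull_of K) f"
  shows "(LINT x|lebesgue_on (hull_of K). norm (f x)) \<le> mesh_size K * l2norm (hull_of K) f"
proof -
  define h a where "h = mesh_size K" and "a = l2norm (hull_of K) f"
  have h: "h > 0" unfolding h_def by (rule mesh_size_pos[OF K])
  have a0: "a \<ge> 0" by (simp add: a_def l2norm_nonneg)
  have i1: "integrable (lebesgue_on (hull_of K)) (\<lambda>x. norm (f x))"
    using L2_integrable[OF hull_of_lmeasurable f] by simp
  have *: "(LINT x|lebesgue_on (hull_of K). norm (f x)) \<le> h * a + e * h" if e: "e > 0" for e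
  proof -
    \<comment> \<open>The optimal parameter is a / h; e > 0 keeps t positive when the norm a is 0,
      and it is removed at the end.\<close>
    define t where "t = (a + e) / h"
    have t: "t > 0" using h a0 e by (simp add: t_def)
    have le: "norm (f x) \<le> t / 2 * 1 + 1 / (2 * t) * (norm (f x))\<^sup>2" for x
    proof -
      have "0 \<le> (norm (f x) - t)\<^sup>2" by simp
      then have "2 * t * norm (f x) \<le> t\<^sup>2 + (norm (f x))\<^sup>2" by (simp add: power2_diff mult_ac)
      then show ?thesis using t by (simp add: field_simps power2_eq_square)
    qed
    have i2: "integrable (lebesgue_on (hull_of K)) (\<lambda>x. t / 2 * 1 + 1 / (2 * t) * (norm (f x))\<^sup>2)"
      using L2_square_integrable[OF f] hull_integrable[of "\<lambda>_. t / 2 * 1" K] by simp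
    have "(LINT x|lebesgue_on (hull_of K). norm (f x)) \<le>
        (LINT x|lebesgue_on (hull_of K). t / 2 * 1 + 1 / (2 * t) * (norm (f x))\<^sup>2)"
      by (rule integral_mono[OF i1 i2 le])
    also have "\<dots> = t / 2 * h\<^sup>2 + 1 / (2 * t) * a\<^sup>2"
      using L2_square_integrable[OF f] hull_integrable[of "\<lambda>_. t / 2" K]
      by (simp add: measure_on_hull h_def a_def l2norm_square)
    also have "\<dots> \<le> t / 2 * h\<^sup>2 + 1 / (2 * t) * (a + e)\<^sup>2"
      using t a0 e by (intro add_left_mono mult_left_mono power_mono) auto
    also have "\<dots> = h * a + e * h"
    proof -
      have "t / 2 * h\<^sup>2 = (a + e) * h / 2" using h by (simp add: t_def power2_eq_square)
      moreover have "1 / (2 * t) * (a + e)\<^sup>2 = (a + e) * h / 2"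
      proof -
        have "1 / (2 * (b / h)) * b\<^sup>2 = b * h / 2" if "b > 0" for b
          using that h by (simp add: field_simps power2_eq_square)
        then show ?thesis unfolding t_def using a0 e by (metis add_nonneg_pos)
      qed
      ultimately have "t / 2 * h\<^sup>2 + 1 / (2 * t) * (a + e)\<^sup>2 = (a + e) * h / 2 + (a + e) * h / 2"
        by (simp only:)
      also have "\<dots> = h * a + e * h" by (simp add: algebra_simps)
      finally show ?thesis .
    qed
    finally show ?thesis .
  qed
  show ?thesis
  proof (rule field_le_epsilon)
    fix e :: real assume "e > 0"
    then show "(LINT x|lebesgue_on (hull_of K). norm (f x)) \<le> mesh_size K * l2norm (hull_of K) f + e"
      using *[of "e / h"] h by (simp add: h_def a_def)
  qed
qed

lemma weak_gradient_cong:
  assumes "U \<in> sets lebesgue" "weak_gradient U v G" "L2 U G'" "\<And>x. x \<in> U \<Longrightarrow> G x = G' x"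
  shows "weak_gradient U v G'"
  unfolding weak_gradient_def
proof (intro conjI allI impI)
  fix \<phi> i j assume \<phi>: "test_fun U \<phi>"
  have "(LINT x|lebesgue_on U. G x $ i $ j * \<phi> x) = (LINT x|lebesgue_on U. G' x $ i $ j * \<phi> x)"
    by (rule Bochner_Integration.integral_cong) (use assms in auto)
  then show "(LINT x|lebesgue_on U. v x $ i * pderiv_at j \<phi> x) = - (LINT x|lebesgue_on U. G' x $ i $ j * \<phi> x)"
    using assms(2) \<phi> by (simp add: weak_gradient_def)
qed (fact assms)

text \<open>A test function on U' is one on U, and outside U' it vanishes together with its
  derivatives.\<close>

lemma weak_gradient_subset:
  assumes U: "open U" "open U'" "U' \<subseteq> U" and G: "weak_gradient U v G"
  shows "weak_gradient U' v G"
  unfolding weak_gradient_def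
proof (intro conjI allI impI)
  show "L2 U' G" using G U by (auto simp: weak_gradient_def intro: L2_subset)
  fix \<phi> i j assume \<phi>: "test_fun U' \<phi>"
  then have \<phi>': "test_fun U \<phi>" using U by (auto simp: test_fun_def)
  have z: "\<phi> x = 0" "pderiv_at j \<phi> x = 0" if "x \<notin> U'" for x
  proof -
    define S where "S = closure {x. \<phi> x \<noteq> 0}"
    have S: "closed S" "S \<subseteq> U'" using \<phi> by (auto simp: S_def test_fun_def)
    have 0: "\<phi> y = 0" if "y \<notin> S" for y
      using that closure_subset[of "{x. \<phi> x \<noteq> 0}", folded S_def] by auto
    show "\<phi> x = 0" using 0 S that by blast
    show "pderiv_at j \<phi> x = 0"
      by (rule grd_zero_outside[of "- S"]) (use S that 0 in \<open>auto simp: open_Compl\<close>)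
  qed
  have "(LINT x|lebesgue_on U. v x $ i * pderiv_at j \<phi> x) = - (LINT x|lebesgue_on U. G x $ i $ j * \<phi> x)"
    using G \<phi>' by (simp add: weak_gradient_def)
  then show "(LINT x|lebesgue_on U'. v x $ i * pderiv_at j \<phi> x) = - (LINT x|lebesgue_on U'. G x $ i $ j * \<phi> x)"
    using LINT_subset[of U U' "\<lambda>x. v x $ i * pderiv_at j \<phi> x"] LINT_subset[of U U' "\<lambda>x. G x $ i $ j * \<phi> x"] U z
    by auto
qed

lemma weak_gradient_affine:
  fixes M :: "real^2^2"
  assumes U: "open U" "bounded U" and v: "L2 U v" "AE x in lebesgue_on U. v x = M *v x + c"
  shows "weak_gradient U v (\<lambda>_. M)"
  unfolding weak_gradient_def
proof (intro conjI allI impI)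
  have Um: "U \<in> lmeasurable" using U by (simp add: lmeasurable_open)
  then show "L2 U (\<lambda>_. M)" by (rule L2_const)
  fix \<phi> i j assume \<phi>: "test_fun U \<phi>"
  define f where "f = (\<lambda>x. M $ i \<bullet> x + c $ i)"
  have der: "(f has_derivative (\<lambda>h. M $ i \<bullet> h)) (at x)" for x
    unfolding f_def by (auto intro!: derivative_eq_intros)
  have grd: "grd f = (\<lambda>_. M $ i)" using grd_eq[OF der] by blast
  have pd: "pderiv_at j f x = M $ i $ j" for x using arg_cong[OF grd, of "\<lambda>g. g x $ j"] by (simp add: grd_def)
  have cf: "continuous_on UNIV f" unfolding f_def by (intro continuous_intros)
  have cp: "continuous_on UNIV (pderiv_at j \<phi>)" by (rule smooth_continuous[OF smooth_pderiv[OF test_fun_smooth[OF \<phi>]]])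
  have "(LINT x|lebesgue_on U. v x $ i * pderiv_at j \<phi> x) = (LINT x|lebesgue_on U. f x * pderiv_at j \<phi> x)"
  proof (rule integral_cong_AE)
    show "(\<lambda>x. v x $ i * pderiv_at j \<phi> x) \<in> borel_measurable (lebesgue_on U)"
      by (intro borel_measurable_integrable[OF L2_times_integrable] L2_nth v test_fun_L2[OF \<phi> Um])
    show "(\<lambda>x. f x * pderiv_at j \<phi> x) \<in> borel_measurable (lebesgue_on U)"
      using Um by (intro continuous_imp_measurable_on_sets_lebesgue continuous_on_mult continuous_on_subset[OF cf]
          continuous_on_subset[OF cp]) auto
    show "AE x in lebesgue_on U. v x $ i * pderiv_at j \<phi> x = f x * pderiv_at j \<phi> x"
      using v(2) by eventually_elim (simp add: f_def matrix_mult_dot)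
  qed
  also have "\<dots> = - (LINT x|lebesgue_on U. pderiv_at j f x * \<phi> x)"
  proof (rule LINT_product_rule[OF _ _ \<phi>])
    show "f differentiable at x" for x using der unfolding differentiable_def by blast
  qed (use Um in \<open>auto simp: grd\<close>)
  finally show "(LINT x|lebesgue_on U. v x $ i * pderiv_at j \<phi> x) = - (LINT x|lebesgue_on U. M $ i $ j * \<phi> x)"
    by (simp add: pd)
qed

context mesh
begin

lemma interior_subset_O: "K \<in> \<T> \<Longrightarrow> interior (hull_of K) \<subseteq> \<Omega>"
  using interior_closure_mem hull_subset_closure by blast

lemma hull_interior_AE: "AE x in lebesgue. x \<in> interior (hull_of K) \<longleftrightarrow> x \<in> hull_of K"
proof -
  have "AE x in lebesgue. x \<notin> frontier (hull_of K)"
    by (intro AE_not_in) (use negligible_convex_frontier[OF convex_hull_of[of K]] in \<open>simp add: negligible_iff_null_sets\<close>)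
  then show ?thesis
    by eventually_elim (use interior_subset closed_hull_of[of K] in \<open>auto simp: frontier_def\<close>)
qed

lemma AE_hull_interior:
  "(AE x in lebesgue_on (hull_of K). P x) \<longleftrightarrow> (AE x in lebesgue_on (interior (hull_of K)). P x)"
proof -
  have "(AE x in lebesgue. x \<in> hull_of K \<longrightarrow> P x) \<longleftrightarrow> (AE x in lebesgue. x \<in> interior (hull_of K) \<longrightarrow> P x)"
    using hull_interior_AE[of K] by (intro iffI; elim AE_mp[OF hull_interior_AE[of K]] AE_mp; intro AE_I2) auto
  then show ?thesis using hull_of_sets[of K] by (simp add: AE_restrict_space_iff)
qed

lemma AE_hull_of_O:
  assumes "K \<in> \<T>" "AE x in lebesgue_on \<Omega>. P x"
  shows "AE x in lebesgue_on (hull_of K). P x"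
  unfolding AE_hull_interior using assms(2) O_sets interior_subset_O[OF assms(1)]
  by (auto simp: AE_restrict_space_iff elim!: eventually_mono)

lemma AE_O_of_hull:
  assumes "\<And>K. K \<in> \<T> \<Longrightarrow> AE x in lebesgue_on (hull_of K). P x"
  shows "AE x in lebesgue_on \<Omega>. P x"
proof -
  have "AE x in lebesgue. x \<in> hull_of K \<longrightarrow> P x" if "K \<in> \<T>" for K
    using assms[OF that] hull_of_sets[of K] by (simp add: AE_restrict_space_iff)
  then have "AE x in lebesgue. \<forall>K\<in>\<T>. x \<in> hull_of K \<longrightarrow> P x"
    using finite_mesh by (subst AE_ball_countable) (auto intro: countable_finite)
  then have "AE x in lebesgue. x \<in> \<Omega> \<longrightarrow> P x"
    by eventually_elim (use union_mesh closure_subset in blast)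
  then show ?thesis using O_sets by (simp add: AE_restrict_space_iff)
qed

lemma L2_interior_hull:
  "L2 (interior (hull_of K)) f \<longleftrightarrow> L2 (hull_of K) f"
proof -
  have ae: "AE x in lebesgue. x \<in> hull_of K \<longleftrightarrow> x \<in> interior (hull_of K)"
    using hull_interior_AE[of K] by eventually_elim auto
  have s: "interior (hull_of K) \<in> sets lebesgue" by simp
  show ?thesis
    using L2_null_change[OF s hull_of_sets hull_interior_AE] L2_null_change[OF hull_of_sets s ae] by blast
qed

lemma L2_hull:
  assumes "K \<in> \<T>" "L2 \<Omega> f"
  shows "L2 (hull_of K) f"
  using L2_subset[OF assms(2) interior_subset_O[OF assms(1)] _ O_sets] by (simp add: L2_interior_hull)

lemma O_closure_AE: "AE x in lebesgue. x \<in> \<Omega> \<longleftrightarrow> x \<in> (\<Union>K\<in>\<T>. hull_of K)"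
proof -
  have "AE x in lebesgue. \<forall>K\<in>\<T>. x \<in> interior (hull_of K) \<longleftrightarrow> x \<in> hull_of K"
    using finite_mesh hull_interior_AE by (subst AE_ball_countable) (auto intro: countable_finite)
  then show ?thesis
    by eventually_elim (use interior_subset_O union_mesh closure_subset in blast)
qed

text \<open>\<Omega> and the union of the triangles differ by a null set, and different triangles
  overlap in null sets.\<close>

lemma LINT_mesh:
  fixes f :: "point \<Rightarrow> real"
  assumes f: "integrable (lebesgue_on \<Omega>) f"
  shows "(LINT x|lebesgue_on \<Omega>. f x) = (\<Sum>K\<in>\<T>. LINT x|lebesgue_on (hull_of K). f x)"
    and "K \<in> \<T> \<Longrightarrow> integrable (lebesgue_on (hull_of K)) f"
proof -
  define C where "C = (\<Union>K\<in>\<T>. hull_of K)"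
  have C: "C \<in> sets lebesgue" unfolding C_def using finite_mesh hull_of_sets by (intro sets.finite_UN) auto
  note ch = LINT_null_change[OF O_sets C O_closure_AE[folded C_def] borel_measurable_integrable[OF f]]
  have iC: "set_integrable lebesgue C f"
    using ch(3)[OF f] C by (simp add: set_integrable_def integrable_restrict_space)
  have iK: "set_integrable lebesgue (hull_of K) f" if "K \<in> \<T>" for K
    by (rule set_integrable_subset[OF iC hull_of_sets]) (use that in \<open>auto simp: C_def\<close>)
  then show "K \<in> \<T> \<Longrightarrow> integrable (lebesgue_on (hull_of K)) f"
    using hull_of_sets by (simp add: set_integrable_def integrable_restrict_space)
  have "(LINT x:C|lebesgue. f x) = (\<Sum>K\<in>\<T>. LINT x:hull_of K|lebesgue. f x)"
    unfolding C_def
  proof (rule set_integral_finite_UN_AE[OF finite_mesh _ _ iK])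
    fix K K' assume K: "K \<in> \<T>" "K' \<in> \<T>"
    show "AE x in lebesgue. x \<in> hull_of K \<and> x \<in> hull_of K' \<longrightarrow> K = K'"
    proof (cases "K = K'")
      case False
      have "AE x in lebesgue. x \<notin> hull_of K \<inter> hull_of K'"
        by (intro AE_not_in) (use hull_Int_negligible[OF K False] in \<open>simp add: negligible_iff_null_sets\<close>)
      then show ?thesis by eventually_elim auto
    qed simp
  qed (auto simp: hull_of_sets)
  then show "(LINT x|lebesgue_on \<Omega>. f x) = (\<Sum>K\<in>\<T>. LINT x|lebesgue_on (hull_of K). f x)"
    unfolding ch(2) LINT_lebesgue_on[OF C] LINT_lebesgue_on[OF hull_of_sets] set_lebesgue_integral_def .
qed

lemma l2norm_mesh:
  assumes "L2 \<Omega> f"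
  shows "(l2norm \<Omega> f)\<^sup>2 = (\<Sum>K\<in>\<T>. (l2norm (hull_of K) f)\<^sup>2)"
  unfolding l2norm_square by (rule LINT_mesh(1)[OF L2_square_integrable[OF assms]])

section \<open>Piecewise affine functions\<close>

text \<open>By continuity A vanishes on the interior of the triangle. Any other point is joined to
  the centroid by a line along which A is affine and vanishes near the centroid.\<close>

lemma affine_field_zero:
  assumes K: "proper K" and A: "affine_field A" and ae: "AE x in lebesgue_on (hull_of K). A x = 0"
  shows "A = (\<lambda>_. 0)"
proof -
  obtain M c where M: "\<And>x. A x = M *v x + c" using A by (auto simp: affine_field_def)
  have comb: "A ((1 - t) *\<^sub>R x + t *\<^sub>R y) = (1 - t) *\<^sub>R A x + t *\<^sub>R A y" for x y t
    by (simp add: M matrix_vector_right_distrib matrix_vector_mult_scaleR algebra_simps)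
  have cont: "continuous_on UNIV A"
    unfolding M by (intro continuous_intros linear_continuous_on matrix_vector_mul_bounded_linear)
  have int0: "A x = 0" if x: "x \<in> interior (hull_of K)" for x
  proof (rule ccontr)
    assume "A x \<noteq> 0"
    define S where "S = interior (hull_of K) \<inter> {x. A x \<noteq> 0}"
    have "open {x. A x \<noteq> 0}" by (intro open_Collect_neq cont continuous_on_const)
    then have "open S" unfolding S_def by (intro open_Int open_interior)
    moreover have "x \<in> S" using x \<open>A x \<noteq> 0\<close> by (simp add: S_def)
    moreover have "negligible S"
    proof -
      have "AE x in lebesgue. x \<in> interior (hull_of K) \<longrightarrow> A x = 0"
        using ae unfolding AE_hull_interior by (simp add: AE_restrict_space_iff)
      then have "AE x in lebesgue. x \<notin> S" by eventually_elim (auto simp: S_def)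
      then show ?thesis using \<open>open S\<close> by (simp add: negligible_iff_null_sets AE_iff_null_sets)
    qed
    ultimately show False using open_not_negligible by blast
  qed
  have "A y = 0" for y
  proof -
    define g where "g = centroid K"
    have g: "g \<in> interior (hull_of K)" unfolding g_def by (rule centroid_interior[OF K])
    obtain r where r: "r > 0" "ball g r \<subseteq> interior (hull_of K)" using g open_contains_ball open_interior by blast
    define t where "t = r / (2 * (norm (y - g) + 1))"
    have pos: "norm (y - g) + 1 > 0" by (simp add: add_nonneg_pos)
    have t: "t > 0" using r(1) pos by (simp add: t_def)
    have "(1 - t) *\<^sub>R g + t *\<^sub>R y - g = t *\<^sub>R (y - g)" by (simp add: algebra_simps)
    then have "norm ((1 - t) *\<^sub>R g + t *\<^sub>R y - g) = t * norm (y - g)" using t by simp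
    also have "\<dots> \<le> t * (norm (y - g) + 1)" using t by simp
    also have "\<dots> = r / 2" unfolding t_def using pos by (simp add: field_simps)
    finally have "(1 - t) *\<^sub>R g + t *\<^sub>R y \<in> ball g r" using r(1) by (simp add: dist_norm norm_minus_commute)
    then have "A ((1 - t) *\<^sub>R g + t *\<^sub>R y) = 0" using int0 r(2) by blast
    then show "A y = 0" using comb[of t g y] int0[OF g] t by simp
  qed
  then show ?thesis by blast
qed

text \<open>Makes the definite description in \<open>poly_on\<close> usable: two affine
  representatives agree almost everywhere on K, hence everywhere, so traces on edges are well
  defined.\<close>

lemma poly_on_eq:
  assumes K: "K \<in> \<T>" and A: "affine_field A" and ae: "AE x in lebesgue_on (hull_of K). v x = A x"
  shows "poly_on v K = A"
  unfolding poly_on_def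
proof (rule the_equality)
  fix B assume B: "affine_field B \<and> (AE x in lebesgue_on (hull_of K). v x = B x)"
  have "affine_field (\<lambda>x. B x - A x)"
  proof -
    obtain M c M' c' where "\<And>x. A x = M *v x + c" "\<And>x. B x = M' *v x + c'"
      using A B unfolding affine_field_def by metis
    then have "B x - A x = (M' - M) *v x + (c' - c)" for x by (simp add: matrix_vector_mult_diff_rdistrib)
    then show ?thesis unfolding affine_field_def by blast
  qed
  moreover have "AE x in lebesgue_on (hull_of K). B x - A x = 0"
    using ae B by (auto elim: eventually_elim2)
  ultimately have "(\<lambda>x. B x - A x) = (\<lambda>_. 0)" by (rule affine_field_zero[OF proper_mesh[OF K]])
  then show "B = A" by (metis (no_types, lifting) ext eq_iff_diff_eq_0)
qed (use A ae in blast)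

text \<open>The midpoint rule is exact for affine functions; it links edge integrals to the midpoint
  conditions in \<open>crouzeix_raviart\<close>.\<close>

lemma edge_integral_affine:
  assumes "affine_field A"
  shows "edge_integral E A = dist (fst E) (snd E) *\<^sub>R A (midpoint (fst E) (snd E))"
proof -
  obtain M c where M: "\<And>x. A x = M *v x + c" using assms by (auto simp: affine_field_def)
  define a b where "a = fst E" and "b = snd E"
  have lin: "A (linepath a b t) = A a + t *\<^sub>R (A b - A a)" for t
    by (simp add: M linepath_def matrix_vector_right_distrib matrix_vector_mult_diff_distrib
        matrix_vector_mult_scaleR algebra_simps)
  have "((\<lambda>t. A (linepath a b t)) has_integral
      ((1 *\<^sub>R A a + (1\<^sup>2 / 2) *\<^sub>R (A b - A a)) - (0 *\<^sub>R A a + (0\<^sup>2 / 2) *\<^sub>R (A b - A a)))) {0..1}"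
  proof (rule fundamental_theorem_of_calculus)
    fix t :: real
    show "((\<lambda>t. t *\<^sub>R A a + (t\<^sup>2 / 2) *\<^sub>R (A b - A a)) has_vector_derivative A (linepath a b t)) (at t within {0..1})"
      unfolding lin by (auto intro!: derivative_eq_intros)
  qed simp
  moreover have "A a + (1 / 2) *\<^sub>R (A b - A a) = A (midpoint a b)"
  proof -
    have "linepath a b (1/2) = midpoint a b" by (simp add: linepath_def midpoint_def scaleR_add_right)
    then show ?thesis using lin[of "1/2"] by simp
  qed
  ultimately have "integral {0..1} (\<lambda>t. A (linepath a b t)) = A (midpoint a b)"
    by (simp add: integral_unique)
  then show ?thesis by (simp add: edge_integral_def a_def b_def)
qed

text \<open>Turns membership in the discrete space into affine pieces with componentwise midpoint
  conditions, the form in which the companion is built.\<close>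

lemma V_mesh_pieces:
  assumes "v \<in> V_mesh \<Omega> \<T>"
  shows "\<exists>(M :: tri \<Rightarrow> real^2^2) c. (\<forall>K\<in>\<T>. AE x in lebesgue_on (hull_of K). v x = M K *v x + c K) \<and>
    (\<forall>i. crouzeix_raviart (\<lambda>K x. M K $ i \<bullet> x + c K $ i) (\<lambda>K. M K $ i))"
proof -
  define ok where "ok = (\<lambda>K p. AE x in lebesgue_on (hull_of K). v x = fst p *v x + snd p)"
  have "\<exists>p. ok K p" if K: "K \<in> \<T>" for K
  proof -
    obtain A where A: "affine_field A" "AE x in lebesgue_on (hull_of K). v x = A x"
      using assms K unfolding V_mesh_def by blast
    obtain M c where Mc: "\<And>x. A x = M *v x + c" using A(1) by (auto simp: affine_field_def)
    then have "ok K (M, c)" using A(2) by (simp add: ok_def)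
    then show ?thesis by (rule exI)
  qed
  then obtain P where "\<And>K. K \<in> \<T> \<Longrightarrow> ok K (P K)" by metis
  then have Mc: "\<And>K. K \<in> \<T> \<Longrightarrow> AE x in lebesgue_on (hull_of K). v x = fst (P K) *v x + snd (P K)"
    by (simp add: ok_def)
  define M c where "M = fst \<circ> P" and "c = snd \<circ> P"
  have Mc: "\<And>K. K \<in> \<T> \<Longrightarrow> AE x in lebesgue_on (hull_of K). v x = M K *v x + c K"
    using Mc by (simp add: M_def c_def)
  define A where "A = (\<lambda>K x. M K *v x + c K)"
  have af: "affine_field (A K)" for K unfolding affine_field_def A_def by blast
  have poly: "poly_on v K = A K" if "K \<in> \<T>" for K
    by (rule poly_on_eq[OF that af]) (use Mc[OF that] in \<open>simp add: A_def\<close>)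
  have V: "(\<not> closed_segment (fst E) (snd E) \<subseteq> frontier \<Omega> \<longrightarrow> edge_integral E (jump \<T> K E (poly_on v)) = 0) \<and>
      (closed_segment (fst E) (snd E) \<subseteq> frontier \<Omega> \<longrightarrow> edge_integral E (poly_on v K) = 0)"
    if "K \<in> \<T>" "E \<in> edges K" for K E
    using assms that unfolding V_mesh_def by blast
  have edge: "A K (midpoint a b) = 0" if K: "K \<in> \<T>" "a \<in> verts K" "b \<in> verts K" "a \<noteq> b"
    and fr: "closed_segment a b \<subseteq> frontier \<Omega>" for K a b
  proof -
    obtain E where E: "E \<in> edges K" "E = (a, b) \<or> E = (b, a)"
      using edges_verts(2)[OF proper_mesh[OF K(1)] K(2-4)] by blast
    have seg: "closed_segment (fst E) (snd E) = closed_segment a b" "midpoint (fst E) (snd E) = midpoint a b"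
        "dist (fst E) (snd E) \<noteq> 0"
      using E(2) K by (auto simp: closed_segment_commute[of b a] midpoint_sym[of b a])
    then have "edge_integral E (poly_on v K) = 0" using V[OF K(1) E(1)] fr unfolding seg(1) by blast
    then show ?thesis
      unfolding poly[OF K(1)] edge_integral_affine[OF af] seg(2) using seg(3) by simp
  qed
  have shared: "A K (midpoint a b) = A K' (midpoint a b)"
    if K: "K \<in> \<T>" "K' \<in> \<T>" "{a, b} \<subseteq> verts K" "{a, b} \<subseteq> verts K'" "a \<noteq> b" for K K' a b
  proof (cases "K = K' \<or> closed_segment a b \<subseteq> frontier \<Omega>")
    case True
    then show ?thesis using edge[of K a b] edge[of K' a b] K by auto
  next
    case False
    obtain E where E: "E \<in> edges K" "E = (a, b) \<or> E = (b, a)"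
      using edges_verts(2)[OF proper_mesh[OF K(1)], of a b] K by blast
    \<comment> \<open>The sum in \<open>jump\<close> has exactly one term, as no third triangle has
      this edge.\<close>
    have "neighbours \<T> K E = {K'}"
    proof -
      have "{fst E, snd E} = {a, b}" using E(2) by auto
      moreover have "L = K'" if "L \<in> \<T>" "L \<noteq> K" "{a, b} \<subseteq> verts L" for L
        by (rule neighbour_unique[OF K(1) that(1) K(2) that(2) _ K(5) K(3) that(3) K(4)]) (use False in blast)
      ultimately show ?thesis unfolding neighbours_eq[OF K(1) E(1)] using K(2,4) False by blast
    qed
    then have "jump \<T> K E (poly_on v) = (\<lambda>x. A K x - A K' x)"
      by (auto simp: jump_def poly K)
    moreover have seg: "closed_segment (fst E) (snd E) = closed_segment a b" "midpoint (fst E) (snd E) = midpoint a b"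
        "dist (fst E) (snd E) \<noteq> 0"
      using E(2) K by (auto simp: closed_segment_commute[of b a] midpoint_sym[of b a])
    moreover have "edge_integral E (jump \<T> K E (poly_on v)) = 0" using V[OF K(1) E(1)] False unfolding seg(1) by blast
    moreover have "affine_field (\<lambda>x. A K x - A K' x)"
    proof -
      have "A K x - A K' x = (M K - M K') *v x + (c K - c K')" for x
        by (simp add: A_def matrix_vector_mult_diff_rdistrib)
      then show ?thesis unfolding affine_field_def by blast
    qed
    ultimately show ?thesis
      using edge_integral_affine[of "\<lambda>x. A K x - A K' x" E] by simp
  qed
  have comp: "M K $ i \<bullet> x + c K $ i = A K x $ i" for K i x by (simp add: A_def matrix_mult_dot)
  have "crouzeix_raviart (\<lambda>K x. M K $ i \<bullet> x + c K $ i) (\<lambda>K. M K $ i)" for i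
    unfolding crouzeix_raviart_def
  proof (intro conjI ballI allI impI)
    fix K x y
    show "M K $ i \<bullet> x + c K $ i - (M K $ i \<bullet> y + c K $ i) = M K $ i \<bullet> (x - y)"
      by (simp add: inner_diff_right)
  next
    fix K a b assume "K \<in> \<T>" "a \<in> verts K" "b \<in> verts K" "a \<noteq> b" "closed_segment a b \<subseteq> frontier \<Omega>"
    then show "M K $ i \<bullet> midpoint a b + c K $ i = 0" unfolding comp using edge by simp
  next
    fix K K' a b assume "K \<in> \<T>" "K' \<in> \<T>" "a \<in> verts K \<inter> verts K'" "b \<in> verts K \<inter> verts K'" "a \<noteq> b"
    then show "M K $ i \<bullet> midpoint a b + c K $ i = M K' $ i \<bullet> midpoint a b + c K' $ i"
      unfolding comp using shared[of K K' a b] by simp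
  qed
  with Mc show ?thesis by blast
qed

section \<open>Broken gradients of discrete functions\<close>

text \<open>A single function G that is a weak gradient on every triangle at once witnesses the
  choice made in \<open>broken_grad\<close>; uniqueness on each triangle does the rest.\<close>

lemma broken_grad_weak:
  assumes "\<And>K. K \<in> \<T> \<Longrightarrow> weak_gradient (interior (hull_of K)) v G" "K \<in> \<T>"
  shows "weak_gradient (interior (hull_of K)) v (broken_grad \<T> v)"
    "AE x in lebesgue_on (hull_of K). broken_grad \<T> v x = G x"
proof -
  have "\<forall>K\<in>\<T>. weak_gradient (interior (hull_of K)) v (broken_grad \<T> v)"
    unfolding broken_grad_def by (rule someI[of _ G]) (use assms(1) in blast)
  then show w: "weak_gradient (interior (hull_of K)) v (broken_grad \<T> v)" using assms(2) by blast
  show "AE x in lebesgue_on (hull_of K). broken_grad \<T> v x = G x"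
    unfolding AE_hull_interior
    by (rule weak_gradient_unique[OF _ _ w assms(1)[OF assms(2)]])
       (auto intro: bounded_subset[OF compact_imp_bounded[OF compact_hull_of] interior_subset])
qed

text \<open>An explicit broken gradient for piecewise affine functions, the witness required by
  \<open>broken_grad_weak\<close>.\<close>

definition piecewise :: "(tri \<Rightarrow> real^2^2) \<Rightarrow> tensor_field" where
  "piecewise M x = (\<Sum>K\<in>\<T>. indicator (interior (hull_of K)) x *\<^sub>R M K)"

lemma piecewise_eq:
  assumes "K \<in> \<T>" "x \<in> interior (hull_of K)"
  shows "piecewise M x = M K"
proof -
  have "indicator (interior (hull_of L)) x *\<^sub>R M L = (if L = K then M K else 0)" if "L \<in> \<T>" for L
    using interior_hull_unique[OF assms(1) that assms(2)] interior_subset[of "hull_of L"] assms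
    by (auto simp: indicator_def)
  then have "piecewise M x = (\<Sum>L\<in>\<T>. if L = K then M K else 0)"
    unfolding piecewise_def by (intro sum.cong) auto
  then show ?thesis using assms(1) finite_mesh by simp
qed

lemma piecewise_AE: "K \<in> \<T> \<Longrightarrow> AE x in lebesgue_on (hull_of K). piecewise M x = M K"
  unfolding AE_hull_interior by (rule AE_I2) (simp add: piecewise_eq)

lemma piecewise_L2: "L2 \<Omega> (piecewise M)"
proof (rule L2_bounded[OF O_lmeasurable])
  have "piecewise M \<in> borel_measurable borel"
    unfolding piecewise_def[abs_def]
    by (intro borel_measurable_sum borel_measurable_scaleR borel_measurable_indicator) auto
  then show "piecewise M \<in> borel_measurable (lebesgue_on \<Omega>)"
    by (intro measurable_restrict_space1 measurable_completion) simp
  show "norm (piecewise M x) \<le> (\<Sum>K\<in>\<T>. norm (M K))" for x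
    unfolding piecewise_def by (rule order_trans[OF norm_sum sum_mono]) (simp add: indicator_def)
qed

lemma broken_grad_V_mesh:
  assumes v: "v \<in> V_mesh \<Omega> \<T>" and M: "\<And>K. K \<in> \<T> \<Longrightarrow> AE x in lebesgue_on (hull_of K). v x = M K *v x + c K"
  shows "K \<in> \<T> \<Longrightarrow> weak_gradient (interior (hull_of K)) v (piecewise M)"
    and "K \<in> \<T> \<Longrightarrow> AE x in lebesgue_on (hull_of K). broken_grad \<T> v x = M K"
    and "L2 \<Omega> (broken_grad \<T> v)"
proof -
  have vL2: "L2 \<Omega> v" using v by (simp add: V_mesh_def)
  show wk: "weak_gradient (interior (hull_of K)) v (piecewise M)" if K: "K \<in> \<T>" for K
  proof (rule weak_gradient_cong)
    show "L2 (interior (hull_of K)) (piecewise M)"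
      unfolding L2_interior_hull by (rule L2_hull[OF K piecewise_L2])
    show "weak_gradient (interior (hull_of K)) v (\<lambda>_. M K)"
    proof (rule weak_gradient_affine)
      show "bounded (interior (hull_of K))"
        by (rule bounded_subset[OF compact_imp_bounded[OF compact_hull_of] interior_subset])
      show "L2 (interior (hull_of K)) v" unfolding L2_interior_hull by (rule L2_hull[OF K vL2])
      show "AE x in lebesgue_on (interior (hull_of K)). v x = M K *v x + c K"
        using M[OF K] unfolding AE_hull_interior .
    qed simp
  qed (use K in \<open>auto simp: piecewise_eq\<close>)
  have pw: "AE x in lebesgue_on (hull_of K). broken_grad \<T> v x = piecewise M x" if "K \<in> \<T>" for K
    using broken_grad_weak(2)[OF wk] that by blast
  show "AE x in lebesgue_on (hull_of K). broken_grad \<T> v x = M K" if "K \<in> \<T>" for K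
    using pw[OF that] piecewise_AE[OF that, of M] by eventually_elim simp
  have "AE x in lebesgue_on \<Omega>. piecewise M x = broken_grad \<T> v x"
    by (rule AE_O_of_hull, drule pw, erule eventually_mono) simp
  then show "L2 \<Omega> (broken_grad \<T> v)" by (rule L2_cong_AE[OF O_sets piecewise_L2])
qed

end

section \<open>The consistency error\<close>

lemma sum_mult_le_sqrt:
  fixes a b :: "'a \<Rightarrow> real"
  shows "(\<Sum>i\<in>I. a i * b i) \<le> sqrt (\<Sum>i\<in>I. (a i)\<^sup>2) * sqrt (\<Sum>i\<in>I. (b i)\<^sup>2)"
  unfolding real_sqrt_mult[symmetric] by (rule real_le_rsqrt[OF Cauchy_Schwarz_ineq_sum])

lemma inner_mat_1: "mat 1 \<bullet> X = trace X" for X :: "real^2^2"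
  by (simp add: inner_vec_def trace_def mat_def sum_2)

lemma norm_mat_1: "(norm (mat 1 :: real^2^2))\<^sup>2 = 2"
  by (simp only: dot_square_norm[symmetric] inner_mat_1) (simp add: trace_def mat_def sum_2)

lemma stress_L2:
  assumes "L2 U (grad U u)" "L2 U p"
  shows "L2 U (stress U \<mu> u p)"
  unfolding stress_def
proof (rule L2_add[OF L2_scaleR[OF assms(1)]])
  show "L2 U (\<lambda>x. p x *\<^sub>R (mat 1 :: real^2^2))"
    by (rule L2_norm_le[OF L2_scaleR[OF assms(2), of "norm (mat 1 :: real^2^2)"]])
       (use L2_measurable[OF assms(2)] in \<open>auto simp: mult.commute\<close>)
qed

text \<open>The first root bounds the nodal deviations by the broken gradient
  (\<open>deviation_sum\<close>). In the bracket the first part belongs to the oscillation and the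
  second to the stress error: \<kappa> / 2 stems from \<open>lam_grad_bound\<close>, the last root
  from \<open>stress_error\<close>.\<close>

definition consistency_const :: "real \<Rightarrow> real \<Rightarrow> real \<Rightarrow> real" where
  "consistency_const \<kappa> \<mu> \<gamma> = sqrt (6 * nodal_const \<kappa>) *
     (1 + 1 / (2 * bubble_moment) + (4 + 3 / (2 * bubble_moment)) * (\<kappa> / 2) * sqrt (2 * \<mu>\<^sup>2 + 4 / \<gamma>))"

lemma consistency_const_nonneg:
  assumes "\<kappa> > 0" "\<gamma> > 0"
  shows "consistency_const \<kappa> \<mu> \<gamma> \<ge> 0"
  unfolding consistency_const_def nodal_const_def
  using assms bubble_moment_pos by (intro mult_nonneg_nonneg add_nonneg_nonneg real_sqrt_ge_zero) auto

context mesh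
begin

text \<open>D and N have mean zero on K, so arbitrary constants g0 and \<sigma>0 may be subtracted.
  Pointwise bounds of D and N then meet L1 norms. The mesh size gained from
  \<open>hull_L1_le_L2\<close> weights the oscillation, and it cancels the inverse mesh size in the
  bound of N.\<close>

lemma element_consistency:
  fixes A :: "2 \<Rightarrow> tri \<Rightarrow> point \<Rightarrow> real"
  assumes K: "K \<in> \<T>" and reg: "shape_regular \<kappa> \<T>"
    and g: "L2 (hull_of K) g" and \<sigma>: "L2 (hull_of K) \<sigma>"
    and D: "AE x in lebesgue_on (hull_of K). \<forall>i. D x $ i = diff_poly (A i) K x" "L2 (hull_of K) D"
    and N: "AE x in lebesgue_on (hull_of K). \<forall>i. N x $ i = diff_grad (A i) K x" "L2 (hull_of K) N"
  shows "(LINT x|lebesgue_on (hull_of K). g x \<bullet> D x - \<sigma> x \<bullet> N x) \<le>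
    (\<Sum>i\<in>UNIV. \<Sum>z\<in>verts K. \<bar>deviation (A i) K z\<bar>) *
      ((1 + 1 / (2 * bubble_moment)) * (mesh_size K * l2norm (hull_of K) (\<lambda>x. g x - g0))
       + (4 + 3 / (2 * bubble_moment)) * (\<kappa> / 2) * l2norm (hull_of K) (\<lambda>x. \<sigma> x - \<sigma>0))"
    (is "_ \<le> ?m * (?C1 * (_ * ?ng) + ?C2 * (\<kappa> / 2) * ?ns)")
proof -
  note p = proper_mesh[OF K]
  have h: "mesh_size K > 0" by (rule mesh_size_pos[OF p])
  define D' :: vfield where "D' = (\<lambda>x. \<chi> i. diff_poly (A i) K x)"
  define N' :: tensor_field where "N' = (\<lambda>x. \<chi> i. diff_grad (A i) K x)"
  have eqD: "AE x in lebesgue_on (hull_of K). D x = D' x" using D(1) by eventually_elim (simp add: D'_def vec_eq_iff)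
  have eqN: "AE x in lebesgue_on (hull_of K). N x = N' x" using N(1) by eventually_elim (simp add: N'_def vec_eq_iff)
  have LD': "L2 (hull_of K) D'" by (rule L2_cong_AE[OF hull_of_sets D(2) eqD])
  have LN': "L2 (hull_of K) N'" by (rule L2_cong_AE[OF hull_of_sets N(2) eqN])
  have Lg: "L2 (hull_of K) (\<lambda>x. g x - g0)" and Ls: "L2 (hull_of K) (\<lambda>x. \<sigma> x - \<sigma>0)"
    using g \<sigma> by (auto intro!: L2_diff L2_const hull_of_lmeasurable)
  have zD: "(LINT x|lebesgue_on (hull_of K). g0 \<bullet> D' x) = 0"
  proof -
    have "(LINT x|lebesgue_on (hull_of K). g0 \<bullet> D' x) = (LINT x|lebesgue_on (hull_of K). (\<Sum>i\<in>UNIV. g0 $ i * diff_poly (A i) K x))"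
      by (simp add: D'_def inner_vec_def)
    also have "\<dots> = (\<Sum>i\<in>UNIV. g0 $ i * (LINT x|lebesgue_on (hull_of K). diff_poly (A i) K x))"
      using hull_integrable[OF nc_diff_continuous[OF p]] by (simp add: diff_poly_def)
    finally show ?thesis by (simp add: diff_poly_def LINT_nc_diff[OF p])
  qed
  have zN: "(LINT x|lebesgue_on (hull_of K). \<sigma>0 \<bullet> N' x) = 0"
  proof -
    have c: "continuous_on UNIV (\<lambda>x. diff_grad (A i) K x $ j)" for i j
      unfolding diff_grad_def by (intro continuous_on_component nc_grad_continuous p)
    have "(LINT x|lebesgue_on (hull_of K). \<sigma>0 \<bullet> N' x) =
        (LINT x|lebesgue_on (hull_of K). (\<Sum>i\<in>UNIV. \<Sum>j\<in>UNIV. \<sigma>0 $ i $ j * diff_grad (A i) K x $ j))"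
      by (simp add: N'_def inner_vec_def)
    also have "\<dots> = (\<Sum>i\<in>UNIV. \<Sum>j\<in>UNIV. \<sigma>0 $ i $ j * (LINT x|lebesgue_on (hull_of K). diff_grad (A i) K x $ j))"
      using hull_integrable[OF c] by simp
    finally show ?thesis by (simp add: diff_grad_def LINT_nc_grad[OF p])
  qed
  have D'b: "norm (D' x) \<le> ?C1 * ?m" if "x \<in> hull_of K" for x
  proof -
    have "norm (D' x) \<le> (\<Sum>i\<in>UNIV. norm (D' x $ i))" by (rule norm_vec_le_sum)
    also have "\<dots> \<le> (\<Sum>i\<in>UNIV. ?C1 * (\<Sum>z\<in>verts K. \<bar>deviation (A i) K z\<bar>))"
      using nc_diff_bound[OF p that] by (intro sum_mono) (simp add: D'_def diff_poly_def)
    finally show ?thesis by (simp add: sum_distrib_left)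
  qed
  have lg: "norm (lam_grad K z) \<le> \<kappa> / (2 * mesh_size K)" if "z \<in> verts K" for z
    using reg K by (intro lam_grad_bound[OF p _ that]) (auto simp: shape_regular_def)
  have N'b: "norm (N' x) \<le> ?C2 * (\<kappa> / (2 * mesh_size K)) * ?m" if "x \<in> hull_of K" for x
  proof -
    have "norm (N' x) \<le> (\<Sum>i\<in>UNIV. norm (N' x $ i))" by (rule norm_vec_le_sum)
    also have "\<dots> \<le> (\<Sum>i\<in>UNIV. ?C2 * (\<kappa> / (2 * mesh_size K)) * (\<Sum>z\<in>verts K. \<bar>deviation (A i) K z\<bar>))"
      using nc_grad_bound[OF p that lg] by (intro sum_mono) (simp add: N'_def diff_grad_def)
    finally show ?thesis by (simp add: sum_distrib_left)
  qed
  note LD = LD' LN' g \<sigma> Lg Ls D(2) N(2)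
  have int: "integrable (lebesgue_on (hull_of K)) (\<lambda>x. g x \<bullet> D x)" "integrable (lebesgue_on (hull_of K)) (\<lambda>x. \<sigma> x \<bullet> N x)"
    "integrable (lebesgue_on (hull_of K)) (\<lambda>x. (g x - g0) \<bullet> D' x)" "integrable (lebesgue_on (hull_of K)) (\<lambda>x. (\<sigma> x - \<sigma>0) \<bullet> N' x)"
    "integrable (lebesgue_on (hull_of K)) (\<lambda>x. g0 \<bullet> D' x)" "integrable (lebesgue_on (hull_of K)) (\<lambda>x. \<sigma>0 \<bullet> N' x)"
    by (intro L2_inner_integrable LD L2_const hull_of_lmeasurable)+
  have "(LINT x|lebesgue_on (hull_of K). g x \<bullet> D x - \<sigma> x \<bullet> N x) =
      (LINT x|lebesgue_on (hull_of K). ((g x - g0) \<bullet> D' x - (\<sigma> x - \<sigma>0) \<bullet> N' x) + (g0 \<bullet> D' x - \<sigma>0 \<bullet> N' x))"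
  proof (rule integral_cong_AE)
    show "AE x in lebesgue_on (hull_of K). g x \<bullet> D x - \<sigma> x \<bullet> N x =
        ((g x - g0) \<bullet> D' x - (\<sigma> x - \<sigma>0) \<bullet> N' x) + (g0 \<bullet> D' x - \<sigma>0 \<bullet> N' x)"
      using eqD eqN by eventually_elim (simp add: inner_diff_left)
  qed (use int in auto)
  also have "\<dots> = (LINT x|lebesgue_on (hull_of K). (g x - g0) \<bullet> D' x - (\<sigma> x - \<sigma>0) \<bullet> N' x)"
    using int zD zN by simp
  also have "\<dots> \<le> (LINT x|lebesgue_on (hull_of K). ?C1 * ?m * norm (g x - g0) + ?C2 * (\<kappa> / (2 * mesh_size K)) * ?m * norm (\<sigma> x - \<sigma>0))"
  proof (rule integral_mono)
    show "integrable (lebesgue_on (hull_of K)) (\<lambda>x. ?C1 * ?m * norm (g x - g0) + ?C2 * (\<kappa> / (2 * mesh_size K)) * ?m * norm (\<sigma> x - \<sigma>0))"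
      using L2_integrable[OF hull_of_lmeasurable Lg] L2_integrable[OF hull_of_lmeasurable Ls]
      by (intro Bochner_Integration.integrable_add integrable_mult_right integrable_norm) auto
    fix x assume "x \<in> space (lebesgue_on (hull_of K))"
    then have x: "x \<in> hull_of K" by simp
    have "(g x - g0) \<bullet> D' x \<le> norm (g x - g0) * norm (D' x)" by (rule norm_cauchy_schwarz)
    also have "\<dots> \<le> norm (g x - g0) * (?C1 * ?m)" using D'b[OF x] by (intro mult_left_mono) auto
    finally have 1: "(g x - g0) \<bullet> D' x \<le> ?C1 * ?m * norm (g x - g0)" by (simp only: mult_ac)
    have "- ((\<sigma> x - \<sigma>0) \<bullet> N' x) \<le> norm (\<sigma> x - \<sigma>0) * norm (N' x)"
      using Cauchy_Schwarz_ineq2[of "\<sigma> x - \<sigma>0" "N' x"] by linarith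
    also have "\<dots> \<le> norm (\<sigma> x - \<sigma>0) * (?C2 * (\<kappa> / (2 * mesh_size K)) * ?m)"
      using N'b[OF x] by (intro mult_left_mono) auto
    finally have 2: "- ((\<sigma> x - \<sigma>0) \<bullet> N' x) \<le> ?C2 * (\<kappa> / (2 * mesh_size K)) * ?m * norm (\<sigma> x - \<sigma>0)"
      by (simp only: mult_ac)
    show "(g x - g0) \<bullet> D' x - (\<sigma> x - \<sigma>0) \<bullet> N' x \<le>
        ?C1 * ?m * norm (g x - g0) + ?C2 * (\<kappa> / (2 * mesh_size K)) * ?m * norm (\<sigma> x - \<sigma>0)"
      using 1 2 by linarith
  qed (use int in auto)
  also have "\<dots> = ?C1 * ?m * (LINT x|lebesgue_on (hull_of K). norm (g x - g0))
      + ?C2 * (\<kappa> / (2 * mesh_size K)) * ?m * (LINT x|lebesgue_on (hull_of K). norm (\<sigma> x - \<sigma>0))"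
  proof -
    have "integrable (lebesgue_on (hull_of K)) (\<lambda>x. norm (g x - g0))" "integrable (lebesgue_on (hull_of K)) (\<lambda>x. norm (\<sigma> x - \<sigma>0))"
      using L2_integrable[OF hull_of_lmeasurable Lg] L2_integrable[OF hull_of_lmeasurable Ls] by auto
    then show ?thesis
      by (subst Bochner_Integration.integral_add) (auto simp del: integral_diff)
  qed
  also have "\<dots> \<le> ?C1 * ?m * (mesh_size K * ?ng) + ?C2 * (\<kappa> / (2 * mesh_size K)) * ?m * (mesh_size K * ?ns)"
  proof -
    \<comment> \<open>Shape regularity for two equal vertices forces this, and hence \<kappa> \<ge>
      0.\<close>
    have "\<kappa> * mesh_size K \<ge> 0"
    proof -
      obtain z where "z \<in> verts K" by (cases K) auto
      then show ?thesis using reg K unfolding shape_regular_def by (metis diff_self norm_zero)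
    qed
    then have k: "\<kappa> \<ge> 0" using h by (simp add: zero_le_mult_iff)
    have "?m \<ge> 0" by (intro sum_nonneg) auto
    then show ?thesis using h k bubble_moment_pos hull_L1_le_L2[OF p Lg] hull_L1_le_L2[OF p Ls]
      by (intro add_mono mult_left_mono mult_nonneg_nonneg) auto
  qed
  also have "\<dots> = ?m * (?C1 * (mesh_size K * ?ng) + ?C2 * (\<kappa> / 2) * ?ns)"
  proof -
    have "c1 * m * (k * x) + c2 * (\<kappa> / (2 * k)) * m * (k * y) = m * (c1 * (k * x) + c2 * (\<kappa> / 2) * y)"
      if "k > 0" for c1 c2 m k x y :: real
      using that by (simp add: field_simps)
    then show ?thesis using h by blast
  qed
  finally show ?thesis .
qed

text \<open>The factor 6 comes from Cauchy-Schwarz for 2 components and 3 vertices;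
  \<open>nodal_error_sum\<close> applies to each component.\<close>

lemma deviation_sum:
  assumes reg: "shape_regular \<kappa> \<T>" and \<kappa>: "\<kappa> > 0" and cr: "\<And>i. crouzeix_raviart (A i) (\<lambda>K. M K $ i)"
  shows "(\<Sum>K\<in>\<T>. (\<Sum>i\<in>UNIV. \<Sum>z\<in>verts K. \<bar>deviation (A i) K z\<bar>)\<^sup>2)
    \<le> 6 * nodal_const \<kappa> * (\<Sum>K\<in>\<T>. (mesh_size K)\<^sup>2 * (norm (M K :: real^2^2))\<^sup>2)"
proof -
  have "(\<Sum>i\<in>UNIV. \<Sum>z\<in>verts K. \<bar>deviation (A i) K z\<bar>)\<^sup>2 \<le> 6 * (\<Sum>i\<in>UNIV. \<Sum>z\<in>verts K. (A i K z - nodal (A i) z)\<^sup>2)"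
    if K: "K \<in> \<T>" for K
  proof -
    have 1: "(\<Sum>z\<in>verts K. \<bar>deviation (A i) K z\<bar>)\<^sup>2 \<le> 3 * (\<Sum>z\<in>verts K. (A i K z - nodal (A i) z)\<^sup>2)" for i
      using sum_squared_le_sum_of_squares[of "\<lambda>z. \<bar>deviation (A i) K z\<bar>" "verts K"] card_verts[OF proper_mesh[OF K]]
      by (simp add: deviation_def mult.commute)
    have "(\<Sum>i\<in>UNIV. \<Sum>z\<in>verts K. \<bar>deviation (A i) K z\<bar>)\<^sup>2 \<le> 2 * (\<Sum>i\<in>UNIV. (\<Sum>z\<in>verts K. \<bar>deviation (A i) K z\<bar>)\<^sup>2)"
      using sum_squared_le_sum_of_squares[of "\<lambda>i. \<Sum>z\<in>verts K. \<bar>deviation (A i) K z\<bar>" UNIV] by (simp add: mult.commute)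
    also have "\<dots> \<le> 2 * (\<Sum>i\<in>UNIV. 3 * (\<Sum>z\<in>verts K. (A i K z - nodal (A i) z)\<^sup>2))"
      using 1 by (intro mult_left_mono sum_mono) auto
    finally show ?thesis by (simp add: sum_distrib_left)
  qed
  then have "(\<Sum>K\<in>\<T>. (\<Sum>i\<in>UNIV. \<Sum>z\<in>verts K. \<bar>deviation (A i) K z\<bar>)\<^sup>2) \<le>
      (\<Sum>K\<in>\<T>. 6 * (\<Sum>i\<in>UNIV. \<Sum>z\<in>verts K. (A i K z - nodal (A i) z)\<^sup>2))"
    by (rule sum_mono)
  also have "\<dots> = 6 * (\<Sum>i\<in>UNIV. \<Sum>K\<in>\<T>. \<Sum>z\<in>verts K. (A i K z - nodal (A i) z)\<^sup>2)"
    unfolding sum_distrib_left[symmetric] by (subst sum.swap) simp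
  also have "\<dots> \<le> 6 * (\<Sum>i\<in>UNIV. nodal_const \<kappa> * (\<Sum>K\<in>\<T>. (mesh_size K * norm (M K $ i))\<^sup>2))"
    by (intro mult_left_mono sum_mono nodal_error_sum[OF reg \<kappa> cr]) auto
  also have "\<dots> = 6 * nodal_const \<kappa> * (\<Sum>K\<in>\<T>. \<Sum>i\<in>UNIV. (mesh_size K * norm (M K $ i))\<^sup>2)"
    unfolding sum_distrib_left[symmetric] by (subst sum.swap) simp
  also have "\<dots> = 6 * nodal_const \<kappa> * (\<Sum>K\<in>\<T>. (mesh_size K)\<^sup>2 * (norm (M K))\<^sup>2)"
    by (simp add: norm_vec_def[of "M _"] L2_set_def sum_nonneg power_mult_distrib sum_distrib_left)
  finally show ?thesis .
qed

text \<open>The constant on K is the discrete stress of (w, q). The stress differs from it by \<mu>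
  times the broken gradient of u - w plus p - q times the identity; as the identity has squared norm
  2, squaring gives the factors \<open>2 * \<mu>\<^sup>2\<close> and 4.\<close>

lemma stress_error:
  assumes \<gamma>: "\<gamma> > 0" and u: "L2 \<Omega> u" "weak_gradient \<Omega> u (grad \<Omega> u)" and p: "L2 \<Omega> p"
    and w: "w \<in> V_mesh \<Omega> \<T>" and q: "q \<in> Q_mesh \<Omega> \<T>"
  obtains \<sigma>0 where "(\<Sum>K\<in>\<T>. (l2norm (hull_of K) (\<lambda>x. stress \<Omega> \<mu> u p x - \<sigma>0 K))\<^sup>2) \<le>
    (2 * \<mu>\<^sup>2 + 4 / \<gamma>) * (energy_norm \<Omega> \<gamma> \<T> (\<lambda>x. u x - w x) (\<lambda>x. p x - q x))\<^sup>2"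
proof -
  obtain M c where "\<forall>K\<in>\<T>. AE x in lebesgue_on (hull_of K). w x = M K *v x + c K"
    using V_mesh_pieces[OF w] by blast
  then have M: "\<And>K. K \<in> \<T> \<Longrightarrow> AE x in lebesgue_on (hull_of K). w x = M K *v x + c K" by blast
  have "\<exists>c. AE x in lebesgue_on (hull_of K). q x = c" if "K \<in> \<T>" for K
    using q that by (simp add: Q_mesh_def)
  then obtain r where r: "\<And>K. K \<in> \<T> \<Longrightarrow> AE x in lebesgue_on (hull_of K). q x = r K" by metis
  have qL: "L2 \<Omega> q" using q by (simp add: Q_mesh_def Q_space_def)
  have wL: "L2 \<Omega> w" using w by (simp add: V_mesh_def)
  define B where "B = broken_grad \<T> (\<lambda>x. u x - w x)"
  have gL: "L2 \<Omega> (grad \<Omega> u)" using u(2) by (simp add: weak_gradient_def)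
  have wk: "weak_gradient (interior (hull_of K)) (\<lambda>x. u x - w x) (\<lambda>x. grad \<Omega> u x - piecewise M x)" if K: "K \<in> \<T>" for K
  proof (rule weak_gradient_diff)
    show "bounded (interior (hull_of K))"
      by (rule bounded_subset[OF compact_imp_bounded[OF compact_hull_of] interior_subset])
    show "L2 (interior (hull_of K)) u" "L2 (interior (hull_of K)) w"
      unfolding L2_interior_hull by (intro L2_hull[OF K] u wL)+
    show "weak_gradient (interior (hull_of K)) u (grad \<Omega> u)"
      by (rule weak_gradient_subset[OF openO open_interior interior_subset_O[OF K] u(2)])
    show "weak_gradient (interior (hull_of K)) w (piecewise M)" by (rule broken_grad_V_mesh(1)[OF w M K])
  qed simp
  have BAE: "AE x in lebesgue_on (hull_of K). B x = grad \<Omega> u x - piecewise M x" if "K \<in> \<T>" for K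
    unfolding B_def using broken_grad_weak(2)[OF wk] that by blast
  have "AE x in lebesgue_on \<Omega>. grad \<Omega> u x - piecewise M x = B x"
    by (rule AE_O_of_hull, drule BAE, erule eventually_mono) simp
  then have BL: "L2 \<Omega> B" by (rule L2_cong_AE[OF O_sets L2_diff[OF gL piecewise_L2]])
  define e where "e = (\<lambda>x. p x - q x)"
  have eL: "L2 \<Omega> e" unfolding e_def by (rule L2_diff[OF p qL])
  have sL: "L2 \<Omega> (stress \<Omega> \<mu> u p)" by (rule stress_L2[OF gL p])
  define \<sigma>0 where "\<sigma>0 = (\<lambda>K. \<mu> *\<^sub>R M K + r K *\<^sub>R (mat 1 :: real^2^2))"
  have loc: "(l2norm (hull_of K) (\<lambda>x. stress \<Omega> \<mu> u p x - \<sigma>0 K))\<^sup>2 \<le>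
      2 * \<mu>\<^sup>2 * (l2norm (hull_of K) B)\<^sup>2 + 4 * (l2norm (hull_of K) e)\<^sup>2" if K: "K \<in> \<T>" for K
  proof -
    have iB: "integrable (lebesgue_on (hull_of K)) (\<lambda>x. (norm (B x))\<^sup>2)"
      and ie: "integrable (lebesgue_on (hull_of K)) (\<lambda>x. (norm (e x))\<^sup>2)"
      by (rule L2_square_integrable[OF L2_hull[OF K BL]], rule L2_square_integrable[OF L2_hull[OF K eL]])
    have "(LINT x|lebesgue_on (hull_of K). (norm (stress \<Omega> \<mu> u p x - \<sigma>0 K))\<^sup>2) \<le>
        (LINT x|lebesgue_on (hull_of K). 2 * \<mu>\<^sup>2 * (norm (B x))\<^sup>2 + 4 * (norm (e x))\<^sup>2)"
    proof (rule integral_mono_AE)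
      show "AE x in lebesgue_on (hull_of K). (norm (stress \<Omega> \<mu> u p x - \<sigma>0 K))\<^sup>2 \<le> 2 * \<mu>\<^sup>2 * (norm (B x))\<^sup>2 + 4 * (norm (e x))\<^sup>2"
        using BAE[OF K] r[OF K] piecewise_AE[OF K, of M]
      proof eventually_elim
        case (elim x)
        have "stress \<Omega> \<mu> u p x - \<sigma>0 K = \<mu> *\<^sub>R B x + e x *\<^sub>R mat 1"
        proof -
          have "grad \<Omega> u x = B x + M K" using elim by simp
          then show ?thesis
            using elim(2) by (simp add: stress_def \<sigma>0_def e_def scaleR_add_right scaleR_diff_left)
        qed
        then show ?case
          using norm_add_square_le[of "\<mu> *\<^sub>R B x" "e x *\<^sub>R (mat 1 :: real^2^2)"]
          by (simp add: power_mult_distrib norm_mat_1)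
      qed
      show "integrable (lebesgue_on (hull_of K)) (\<lambda>x. (norm (stress \<Omega> \<mu> u p x - \<sigma>0 K))\<^sup>2)"
        by (intro L2_square_integrable L2_diff L2_hull[OF K sL] L2_const hull_of_lmeasurable)
    qed (use iB ie in auto)
    then show ?thesis unfolding l2norm_square using iB ie by simp
  qed
  have "(\<Sum>K\<in>\<T>. (l2norm (hull_of K) (\<lambda>x. stress \<Omega> \<mu> u p x - \<sigma>0 K))\<^sup>2) \<le>
      2 * \<mu>\<^sup>2 * (l2norm \<Omega> B)\<^sup>2 + 4 * (l2norm \<Omega> e)\<^sup>2"
    unfolding l2norm_mesh[OF BL] l2norm_mesh[OF eL] sum_distrib_left sum.distrib[symmetric]
    by (rule sum_mono) (rule loc)
  \<comment> \<open>The summand 4 / \<gamma> makes up for the weight \<gamma> of the pressure in the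
    energy norm.\<close>
  also have "\<dots> \<le> (2 * \<mu>\<^sup>2 + 4 / \<gamma>) * ((l2norm \<Omega> B)\<^sup>2 + \<gamma> * (l2norm \<Omega> e)\<^sup>2)"
  proof -
    have "(2 * \<mu>\<^sup>2 + 4 / \<gamma>) * ((l2norm \<Omega> B)\<^sup>2 + \<gamma> * (l2norm \<Omega> e)\<^sup>2) =
        2 * \<mu>\<^sup>2 * (l2norm \<Omega> B)\<^sup>2 + 4 * (l2norm \<Omega> e)\<^sup>2
        + (4 / \<gamma> * (l2norm \<Omega> B)\<^sup>2 + 2 * \<mu>\<^sup>2 * (\<gamma> * (l2norm \<Omega> e)\<^sup>2))"
      using \<gamma> by (simp add: distrib_left distrib_right)
    moreover have "0 \<le> 4 / \<gamma> * (l2norm \<Omega> B)\<^sup>2 + 2 * \<mu>\<^sup>2 * (\<gamma> * (l2norm \<Omega> e)\<^sup>2)" using \<gamma> by simp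
    ultimately show ?thesis by linarith
  qed
  also have "(l2norm \<Omega> B)\<^sup>2 + \<gamma> * (l2norm \<Omega> e)\<^sup>2 = (energy_norm \<Omega> \<gamma> \<T> (\<lambda>x. u x - w x) (\<lambda>x. p x - q x))\<^sup>2"
    unfolding energy_norm_def B_def[symmetric] e_def[symmetric] using \<gamma> by simp
  finally show thesis by (rule that)
qed

theorem consistency_estimate:
  assumes reg: "shape_regular \<kappa> \<T>" and \<kappa>: "\<kappa> > 0" and \<gamma>: "\<gamma> > 0"
    and g: "L2 \<Omega> g" and st: "stokes_solution \<Omega> \<mu> g u p"
    and v: "v \<in> V_mesh \<Omega> \<T>" and w: "w \<in> V_mesh \<Omega> \<T>" and q: "q \<in> Q_mesh \<Omega> \<T>"
  shows "l2inner \<Omega> g v - l2inner \<Omega> (stress \<Omega> \<mu> u p) (broken_grad \<T> v) \<le>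
    consistency_const \<kappa> \<mu> \<gamma> * (energy_norm \<Omega> \<gamma> \<T> (\<lambda>x. u x - w x) (\<lambda>x. p x - q x) + osc g \<T>)
      * l2norm \<Omega> (broken_grad \<T> v)"
proof -
  have uV: "u \<in> V_space \<Omega>" and pQ: "p \<in> Q_space \<Omega>" using st by (auto simp: stokes_solution_def)
  have uL: "L2 \<Omega> u" and "\<exists>G. weak_gradient \<Omega> u G" using uV unfolding V_space_def H1_def by blast+
  from this(2) have ugr: "weak_gradient \<Omega> u (grad \<Omega> u)" unfolding grad_def by (rule someI_ex)
  have pL: "L2 \<Omega> p" using pQ by (simp add: Q_space_def)
  have gL: "L2 \<Omega> (grad \<Omega> u)" using ugr by (simp add: weak_gradient_def)
  define \<sigma> where "\<sigma> = stress \<Omega> \<mu> u p"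
  have sL: "L2 \<Omega> \<sigma>" unfolding \<sigma>_def by (rule stress_L2[OF gL pL])
  have vL: "L2 \<Omega> v" using v by (simp add: V_mesh_def)
  obtain M c where Mc: "\<forall>K\<in>\<T>. AE x in lebesgue_on (hull_of K). v x = M K *v x + c K"
    "\<forall>i. crouzeix_raviart (\<lambda>K x. M K $ i \<bullet> x + c K $ i) (\<lambda>K. M K $ i)"
    using V_mesh_pieces[OF v] by blast
  define A where "A = (\<lambda>i K x. M K $ i \<bullet> x + c K $ i)"
  have M: "\<And>K. K \<in> \<T> \<Longrightarrow> AE x in lebesgue_on (hull_of K). v x = M K *v x + c K"
    and cr: "\<And>i. crouzeix_raviart (A i) (\<lambda>K. M K $ i)"
    using Mc by (auto simp: A_def)
  define W :: vfield where "W = (\<lambda>x. \<chi> i. companion (A i) x)"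
  define G :: tensor_field where "G = (\<lambda>x. \<chi> i. companion_grad (A i) (\<lambda>K. M K $ i) x)"
  have WV: "W \<in> V_space \<Omega>" and WG: "weak_gradient \<Omega> W G"
    using companion_V_space[of A "\<lambda>i K. M K $ i"] cr unfolding W_def G_def A_def by blast+
  have WL: "L2 \<Omega> W" using WV by (simp add: V_space_def H1_def)
  define H where "H = grad \<Omega> W"
  have HL: "L2 \<Omega> H" unfolding H_def by (rule grad_L2[OF WG])
  have HG: "AE x in lebesgue_on \<Omega>. H x = G x" unfolding H_def by (rule grad_AE[OF openO boundedO WG])
  define B where "B = broken_grad \<T> v"
  have BL: "L2 \<Omega> B" unfolding B_def by (rule broken_grad_V_mesh(3)[OF v M])
  have BM: "AE x in lebesgue_on (hull_of K). B x = M K" if "K \<in> \<T>" for K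
    unfolding B_def by (rule broken_grad_V_mesh(2)[OF v M that])
  have weak: "l2inner \<Omega> \<sigma> H = l2inner \<Omega> g W"
  proof -
    \<comment> \<open>With q = 0 the divergence constraint drops out, and the Stokes equation
      relates the stress and g on the companion alone.\<close>
    have "(\<lambda>x. 0) \<in> Q_space \<Omega>" by (simp add: Q_space_def L2_const O_lmeasurable)
    then have "\<mu> * l2inner \<Omega> (grad \<Omega> u) H + l2inner \<Omega> (\<lambda>x. trace (H x)) p
        + l2inner \<Omega> (\<lambda>x. trace (grad \<Omega> u x)) (\<lambda>x. 0) = l2inner \<Omega> g W"
      using st WV unfolding stokes_solution_def H_def by blast
    moreover have "l2inner \<Omega> \<sigma> H = \<mu> * l2inner \<Omega> (grad \<Omega> u) H + l2inner \<Omega> (\<lambda>x. trace (H x)) p"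
    proof -
      have s: "\<sigma> x \<bullet> H x = \<mu> * (grad \<Omega> u x \<bullet> H x) + trace (H x) * p x" for x
        by (simp add: \<sigma>_def stress_def inner_add_left inner_mat_1)
      have i: "integrable (lebesgue_on \<Omega>) (\<lambda>x. grad \<Omega> u x \<bullet> H x)" "integrable (lebesgue_on \<Omega>) (\<lambda>x. \<sigma> x \<bullet> H x)"
        by (intro L2_inner_integrable gL HL sL)+
      have "integrable (lebesgue_on \<Omega>) (\<lambda>x. \<sigma> x \<bullet> H x - \<mu> * (grad \<Omega> u x \<bullet> H x))" using i by simp
      then have "integrable (lebesgue_on \<Omega>) (\<lambda>x. trace (H x) * p x)" by (simp add: s)
      then show ?thesis using i by (simp add: l2inner_def s)
    qed
    ultimately show ?thesis by (simp add: l2inner_def)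
  qed
  define D N where "D = (\<lambda>x. v x - W x)" and "N = (\<lambda>x. B x - H x)"
  have DL: "L2 \<Omega> D" and NL: "L2 \<Omega> N" unfolding D_def N_def by (intro L2_diff vL WL BL HL)+
  have int: "integrable (lebesgue_on \<Omega>) (\<lambda>x. g x \<bullet> v x)" "integrable (lebesgue_on \<Omega>) (\<lambda>x. g x \<bullet> W x)"
    "integrable (lebesgue_on \<Omega>) (\<lambda>x. \<sigma> x \<bullet> B x)" "integrable (lebesgue_on \<Omega>) (\<lambda>x. \<sigma> x \<bullet> H x)"
    "integrable (lebesgue_on \<Omega>) (\<lambda>x. g x \<bullet> D x)" "integrable (lebesgue_on \<Omega>) (\<lambda>x. \<sigma> x \<bullet> N x)"
    by (intro L2_inner_integrable g vL WL sL BL HL DL NL)+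
  \<comment> \<open>By \<open>weak\<close> the inserted terms cancel, which leaves v - W and its
    broken gradient.\<close>
  have "l2inner \<Omega> g v - l2inner \<Omega> \<sigma> B = (l2inner \<Omega> g v - l2inner \<Omega> g W) - (l2inner \<Omega> \<sigma> B - l2inner \<Omega> \<sigma> H)"
    by (simp add: weak)
  also have "\<dots> = (LINT x|lebesgue_on \<Omega>. g x \<bullet> D x - \<sigma> x \<bullet> N x)"
    using int by (simp add: l2inner_def D_def N_def inner_diff_right)
  also have "\<dots> = (\<Sum>K\<in>\<T>. LINT x|lebesgue_on (hull_of K). g x \<bullet> D x - \<sigma> x \<bullet> N x)"
    using int by (intro LINT_mesh) auto
  finally have E: "l2inner \<Omega> g v - l2inner \<Omega> \<sigma> B = (\<Sum>K\<in>\<T>. LINT x|lebesgue_on (hull_of K). g x \<bullet> D x - \<sigma> x \<bullet> N x)" .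
  have DK: "AE x in lebesgue_on (hull_of K). \<forall>i. D x $ i = diff_poly (A i) K x" if K: "K \<in> \<T>" for K
  proof -
    have "AE x in lebesgue_on (hull_of K). x \<in> hull_of K" using AE_space[of "lebesgue_on (hull_of K)"] by simp
    with M[OF K] show ?thesis
    proof eventually_elim
      case (elim x)
      have "companion (A i) x = A i K x - diff_poly (A i) K x" for i
        by (rule companion_eq[OF cr K elim(2)])
      then show ?case by (simp add: D_def W_def elim(1) A_def matrix_mult_dot)
    qed
  qed
  have NK: "AE x in lebesgue_on (hull_of K). \<forall>i. N x $ i = diff_grad (A i) K x" if K: "K \<in> \<T>" for K
  proof -
    have "AE x in lebesgue_on (hull_of K). x \<in> interior (hull_of K)"
      unfolding AE_hull_interior using AE_space[of "lebesgue_on (interior (hull_of K))"] by simp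
    with BM[OF K] AE_hull_of_O[OF K HG] show ?thesis
      by eventually_elim (simp add: N_def G_def companion_grad_eq[OF K])
  qed
  \<comment> \<open>The constants subtracted from the stress come from the pair (w, q),
    independently of v.\<close>
  obtain \<sigma>0 where s0: "(\<Sum>K\<in>\<T>. (l2norm (hull_of K) (\<lambda>x. \<sigma> x - \<sigma>0 K))\<^sup>2) \<le>
      (2 * \<mu>\<^sup>2 + 4 / \<gamma>) * (energy_norm \<Omega> \<gamma> \<T> (\<lambda>x. u x - w x) (\<lambda>x. p x - q x))\<^sup>2"
    using stress_error[OF \<gamma> uL ugr pL w q] unfolding \<sigma>_def by blast
  define en where "en = energy_norm \<Omega> \<gamma> \<T> (\<lambda>x. u x - w x) (\<lambda>x. p x - q x)"
  have en: "en \<ge> 0" using \<gamma> by (simp add: en_def energy_norm_def)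
  define m where "m = (\<lambda>K. \<Sum>i\<in>UNIV. \<Sum>z\<in>verts K. \<bar>deviation (A i) K z\<bar>)"
  define C1 where "C1 = 1 + 1 / (2 * bubble_moment)"
  define C2 where "C2 = (4 + 3 / (2 * bubble_moment)) * (\<kappa> / 2)"
  define a where "a = (\<lambda>K. mesh_size K * l2norm (hull_of K) (\<lambda>x. g x - l2proj_const K g))"
  define b where "b = (\<lambda>K. l2norm (hull_of K) (\<lambda>x. \<sigma> x - \<sigma>0 K))"
  have C: "C1 \<ge> 0" "C2 \<ge> 0" using bubble_moment_pos \<kappa> by (auto simp: C1_def C2_def)
  have bB: "(\<Sum>K\<in>\<T>. (m K)\<^sup>2) \<le> 6 * nodal_const \<kappa> * (l2norm \<Omega> B)\<^sup>2"
  proof -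
    have "(l2norm (hull_of K) B)\<^sup>2 = (mesh_size K)\<^sup>2 * (norm (M K))\<^sup>2" if K: "K \<in> \<T>" for K
    proof -
      have "l2norm (hull_of K) B = l2norm (hull_of K) (\<lambda>_. M K)"
        by (rule l2norm_cong_AE[OF hull_of_sets L2_hull[OF K BL] L2_const[OF hull_of_lmeasurable] BM[OF K]])
      then show ?thesis by (simp add: l2norm_square measure_on_hull)
    qed
    then have "(l2norm \<Omega> B)\<^sup>2 = (\<Sum>K\<in>\<T>. (mesh_size K)\<^sup>2 * (norm (M K))\<^sup>2)"
      by (simp add: l2norm_mesh[OF BL])
    then show ?thesis using deviation_sum[OF reg \<kappa> cr] by (simp add: m_def)
  qed
  have "l2inner \<Omega> g v - l2inner \<Omega> \<sigma> B \<le> (\<Sum>K\<in>\<T>. m K * (C1 * a K + C2 * b K))"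
    unfolding E m_def C1_def C2_def a_def b_def
    using reg DK NK by (intro sum_mono element_consistency L2_hull g sL DL NL)
  also have "\<dots> = C1 * (\<Sum>K\<in>\<T>. m K * a K) + C2 * (\<Sum>K\<in>\<T>. m K * b K)"
    by (simp add: distrib_left sum.distrib sum_distrib_left mult_ac)
  also have "\<dots> \<le> C1 * (sqrt (\<Sum>K\<in>\<T>. (m K)\<^sup>2) * sqrt (\<Sum>K\<in>\<T>. (a K)\<^sup>2)) + C2 * (sqrt (\<Sum>K\<in>\<T>. (m K)\<^sup>2) * sqrt (\<Sum>K\<in>\<T>. (b K)\<^sup>2))"
    using C by (intro add_mono mult_left_mono sum_mult_le_sqrt)
  also have "\<dots> = sqrt (\<Sum>K\<in>\<T>. (m K)\<^sup>2) * (C1 * osc g \<T> + C2 * sqrt (\<Sum>K\<in>\<T>. (b K)\<^sup>2))"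
    by (simp add: osc_def a_def power_mult_distrib algebra_simps)
  \<comment> \<open>Energy error and oscillation are each estimated by their sum, so that one
    constant serves both.\<close>
  also have "\<dots> \<le> (sqrt (6 * nodal_const \<kappa>) * l2norm \<Omega> B) * ((C1 + C2 * sqrt (2 * \<mu>\<^sup>2 + 4 / \<gamma>)) * (en + osc g \<T>))"
  proof (rule mult_mono)
    show "sqrt (\<Sum>K\<in>\<T>. (m K)\<^sup>2) \<le> sqrt (6 * nodal_const \<kappa>) * l2norm \<Omega> B"
      using real_sqrt_le_mono[OF bB] l2norm_nonneg[of \<Omega> B] by (simp add: real_sqrt_mult)
    have o: "osc g \<T> \<ge> 0" by (simp add: osc_def sum_nonneg)
    have "sqrt (\<Sum>K\<in>\<T>. (b K)\<^sup>2) \<le> sqrt ((2 * \<mu>\<^sup>2 + 4 / \<gamma>) * en\<^sup>2)"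
      unfolding b_def en_def by (rule real_sqrt_le_mono[OF s0])
    also have "\<dots> = sqrt (2 * \<mu>\<^sup>2 + 4 / \<gamma>) * en" using en by (simp add: real_sqrt_mult)
    finally have "C2 * sqrt (\<Sum>K\<in>\<T>. (b K)\<^sup>2) \<le> C2 * (sqrt (2 * \<mu>\<^sup>2 + 4 / \<gamma>) * en)"
      using C by (intro mult_left_mono)
    moreover have "(C1 + C2 * sqrt (2 * \<mu>\<^sup>2 + 4 / \<gamma>)) * (en + osc g \<T>) =
        C1 * osc g \<T> + C2 * (sqrt (2 * \<mu>\<^sup>2 + 4 / \<gamma>) * en) + (C1 * en + C2 * sqrt (2 * \<mu>\<^sup>2 + 4 / \<gamma>) * osc g \<T>)"
      by (simp add: algebra_simps)
    moreover have "0 \<le> C1 * en + C2 * sqrt (2 * \<mu>\<^sup>2 + 4 / \<gamma>) * osc g \<T>"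
      using C en o \<gamma> by simp
    ultimately show "C1 * osc g \<T> + C2 * sqrt (\<Sum>K\<in>\<T>. (b K)\<^sup>2) \<le> (C1 + C2 * sqrt (2 * \<mu>\<^sup>2 + 4 / \<gamma>)) * (en + osc g \<T>)"
      by linarith
    show "0 \<le> C1 * osc g \<T> + C2 * sqrt (\<Sum>K\<in>\<T>. (b K)\<^sup>2)" using C o by (simp add: sum_nonneg)
    have "nodal_const \<kappa> \<ge> 0" using \<kappa> by (simp add: nodal_const_def)
    then show "0 \<le> sqrt (6 * nodal_const \<kappa>) * l2norm \<Omega> B" by (simp add: l2norm_nonneg)
  qed
  also have "\<dots> = consistency_const \<kappa> \<mu> \<gamma> * (en + osc g \<T>) * l2norm \<Omega> B"
    by (simp add: consistency_const_def C1_def C2_def mult_ac)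
  finally show ?thesis by (simp add: \<sigma>_def B_def en_def)
qed

text \<open>The estimate holds for every discrete pair. As C > 0, it can be solved for the energy
  norm, which gives a lower bound of all these norms and so of their infimum.\<close>

lemma consistency_error_le:
  assumes reg: "shape_regular \<kappa> \<T>" and \<kappa>: "\<kappa> > 0" and \<gamma>: "\<gamma> > 0"
    and g: "L2 \<Omega> g" and st: "stokes_solution \<Omega> \<mu> g u p"
    and C: "consistency_const \<kappa> \<mu> \<gamma> \<le> C" "C > 0"
  shows "consistency_error \<Omega> g (stress \<Omega> \<mu> u p) \<T> \<le> ereal (C * ((INF (v, q)\<in>V_mesh \<Omega> \<T> \<times> Q_mesh \<Omega> \<T>.
    energy_norm \<Omega> \<gamma> \<T> (\<lambda>x. u x - v x) (\<lambda>x. p x - q x)) + osc g \<T>))"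
  unfolding consistency_error_def
proof (rule SUP_least)
  fix v assume "v \<in> {v \<in> V_mesh \<Omega> \<T>. \<not> (AE x in lebesgue_on \<Omega>. v x = 0)}"
  then have v: "v \<in> V_mesh \<Omega> \<T>" by simp
  define B where "B = broken_grad \<T> v"
  define E where "E = l2inner \<Omega> g v - l2inner \<Omega> (stress \<Omega> \<mu> u p) B"
  define e where "e = E / l2norm \<Omega> B"
  define en where "en = (\<lambda>(v, q). energy_norm \<Omega> \<gamma> \<T> (\<lambda>x. u x - v x) (\<lambda>x. p x - q x))"
  \<comment> \<open>Together with v itself this gives a discrete pair, so the infimum is over a
    nonempty set.\<close>
  have "(\<lambda>_. 0) \<in> Q_mesh \<Omega> \<T>"
    by (auto simp: Q_mesh_def Q_space_def L2_const O_lmeasurable intro!: exI[of _ 0])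
  then have ne: "V_mesh \<Omega> \<T> \<times> Q_mesh \<Omega> \<T> \<noteq> {}" using v by blast
  have en0: "0 \<le> en x" for x using \<gamma> by (cases x) (simp add: en_def energy_norm_def)
  have o: "osc g \<T> \<ge> 0" by (simp add: osc_def sum_nonneg)
  have le: "e \<le> C * (en x + osc g \<T>)" if x: "x \<in> V_mesh \<Omega> \<T> \<times> Q_mesh \<Omega> \<T>" for x
  proof -
    obtain w q where wq: "x = (w, q)" "w \<in> V_mesh \<Omega> \<T>" "q \<in> Q_mesh \<Omega> \<T>" using x by auto
    have "E \<le> consistency_const \<kappa> \<mu> \<gamma> * (en x + osc g \<T>) * l2norm \<Omega> B"
      using consistency_estimate[OF reg \<kappa> \<gamma> g st v wq(2,3)] by (simp add: E_def B_def en_def wq(1))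
    also have "\<dots> \<le> C * (en x + osc g \<T>) * l2norm \<Omega> B"
      using C en0[of x] o by (intro mult_right_mono) (auto simp: l2norm_nonneg)
    finally have "E \<le> C * (en x + osc g \<T>) * l2norm \<Omega> B" .
    \<comment> \<open>If the broken gradient has norm 0, the quotient is 0 by the convention for
      division, while the right-hand side is nonnegative.\<close>
    then show ?thesis
      unfolding e_def using l2norm_nonneg[of \<Omega> B] C en0[of x] o by (cases "l2norm \<Omega> B = 0") (auto simp: field_simps)
  qed
  have "e / C - osc g \<T> \<le> (INF x\<in>V_mesh \<Omega> \<T> \<times> Q_mesh \<Omega> \<T>. en x)"
  proof (rule cINF_greatest[OF ne])
    fix x assume "x \<in> V_mesh \<Omega> \<T> \<times> Q_mesh \<Omega> \<T>"
    then have "e / C \<le> en x + osc g \<T>" using le[of x] C by (simp add: pos_divide_le_eq mult.commute)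
    then show "e / C - osc g \<T> \<le> en x" by simp
  qed
  then have "e / C \<le> (INF x\<in>V_mesh \<Omega> \<T> \<times> Q_mesh \<Omega> \<T>. en x) + osc g \<T>" by simp
  then have "e \<le> C * ((INF x\<in>V_mesh \<Omega> \<T> \<times> Q_mesh \<Omega> \<T>. en x) + osc g \<T>)"
    using C by (simp add: pos_divide_le_eq mult.commute)
  then show "ereal ((l2inner \<Omega> g v - l2inner \<Omega> (stress \<Omega> \<mu> u p) (broken_grad \<T> v)) / l2norm \<Omega> (broken_grad \<T> v))
      \<le> ereal (C * ((INF (v, q)\<in>V_mesh \<Omega> \<T> \<times> Q_mesh \<Omega> \<T>.
        energy_norm \<Omega> \<gamma> \<T> (\<lambda>x. u x - v x) (\<lambda>x. p x - q x)) + osc g \<T>))"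
    by (simp add: e_def E_def B_def en_def)
qed

end

theorem mainTheorem6:
  fixes \<Omega> :: "(real^2) set" and \<mu> \<theta> \<gamma>\<^sub>1 :: real and \<T>\<^sub>0 :: "tri set"
    and g u :: "real^2 \<Rightarrow> real^2" and p :: "real^2 \<Rightarrow> real"
  assumes "polygonal_domain \<Omega>"
    and "\<mu> > 0"
    and "conforming_mesh \<Omega> \<T>\<^sub>0"
    and "L2 \<Omega> g"
    and "stokes_solution \<Omega> \<mu> g u p"
    and "0 < \<theta>" and "\<theta> < 1"
    and "contraction_weight \<Omega> \<mu> g \<theta> \<T>\<^sub>0 u p \<gamma>\<^sub>1"
  shows "\<exists>C>0. \<forall>\<T>. nvb_refinement \<Omega> \<T>\<^sub>0 \<T> \<longrightarrow>
    consistency_error \<Omega> g (stress \<Omega> \<mu> u p) \<T>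
    \<le> ereal (C * ((INF (v, q)\<in>V_mesh \<Omega> \<T> \<times> Q_mesh \<Omega> \<T>.
                    energy_norm \<Omega> \<gamma>\<^sub>1 \<T> (\<lambda>x. u x - v x) (\<lambda>x. p x - q x))
                  + osc g \<T>))"
proof -
  have \<gamma>: "\<gamma>\<^sub>1 > 0" using assms(8) by (simp add: contraction_weight_def)
  have is_mesh: "mesh \<Omega> \<T>" if "conforming_mesh \<Omega> \<T>" for \<T>
    using assms(1) that by unfold_locales (auto simp: polygonal_domain_def)
  interpret T0: mesh \<Omega> \<T>\<^sub>0 by (rule is_mesh[OF assms(3)])
  obtain \<kappa> where \<kappa>: "\<kappa> > 0" "\<And>\<T>. bisect_step\<^sup>*\<^sup>* \<T>\<^sub>0 \<T> \<Longrightarrow> shape_regular \<kappa> \<T>"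
    using nvb_shape_regular[OF T0.finite_mesh] T0.proper_mesh by blast
  \<comment> \<open>Fixed before the mesh, as \<kappa> serves all refinements; the summand 1 makes
    it positive.\<close>
  define C where "C = consistency_const \<kappa> \<mu> \<gamma>\<^sub>1 + 1"
  have C: "C > 0" "consistency_const \<kappa> \<mu> \<gamma>\<^sub>1 \<le> C"
    using consistency_const_nonneg[OF \<kappa>(1) \<gamma>, of \<mu>] by (auto simp: C_def)
  show ?thesis
  proof (intro exI[of _ C] conjI allI impI C(1))
    fix \<T> assume T: "nvb_refinement \<Omega> \<T>\<^sub>0 \<T>"
    then interpret T: mesh \<Omega> \<T> by (intro is_mesh) (simp add: nvb_refinement_def)
    show "consistency_error \<Omega> g (stress \<Omega> \<mu> u p) \<T>
        \<le> ereal (C * ((INF (v, q)\<in>V_mesh \<Omega> \<T> \<times> Q_mesh \<Omega> \<T>.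
                        energy_norm \<Omega> \<gamma>\<^sub>1 \<T> (\<lambda>x. u x - v x) (\<lambda>x. p x - q x))
                      + osc g \<T>))"
      by (rule T.consistency_error_le[OF \<kappa>(2) \<kappa>(1) \<gamma> assms(4,5) C(2,1)])
         (use T in \<open>simp add: nvb_refinement_def\<close>)
  qed
qed

end
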